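(* Let $\phi\in\mathfrak{M}(\overline{\mathbb{D}})$ be nonconstant, and let $\phi=\psi(B)$ be the Cowen-Thomson representation of $\phi$. Then $\psi$ has the FSI property.
   Context: $\mathbb{D}$ is the open unit disk in $\mathbb{C}$ and $\mathbb{T}$ its boundary. $\mathfrak{M}(\overline{\mathbb{D}})$ is the set of all meromorphic functions on $\mathbb{C}$ that have no pole on $\overline{\mathbb{D}}$. $\mathcal{H}$ denotes the Hardy space $H^2(\mathbb{D})$ or the Bergman space $L_a^2(\mathbb{D})$ (holomorphic functions on $\mathbb{D}$ square integrable with respect to normalized area measure); for a bounded holomorphic $f$ on $\mathbb{D}$, $T_f$ is the operator of multiplication by $f$ on $\mathcal{H}$; $\{T\}'$ denotes the commutant of a bounded operator $T$. Cowen-Thomson representation: by a theorem of Thomson and Cowen, for every nonconstant $\phi$ holomorphic on a neighborhood of $\overline{\mathbb{D}}$ there are a finite Blaschke product $B$ and a bounded holomorphic function $\psi$ on $\mathbb{D}$ such that $\phi=\psi\circ B$ on $\mathbb{D}$ and $\{T_\phi\}'=\{T_B\}'$ on $\mathcal{H}$; the identity $\phi=\psi(B)$ is called the Cowen-Thomson representation of $\phi$. It is unique modulo Moebius maps of the disk, $B$ has maximal order among all finite Blaschke products $\widetilde B$ with $\phi=\widetilde\psi\circ\widetilde B$ for some bounded holomorphic $\widetilde\psi$ on $\mathbb{D}$, and it is known that here $\psi$ is holomorphic on a neighborhood of $\overline{\mathbb{D}}$. FSI property: a function $\psi$ holomorphic on $\mathbb{D}$ and continuous on $\overline{\mathbb{D}}$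 has the FSI (finite self-intersection) property if, for all $\xi\in\mathbb{T}$ outside some finite subset of $\mathbb{T}$, the set $\{w\in\mathbb{T}:\psi(w)=\psi(\xi)\}$ has cardinality $1$. *)

theory Defs
  imports "HOL-Complex_Analysis.Complex_Analysis"
begin

text \<open>A library-\<^const>\<open>meromorphic_on\<close> function may take arbitrary values at isolated points.
  \<^const>\<open>nicely_meromorphic_on\<close> excludes this: removable singularities are filled in, and
  poles are sent to \<open>0\<close>.\<close>

definition mero_no_pole_cdisk :: "(complex \<Rightarrow> complex) set" where
  "mero_no_pole_cdisk =
     {\<phi>. \<phi> nicely_meromorphic_on UNIV \<and> (\<forall>z\<in>cball 0 1. \<not> is_pole \<phi> z)}"

definition finite_blaschke :: "(complex \<Rightarrow> complex) \<Rightarrow> bool" where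
  "finite_blaschke B \<longleftrightarrow>
     (\<exists>(n::nat) (a :: nat \<Rightarrow> complex) c. norm c = 1 \<and> (\<forall>i<n. norm (a i) < 1) \<and>
        (\<forall>z\<in>ball 0 1. B z = c * (\<Prod>i<n. (z - a i) / (1 - cnj (a i) * z))))"

datatype disk_space = Hardy | Bergman

definition hardy_mean :: "(complex \<Rightarrow> complex) \<Rightarrow> real \<Rightarrow> real" where
  "hardy_mean f r = integral {0..2 * pi} (\<lambda>t. (norm (f (of_real r * cis t)))\<^sup>2) / (2 * pi)"

text \<open>Elements of the two Hilbert spaces are holomorphic functions on the open unit disk,
  represented by their extension by \<open>0\<close>, so that HOL equality is equality in the space.\<close>

fun space_carrier :: "disk_space \<Rightarrow> (complex \<Rightarrow> complex) set" where
  "space_carrier Hardy =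
     {f. f holomorphic_on ball 0 1 \<and> (\<forall>z. z \<notin> ball 0 1 \<longrightarrow> f z = 0) \<and>
         bdd_above (hardy_mean f ` {0..<1})}"
| "space_carrier Bergman =
     {f. f holomorphic_on ball 0 1 \<and> (\<forall>z. z \<notin> ball 0 1 \<longrightarrow> f z = 0) \<and>
         set_integrable lborel (ball 0 1) (\<lambda>z. (norm (f z))\<^sup>2)}"

fun space_norm :: "disk_space \<Rightarrow> (complex \<Rightarrow> complex) \<Rightarrow> real" where
  "space_norm Hardy f = sqrt (SUP r\<in>{0..<1}. hardy_mean f r)"
| "space_norm Bergman f =
     sqrt (set_lebesgue_integral lborel (ball 0 1) (\<lambda>z. (norm (f z))\<^sup>2) / pi)"

text \<open>Only the restriction of an operator to the carrier matters; its values on other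
  functions are unconstrained.\<close>

definition bounded_operator ::
    "disk_space \<Rightarrow> ((complex \<Rightarrow> complex) \<Rightarrow> (complex \<Rightarrow> complex)) \<Rightarrow> bool" where
  "bounded_operator H S \<longleftrightarrow>
     (\<forall>f\<in>space_carrier H. S f \<in> space_carrier H) \<and>
     (\<forall>f\<in>space_carrier H. \<forall>g\<in>space_carrier H. S (\<lambda>z. f z + g z) = (\<lambda>z. S f z + S g z)) \<and>
     (\<forall>c. \<forall>f\<in>space_carrier H. S (\<lambda>z. c * f z) = (\<lambda>z. c * S f z)) \<and>
     (\<exists>K. \<forall>f\<in>space_carrier H. space_norm H (S f) \<le> K * space_norm H f)"

definition mult_operator ::
    "(complex \<Rightarrow> complex) \<Rightarrow> (complex \<Rightarrow> complex) \<Rightarrow> (complex \<Rightarrow> complex)" where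
  "mult_operator h f = (\<lambda>z. h z * f z)"

definition commutant ::
    "disk_space \<Rightarrow> ((complex \<Rightarrow> complex) \<Rightarrow> (complex \<Rightarrow> complex))
       \<Rightarrow> ((complex \<Rightarrow> complex) \<Rightarrow> (complex \<Rightarrow> complex)) set" where
  "commutant H T = {S. bounded_operator H S \<and> (\<forall>f\<in>space_carrier H. S (T f) = T (S f))}"

definition cowen_thomson_rep ::
    "disk_space \<Rightarrow> (complex \<Rightarrow> complex) \<Rightarrow> (complex \<Rightarrow> complex) \<Rightarrow> (complex \<Rightarrow> complex) \<Rightarrow> bool"
  where
  "cowen_thomson_rep H \<phi> \<psi> B \<longleftrightarrow>
     finite_blaschke B \<and>
     \<psi> holomorphic_on ball 0 1 \<and> bounded (\<psi> ` ball 0 1) \<and>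
     (\<forall>z\<in>ball 0 1. \<phi> z = \<psi> (B z)) \<and>
     commutant H (mult_operator \<phi>) = commutant H (mult_operator B)"

text \<open>The fibre of \<open>\<xi>\<close> contains \<open>\<xi>\<close>, and \<^const>\<open>card\<close> of an infinite set is \<open>0\<close>, so
  infinite fibres count as exceptional, as they should.\<close>

definition FSI_property :: "(complex \<Rightarrow> complex) \<Rightarrow> bool" where
  "FSI_property \<psi> \<longleftrightarrow>
     \<psi> holomorphic_on ball 0 1 \<and> continuous_on (cball 0 1) \<psi> \<and>
     (\<exists>F. finite F \<and> F \<subseteq> sphere 0 1 \<and>
        (\<forall>\<xi>\<in>sphere 0 1 - F. card {w \<in> sphere 0 1. \<psi> w = \<psi> \<xi>} = 1))"

end

theory Submission
  imports Defs
begin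

text \<open>Why the theorem holds. Let \<open>\<phi>\<^sup>*(z) = cnj (\<phi> (1 / cnj z))\<close> be the reflection of \<open>\<phi>\<close> in the unit
  circle. On the circle \<open>\<phi>\<^sup>*\<close> is the conjugate of \<open>\<phi>\<close>, so circle points with equal values of \<open>\<phi>\<close>
  have equal values of \<open>\<phi>\<^sup>*\<close> as well. Call \<open>z\<close> and \<open>w\<close> equivalent if some holomorphic germ takes \<open>z\<close>
  to \<open>w\<close> and preserves both \<open>\<phi>\<close> and \<open>\<phi>\<^sup>*\<close>. As \<open>\<phi>\<close> is meromorphic in the whole plane, \<open>\<phi>\<close> controls the
  members of a class in the closed disc and \<open>\<phi>\<^sup>*\<close> those outside. Hence classes are finite, and over
  the plane minus \<open>0\<close> and a set without other limit points they are the fibres of a finite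
  unbranched covering (\<open>cls_local_structure\<close>). Symmetric functions of the members of a class are
  therefore holomorphic there, and bounded ones extend over the exceptional points
  (\<open>ext_holomorphic\<close>).

  The decisive point is that the class of a point of the open disc stays in the disc
  (\<open>cls_in_disc\<close>). Outside the closed disc there is a place \<open>s\<close> near which \<open>\<phi>\<close> is unbounded: a pole,
  or \<open>\<infinity>\<close> when \<open>\<phi>\<close> is entire. Let \<open>\<beta>\<close> be the Moebius map that preserves the circle and the disc and
  has its pole at \<open>s\<close>, and let \<open>b(z)\<close> be the product of \<open>\<beta>(w)\<close> over the class of \<open>z\<close>. Classes of disc
  points avoid a neighbourhood of \<open>s\<close>, since \<open>\<phi>\<close> is bounded on them; so \<open>b\<close> is holomorphic on a
  neighbourhood of the closed disc. Classes of circle points are symmetric about the circle, so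
  \<open>\<bar>b\<bar> = 1\<close> there. By the maximum principle \<open>b\<close> maps the disc into itself, by reflection it maps
  the exterior to the exterior, and it is constant on classes.

  Consequently \<open>(S f)(z)\<close>, the sum of \<open>f(w)\<close> over the class of \<open>z\<close>, defines an operator on the Hardy
  space and on the Bergman space. It is bounded because its circular means are dominated by those
  of \<open>f\<close> on a slightly larger circle (\<open>hardy_mean_cls_sum\<close>), and it commutes with multiplication by
  \<open>\<phi>\<close>, which is constant on classes. Equality of the commutants makes it commute with multiplication
  by \<open>B\<close>; applied to the constant \<open>1\<close> this says that \<open>B(z)\<close> is the average of \<open>B\<close> over the class of
  \<open>z\<close>, whence \<open>B\<close> is constant on classes (\<open>commutant_imp_invariant\<close>).

  On the circle, local Puiseux parametrisations show that, with finitely many exceptions \<open>z\<close>, every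
  circle point \<open>w\<close> with \<open>\<phi>(w) = \<phi>(z)\<close> is equivalent to \<open>z\<close> (\<open>finite_nongerm_pairs\<close>), so that
  \<open>B(w) = B(z)\<close>. Since \<open>B\<close> maps the circle onto itself and \<open>\<psi>(B(z)) = \<phi>(z)\<close>, this is the injectivity
  of \<open>\<psi>\<close> on the circle outside a finite set of values of \<open>B\<close>.\<close>

section \<open>Reflection in the unit circle\<close>

definition mirror :: "complex \<Rightarrow> complex" where
  "mirror z = 1 / cnj z"

lemma mirror_mirror [simp]: "mirror (mirror z) = z"
  by (simp add: mirror_def)

lemma mirror_eq_0_iff [simp]: "mirror z = 0 \<longleftrightarrow> z = 0"
  by (simp add: mirror_def)

lemma mirror_eq_iff [simp]: "mirror z = mirror w \<longleftrightarrow> z = w"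
  by (metis mirror_mirror)

lemma norm_mirror: "norm (mirror z) = 1 / norm z"
  by (simp add: mirror_def norm_divide)

lemma norm_mirror_less: "1 < norm z \<Longrightarrow> norm (mirror z) < 1"
  by (simp add: norm_mirror divide_less_eq)

lemma mirror_on_circle: "norm z = 1 \<Longrightarrow> mirror z = z"
proof -
  assume "norm z = 1"
  then have "z * cnj z = 1" using complex_norm_square[of z] by simp
  then show "mirror z = z" unfolding mirror_def by (metis divide_eq_eq mult_zero_right zero_neq_one)
qed

lemma isCont_mirror: "z \<noteq> 0 \<Longrightarrow> isCont mirror z"
  unfolding mirror_def by (intro continuous_intros) auto

lemma filterlim_mirror_at: "z \<noteq> 0 \<Longrightarrow> filterlim mirror (at (mirror z)) (at z)"
  using isCont_mirror[of z]
  by (auto simp: filterlim_at isCont_def eventually_at_filter)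

lemma filterlim_mirror_nhds: "z \<noteq> 0 \<Longrightarrow> filterlim mirror (nhds (mirror z)) (nhds z)"
  using isCont_mirror[of z] by (simp add: isCont_def tendsto_at_iff_tendsto_nhds)

text \<open>Conjugation on both sides turns the antiholomorphic reflection into the holomorphic map
  \<open>u \<mapsto> 1 / u\<close>. This is how identities between values of \<open>\<phi>\<close> at reflected points become identities
  between holomorphic functions.\<close>

lemma analytic_cnj_mirror:
  assumes "g analytic_on {mirror z}" "z \<noteq> 0"
  shows "(\<lambda>u. cnj (g (mirror u))) analytic_on {z}"
proof -
  have 1: "(\<lambda>u. 1 / u) analytic_on {z}"
    by (intro analytic_intros) (use assms in auto)
  have "(cnj \<circ> g \<circ> cnj) analytic_on {1 / z}"
  proof -
    from assms(1) obtain e where e: "e > 0" "g holomorphic_on ball (mirror z) e"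
      by (auto simp: analytic_at_ball)
    have o: "open (cnj ` ball (mirror z) e)"
      unfolding image_cnj_conv_vimage_cnj by (intro open_vimage continuous_intros) auto
    moreover have "(cnj \<circ> g \<circ> cnj) holomorphic_on (cnj ` ball (mirror z) e)"
      by (rule holomorphic_on_compose_cnj_cnj) (use e o in \<open>auto simp: image_image\<close>)
    moreover have "1 / z \<in> cnj ` ball (mirror z) e"
      using e by (intro image_eqI[of _ _ "mirror z"]) (auto simp: mirror_def)
    ultimately show ?thesis by (meson analytic_at)
  qed
  then show "(\<lambda>u. cnj (g (mirror u))) analytic_on {z}"
    using analytic_on_compose[of "\<lambda>u. 1 / u" "{z}" "cnj \<circ> g \<circ> cnj"] 1
    by (simp add: o_def mirror_def)
qed

lemma analytic_mirror_conjugate: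
  assumes "g analytic_on {mirror z}" "z \<noteq> 0" "g (mirror z) \<noteq> 0"
  shows "(\<lambda>u. mirror (g (mirror u))) analytic_on {z}"
  using analytic_cnj_mirror[OF assms(1,2)] assms(3)
  unfolding mirror_def by (intro analytic_intros) auto

lemma isCont_tendsto_nhds: "isCont f a \<Longrightarrow> (f \<longlongrightarrow> f a) (nhds a)"
  by (simp add: isCont_def tendsto_at_iff_tendsto_nhds)

section \<open>Good points of a meromorphic symbol\<close>

locale nonconst_mero =
  fixes \<phi> :: "complex \<Rightarrow> complex"
  assumes mem: "\<phi> \<in> mero_no_pole_cdisk" and nonconst: "\<not> \<phi> constant_on UNIV"
begin

text \<open>The complement of the poles: removable singularities of \<open>\<phi>\<close> are filled in.\<close>

definition N :: "complex set" where "N = {z. \<phi> analytic_on {z}}"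

lemma nicely: "\<phi> nicely_meromorphic_on UNIV"
  using mem by (simp add: mero_no_pole_cdisk_def)

lemma pole_outside_N: "z \<notin> N \<Longrightarrow> is_pole \<phi> z"
  using nicely nicely_meromorphic_on_imp_analytic_at[of \<phi> UNIV z] by (auto simp: N_def)

lemma cball_subset_N: "cball 0 1 \<subseteq> N"
  using mem pole_outside_N unfolding mero_no_pole_cdisk_def by auto

lemma open_N: "open N"
proof (subst open_subopen, intro ballI)
  fix z assume "z \<in> N"
  then obtain s where "open s" "z \<in> s" "\<phi> holomorphic_on s" by (auto simp: N_def analytic_at)
  moreover from this have "s \<subseteq> N" unfolding N_def by (auto intro: holomorphic_on_imp_analytic_at)
  ultimately show "\<exists>T. open T \<and> z \<in> T \<and> T \<subseteq> N" by blast
qed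

lemma phi_analytic: "z \<in> N \<Longrightarrow> \<phi> analytic_on {z}"
  by (simp add: N_def)

lemma phi_isCont: "z \<in> N \<Longrightarrow> isCont \<phi> z"
  by (simp add: N_def analytic_at_imp_isCont)

lemma phi_holomorphic: "\<phi> holomorphic_on N"
  using phi_analytic analytic_imp_holomorphic analytic_on_analytic_at by blast

lemma eventually_ne: "\<forall>\<^sub>F z in at x. \<phi> z \<noteq> c"
proof (rule ccontr)
  assume "\<not> ?thesis"
  then have "\<exists>\<^sub>F z in at x. \<phi> z = c" by (simp add: not_eventually)
  from frequently_eq_meromorphic_imp_constant[OF this nicely]
  have "\<phi> constant_on UNIV" by (auto simp: constant_on_def)
  with nonconst show False by simp
qed

lemma eventually_in_N: "\<forall>\<^sub>F z in at x. z \<in> N"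
proof -
  have "\<forall>\<^sub>F z in at x. \<not> is_pole \<phi> z"
    using nicely unfolding nicely_meromorphic_on_def
    by (metis UNIV_I eventually_not_pole meromorphic_onE)
  then show ?thesis by (rule eventually_mono) (use pole_outside_N in auto)
qed

text \<open>An infinite level set would have a limit point in \<open>K\<close>, against the identity theorem.\<close>

lemma finite_level_set:
  assumes "compact K" "K \<subseteq> N"
  shows "finite {z\<in>K. \<phi> z = c}"
proof (rule ccontr)
  assume "infinite {z\<in>K. \<phi> z = c}"
  then obtain x where "x \<in> K" "x islimpt {z\<in>K. \<phi> z = c}"
    using assms(1) by (auto simp: compact_eq_Bolzano_Weierstrass)
  then have "\<exists>\<^sub>F z in at x. \<phi> z = c"
    unfolding islimpt_conv_frequently_at by (erule_tac frequently_elim1) auto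
  with eventually_ne[of c x] show False by (simp add: frequently_def)
qed

definition crit :: "complex set" where
  "crit = {z\<in>cball 0 1. deriv \<phi> z = 0}"

lemma finite_crit: "finite crit"
proof (rule ccontr)
  assume "infinite crit"
  then obtain x where x: "x \<in> cball 0 1" "x islimpt crit"
    using compact_cball[of "0::complex" 1] unfolding compact_eq_Bolzano_Weierstrass crit_def by force
  then obtain e where e: "e > 0" "\<phi> holomorphic_on ball x e"
    using cball_subset_N phi_analytic by (metis analytic_at_ball subsetD)
  have 0: "deriv \<phi> z = 0" if "z \<in> ball x e" for z
  proof (rule analytic_continuation[of "deriv \<phi>" "ball x e" "crit \<inter> ball x e" x])
    show "deriv \<phi> holomorphic_on ball x e" using e holomorphic_deriv by blast
    show "x islimpt (crit \<inter> ball x e)" using x(2) e unfolding islimpt_conv_frequently_at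
      by (elim frequently_eventually_frequently[THEN frequently_elim1])
         (auto simp: eventually_at dist_commute intro!: exI[of _ e])
  qed (use e that in \<open>auto simp: crit_def\<close>)
  have "\<exists>c. \<forall>z\<in>ball x e. \<phi> z = c"
  proof (rule has_field_derivative_zero_constant)
    show "(\<phi> has_field_derivative 0) (at z within ball x e)" if "z \<in> ball x e" for z
      using holomorphic_derivI[OF e(2) open_ball that] 0[OF that]
      by (simp add: has_field_derivative_at_within)
  qed auto
  then obtain c where "\<And>z. z \<in> ball x e \<Longrightarrow> \<phi> z = c" by blast
  then have "\<forall>\<^sub>F z in at x. \<phi> z = c"
    using e(1) by (auto simp: eventually_at dist_commute intro!: exI[of _ e])
  with eventually_ne[of c x] have "\<forall>\<^sub>F z in at x. False" by eventually_elim simp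
  then show False by simp
qed

text \<open>The value at \<open>0\<close> is excluded along with the critical values because \<open>0\<close> is the reflection of \<open>\<infinity>\<close>:
  a point with \<open>\<phi>(1 / cnj z) = \<phi>(0)\<close> could have \<open>\<infinity>\<close> in its class.\<close>

definition V :: "complex set" where "V = insert (\<phi> 0) (\<phi> ` crit)"

text \<open>The good points. For nonzero points goodness is a condition on the values, possibly infinite,
  of \<open>\<phi>\<close> at the point and at its reflection, so it passes to all points with the same two values; and
  \<open>\<phi>\<close> is locally injective at every point of the closed disc where it takes the value of a good
  point. The bad points can accumulate only at \<open>0\<close> and \<open>\<infinity>\<close>.\<close>

definition G :: "complex set" where
  "G = {z. z \<noteq> 0 \<and> z \<in> N \<and> mirror z \<in> N \<and> \<phi> z \<notin> V \<and> \<phi> (mirror z) \<notin> V}"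

lemma finite_V: "finite V" by (simp add: V_def finite_crit)

lemma eventually_G: assumes "x \<noteq> 0" shows "\<forall>\<^sub>F z in at x. z \<in> G"
proof -
  have *: "\<forall>\<^sub>F z in at y. z \<in> N \<and> \<phi> z \<notin> V" for y
  proof -
    have "\<forall>\<^sub>F z in at y. \<forall>v\<in>V. \<phi> z \<noteq> v"
      using finite_V eventually_ne by (simp add: eventually_ball_finite)
    with eventually_in_N[of y] show ?thesis by eventually_elim auto
  qed
  have "\<forall>\<^sub>F z in at x. mirror z \<in> N \<and> \<phi> (mirror z) \<notin> V"
    using eventually_compose_filterlim[OF *[of "mirror x"] filterlim_mirror_at[OF assms]] .
  moreover have "\<forall>\<^sub>F z in at x. z \<noteq> 0"
    using assms by (metis eventually_neq_at_within)
  ultimately show ?thesis using *[of x] by eventually_elim (auto simp: G_def)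
qed

lemma G_sparse: "- G sparse_in (- {0})"
  by (subst sparse_in_eventually_iff) (use eventually_G in auto)

lemma open_G: "open G"
proof -
  have "open (- {0::complex} - - G)"
    by (rule open_diff_sparse_pts[OF _ G_sparse]) auto
  moreover have "- {0::complex} - - G = G" by (auto simp: G_def)
  ultimately show ?thesis by simp
qed

lemma connected_Int_G:
  assumes "open D" "connected D" "0 \<notin> D" shows "connected (D \<inter> G)"
proof -
  have "connected (D - - G)"
    by (rule sparse_imp_connected) (use assms G_sparse in \<open>auto intro: sparse_in_subset\<close>)
  then show ?thesis by (simp add: Diff_eq)
qed

lemma connected_G: "connected G"
proof -
  have "connected (- {0::complex})" by (rule connected_punctured_universe) simp
  then have "connected ((- {0}) \<inter> G)" by (intro connected_Int_G) auto
  moreover have "- {0::complex} \<inter> G = G" by (auto simp: G_def)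
  ultimately show ?thesis by simp
qed

lemma countable_Compl_G: "countable (- G)"
proof -
  have "countable (- {0} \<inter> - G)" by (rule sparse_imp_countable[OF _ G_sparse]) auto
  then have "countable (insert 0 (- {0} \<inter> - G))" by simp
  then show ?thesis by (rule countable_subset[rotated]) auto
qed

lemma G_dense: "at x within G \<noteq> bot"
proof -
  have "x islimpt G"
  proof (rule islimptI)
    fix T assume "x \<in> T" "open T"
    then obtain e where e: "e > 0" "ball x e \<subseteq> T" by (meson open_contains_ball)
    have "countable (insert x (- G))" using countable_Compl_G by simp
    then have "\<not> ball x e \<subseteq> insert x (- G)"
      using uncountable_ball[OF e(1), of x] countable_subset by blast
    then show "\<exists>y\<in>G. y \<in> T \<and> y \<noteq> x" using e by auto
  qed
  then show ?thesis by (simp add: trivial_limit_within)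
qed

lemma mirror_G: "z \<in> G \<Longrightarrow> mirror z \<in> G"
  by (auto simp: G_def)

lemma mirror_G_iff [simp]: "mirror z \<in> G \<longleftrightarrow> z \<in> G"
  by (metis mirror_G mirror_mirror)

section \<open>Germs preserving the symbol and its reflection\<close>

text \<open>The second equation says that \<open>g\<close> preserves \<open>\<phi>\<^sup>*\<close>; conjugation on both sides is dropped.\<close>

definition germ :: "(complex \<Rightarrow> complex) \<Rightarrow> complex \<Rightarrow> bool" where
  "germ g z \<longleftrightarrow> g analytic_on {z} \<and>
     (\<forall>\<^sub>F u in nhds z. \<phi> (g u) = \<phi> u \<and> \<phi> (mirror (g u)) = \<phi> (mirror u))"

text \<open>Classes consist of points joined by a germ, not merely of solutions of the two equations
  \<open>\<phi>(w) = \<phi>(z)\<close> and \<open>\<phi>\<^sup>*(w) = \<phi>\<^sup>*(z)\<close>: two analytic curves can also meet in isolated points, which would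
  destroy the covering property.\<close>

definition cls :: "complex \<Rightarrow> complex set" where
  "cls z = {w. z \<in> G \<and> w \<in> G \<and> (\<exists>g. g z = w \<and> germ g z)}"

lemma cls_G: "w \<in> cls z \<Longrightarrow> z \<in> G" "w \<in> cls z \<Longrightarrow> w \<in> G"
  by (auto simp: cls_def)

lemma cls_phi:
  assumes "w \<in> cls z"
  shows "\<phi> w = \<phi> z" "\<phi> (mirror w) = \<phi> (mirror z)"
proof -
  obtain g where g: "g z = w" "\<forall>\<^sub>F u in nhds z. \<phi> (g u) = \<phi> u \<and> \<phi> (mirror (g u)) = \<phi> (mirror u)"
    using assms by (auto simp: cls_def germ_def)
  from eventually_nhds_x_imp_x[OF g(2)] g(1) show "\<phi> w = \<phi> z" "\<phi> (mirror w) = \<phi> (mirror z)" by auto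
qed

lemma cls_refl: "z \<in> G \<Longrightarrow> z \<in> cls z"
  unfolding cls_def germ_def by (auto intro!: exI[of _ "\<lambda>u. u"] analytic_intros)

lemma eventually_nhds_germ:
  assumes "germ g z" "eventually P (nhds (g z))"
  shows "\<forall>\<^sub>F u in nhds z. P (g u)"
proof -
  have "isCont g z" using assms(1) by (simp add: germ_def analytic_at_imp_isCont)
  then have "filterlim g (nhds (g z)) (nhds z)"
    by (simp add: isCont_def tendsto_at_iff_tendsto_nhds)
  then show ?thesis using assms(2) by (rule eventually_compose_filterlim[rotated])
qed

lemma germ_compose:
  assumes "germ g z" "germ h (g z)"
  shows "germ (h \<circ> g) z"
proof -
  have "\<forall>\<^sub>F u in nhds z. \<phi> (h (g u)) = \<phi> (g u) \<and> \<phi> (mirror (h (g u))) = \<phi> (mirror (g u))"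
    by (rule eventually_nhds_germ[OF assms(1)]) (use assms(2) in \<open>simp add: germ_def\<close>)
  moreover have "\<forall>\<^sub>F u in nhds z. \<phi> (g u) = \<phi> u \<and> \<phi> (mirror (g u)) = \<phi> (mirror u)"
    using assms(1) by (simp add: germ_def)
  ultimately have "\<forall>\<^sub>F u in nhds z. \<phi> (h (g u)) = \<phi> u \<and> \<phi> (mirror (h (g u))) = \<phi> (mirror u)"
    by eventually_elim simp
  moreover have "(h \<circ> g) analytic_on {z}"
    using assms by (intro analytic_on_compose) (auto simp: germ_def)
  ultimately show ?thesis by (simp add: germ_def)
qed

lemma cls_trans: "w \<in> cls z \<Longrightarrow> v \<in> cls w \<Longrightarrow> v \<in> cls z"
  unfolding cls_def using germ_compose by (auto simp: o_def)

lemma germ_mirror: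
  assumes "germ g z" "z \<noteq> 0" "g z \<noteq> 0"
  shows "germ (\<lambda>u. mirror (g (mirror u))) (mirror z)"
proof -
  have "\<forall>\<^sub>F u in nhds (mirror z). \<phi> (g (mirror u)) = \<phi> (mirror u) \<and>
          \<phi> (mirror (g (mirror u))) = \<phi> (mirror (mirror u))"
    using eventually_compose_filterlim[OF _ filterlim_mirror_nhds[of "mirror z"], of
       "\<lambda>u. \<phi> (g u) = \<phi> u \<and> \<phi> (mirror (g u)) = \<phi> (mirror u)"] assms by (auto simp: germ_def)
  then have "\<forall>\<^sub>F u in nhds (mirror z). \<phi> (mirror (g (mirror u))) = \<phi> u \<and>
          \<phi> (mirror (mirror (g (mirror u)))) = \<phi> (mirror u)"
    by eventually_elim simp
  moreover have "(\<lambda>u. mirror (g (mirror u))) analytic_on {mirror z}"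
    by (rule analytic_mirror_conjugate) (use assms in \<open>auto simp: germ_def\<close>)
  ultimately show ?thesis by (simp add: germ_def)
qed

lemma cls_mirror: assumes "w \<in> cls z" shows "mirror w \<in> cls (mirror z)"
proof -
  obtain g where g: "g z = w" "germ g z" "z \<in> G" "w \<in> G" using assms by (auto simp: cls_def)
  then have "z \<noteq> 0" "g z \<noteq> 0" by (auto simp: G_def)
  from germ_mirror[OF g(2) this] g show ?thesis
    by (auto simp: cls_def intro!: exI[of _ "\<lambda>u. mirror (g (mirror u))"])
qed

lemma cls_mirror_eq: "cls (mirror z) = mirror ` cls z"
proof (intro equalityI subsetI)
  fix w assume "w \<in> cls (mirror z)"
  then have "mirror w \<in> cls z" using cls_mirror[of w "mirror z"] by simp
  then show "w \<in> mirror ` cls z" by (intro image_eqI[of _ _ "mirror w"]) auto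
qed (use cls_mirror in auto)

text \<open>The value \<open>\<phi>(u0)\<close> is not critical on the closed disc, so \<open>\<phi>\<close> has a local inverse near \<open>u0\<close>.
  Following \<open>\<phi>\<close> near \<open>z0\<close> by it gives the only germ at \<open>z0\<close> that preserves \<open>\<phi>\<close> and takes \<open>z0\<close> to
  \<open>u0\<close>, in the strong form that all solutions near \<open>(z0, u0)\<close> lie on its graph.\<close>

lemma local_inverse:
  assumes "norm u0 \<le> 1" "\<phi> u0 \<notin> V" "z0 \<in> N" "\<phi> z0 = \<phi> u0"
  obtains e d g where "e > 0" "d > 0" "g holomorphic_on ball z0 e" "g z0 = u0"
    "ball z0 e \<subseteq> N" "ball u0 d \<subseteq> N"
    "\<And>z. z \<in> ball z0 e \<Longrightarrow> g z \<in> ball u0 d"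
    "\<And>z. z \<in> ball z0 e \<Longrightarrow> \<phi> (g z) = \<phi> z"
    "\<And>z u. z \<in> ball z0 e \<Longrightarrow> u \<in> ball u0 d \<Longrightarrow> \<phi> u = \<phi> z \<Longrightarrow> u = g z"
proof -
  have u0: "u0 \<in> N" using assms cball_subset_N by auto
  have "deriv \<phi> u0 \<noteq> 0" using assms by (auto simp: V_def crit_def)
  then obtain d where d: "d > 0" "ball u0 d \<subseteq> N" "open (\<phi> ` ball u0 d)" "inj_on \<phi> (ball u0 d)"
    using has_complex_derivative_locally_invertible[OF phi_holomorphic u0 open_N] by metis
  have hol: "\<phi> holomorphic_on ball u0 d" using phi_holomorphic d(2) holomorphic_on_subset by blast
  from holomorphic_has_inverse[OF hol open_ball d(4)]
  obtain h where h: "h holomorphic_on \<phi> ` ball u0 d" "\<And>z. z \<in> ball u0 d \<Longrightarrow> h (\<phi> z) = z" by metis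
  have "\<phi> z0 \<in> \<phi> ` ball u0 d" using assms d by auto
  then have "\<forall>\<^sub>F z in nhds z0. \<phi> z \<in> \<phi> ` ball u0 d"
    using phi_isCont[OF assms(3)] d(3)
    by (simp add: isCont_def tendsto_at_iff_tendsto_nhds topological_tendstoD)
  moreover have "\<forall>\<^sub>F z in nhds z0. z \<in> N" using open_N assms(3) by (simp add: eventually_nhds_in_open)
  ultimately have "\<forall>\<^sub>F z in nhds z0. \<phi> z \<in> \<phi> ` ball u0 d \<and> z \<in> N" by eventually_elim auto
  then obtain e where e: "e > 0" "\<And>z. z \<in> ball z0 e \<Longrightarrow> \<phi> z \<in> \<phi> ` ball u0 d \<and> z \<in> N"
    by (auto simp: eventually_nhds_metric dist_commute)
  show ?thesis
  proof (rule that[of e d "h \<circ> \<phi>"])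
    have "\<phi> holomorphic_on ball z0 e" using phi_holomorphic e(2) holomorphic_on_subset by blast
    then show "h \<circ> \<phi> holomorphic_on ball z0 e"
      by (rule holomorphic_on_compose_gen[OF _ h(1)]) (use e in auto)
    show "(h \<circ> \<phi>) z0 = u0" using assms h d by auto
    show "(h \<circ> \<phi>) z \<in> ball u0 d" "\<phi> ((h \<circ> \<phi>) z) = \<phi> z" if "z \<in> ball z0 e" for z
      using e(2)[OF that] h(2) by (auto simp: image_iff)
    show "u = (h \<circ> \<phi>) z" if "z \<in> ball z0 e" "u \<in> ball u0 d" "\<phi> u = \<phi> z" for z u
      using h(2)[OF that(2)] that(3) by simp
  qed (use e d in auto)
qed

text \<open>In the closed disc \<open>\<phi>\<close> is locally injective at \<open>z\<close>, so a germ taking \<open>z\<close> to \<open>w\<close> has an inverse germ.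
  Outside, the same argument applies after reflection.\<close>

lemma cls_sym_disc:
  assumes "w \<in> cls z" "norm z \<le> 1" shows "z \<in> cls w"
proof -
  obtain h where h: "h z = w" "germ h z" and G: "z \<in> G" "w \<in> G" using assms by (auto simp: cls_def)
  have phi: "\<phi> w = \<phi> z" using cls_phi assms by blast
  obtain e d g where g: "e > 0" "d > 0" "g holomorphic_on ball w e" "g w = z"
    "\<And>v u. v \<in> ball w e \<Longrightarrow> u \<in> ball z d \<Longrightarrow> \<phi> u = \<phi> v \<Longrightarrow> u = g v"
    by (rule local_inverse[of z w]) (use assms(2) G phi in \<open>auto simp: G_def\<close>)
  obtain s where s: "open s" "z \<in> s" "h holomorphic_on s" using h by (auto simp: germ_def analytic_at)
  have "\<forall>\<^sub>F u in nhds z. h u \<in> ball w e"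
    using g h by (intro eventually_nhds_germ[OF h(2)] eventually_nhds_in_open) auto
  moreover have "\<forall>\<^sub>F u in nhds z. u \<in> ball z d" using g by (intro eventually_nhds_in_open) auto
  moreover have "\<forall>\<^sub>F u in nhds z. \<phi> (h u) = \<phi> u \<and> \<phi> (mirror (h u)) = \<phi> (mirror u)"
    using h by (simp add: germ_def)
  moreover have "\<forall>\<^sub>F u in nhds z. u \<in> s" using s by (intro eventually_nhds_in_open)
  ultimately have "\<forall>\<^sub>F u in nhds z. u \<in> s \<and> g (h u) = u \<and> \<phi> (h u) = \<phi> u \<and> \<phi> (mirror (h u)) = \<phi> (mirror u)"
    by eventually_elim (use g(5) in fastforce)
  then obtain r where r: "r > 0" and inv: "\<And>u. u \<in> ball z r \<Longrightarrow> u \<in> s \<and> g (h u) = u \<and> \<phi> (h u) = \<phi> u \<and> \<phi> (mirror (h u)) = \<phi> (mirror u)"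
    by (auto simp: eventually_nhds_metric dist_commute)
  have "inj_on h (ball z r)" using inv by (metis inj_onI)
  moreover have "h holomorphic_on ball z r" using s(3) inv holomorphic_on_subset by blast
  ultimately have "open (h ` ball z r)" using open_mapping_thm3 by blast
  then have "\<forall>\<^sub>F v in nhds w. v \<in> h ` ball z r"
    by (rule eventually_nhds_in_open) (use h r in auto)
  then have "\<forall>\<^sub>F v in nhds w. \<phi> (g v) = \<phi> v \<and> \<phi> (mirror (g v)) = \<phi> (mirror v)"
    by eventually_elim (use inv in auto)
  moreover have "g analytic_on {w}" using g(1,3) by (meson analytic_at_ball)
  ultimately have "germ g w" by (simp add: germ_def)
  then show ?thesis using g(4) G by (auto simp: cls_def)
qed

lemma cls_sym: assumes "w \<in> cls z" shows "z \<in> cls w"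
proof (cases "norm z \<le> 1")
  case False
  then have "norm (mirror z) \<le> 1" using norm_mirror_less[of z] by simp
  from cls_sym_disc[OF cls_mirror[OF assms] this] have "mirror (mirror z) \<in> cls (mirror (mirror w))"
    by (rule cls_mirror)
  then show ?thesis by simp
qed (use cls_sym_disc assms in auto)

lemma cls_eq: "w \<in> cls z \<Longrightarrow> cls w = cls z"
  using cls_sym cls_trans by blast

text \<open>Members in the closed disc solve \<open>\<phi>(w) = \<phi>(z)\<close>; the reflections of the others solve the
  corresponding equation at the reflected point.\<close>

lemma finite_cls: "finite (cls z)"
proof -
  let ?K = "\<lambda>c. {u \<in> cball 0 1. \<phi> u = c}"
  have "cls z \<subseteq> ?K (\<phi> z) \<union> mirror ` ?K (\<phi> (mirror z))"
  proof
    fix w assume w: "w \<in> cls z"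
    show "w \<in> ?K (\<phi> z) \<union> mirror ` ?K (\<phi> (mirror z))"
    proof (cases "norm w \<le> 1")
      case False
      then have "mirror w \<in> ?K (\<phi> (mirror z))" using cls_phi(2)[OF w] norm_mirror_less[of w] by simp
      then have "mirror (mirror w) \<in> mirror ` ?K (\<phi> (mirror z))" by blast
      then show ?thesis by simp
    qed (use cls_phi[OF w] in auto)
  qed
  moreover have "finite (?K c)" for c using finite_level_set[OF _ cball_subset_N] by auto
  ultimately show ?thesis by (meson finite_UnI finite_imageI finite_subset)
qed

lemma germ_eventually_cls:
  assumes "germ g z" "z \<in> G" "g z \<in> G"
  shows "\<forall>\<^sub>F u in nhds z. g u \<in> cls u"
proof -
  have "\<forall>\<^sub>F u in nhds z. \<forall>\<^sub>F v in nhds u. \<phi> (g v) = \<phi> v \<and> \<phi> (mirror (g v)) = \<phi> (mirror v)"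
    using assms(1) by (simp add: germ_def eventually_eventually)
  moreover have "\<forall>\<^sub>F u in nhds z. g u \<in> G"
    by (rule eventually_nhds_germ[OF assms(1)], rule eventually_nhds_in_open[OF open_G assms(3)])
  moreover have "\<forall>\<^sub>F u in nhds z. u \<in> G"
    using assms open_G by (intro eventually_nhds_in_open)
  moreover have "\<forall>\<^sub>F u in nhds z. g analytic_on {u}"
  proof -
    from assms obtain s where s: "open s" "z \<in> s" "g holomorphic_on s" by (auto simp: germ_def analytic_at)
    then have "\<forall>\<^sub>F u in nhds z. u \<in> s" by (intro eventually_nhds_in_open)
    then show ?thesis by eventually_elim (use s in \<open>auto simp: analytic_at\<close>)
  qed
  ultimately show ?thesis by eventually_elim (auto simp: cls_def germ_def)
qed

lemma eventually_analytic_identity: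
  assumes "f analytic_on {z}" "h analytic_on {z}"
    and "\<exists>\<^sub>F u in nhds z. \<forall>\<^sub>F v in nhds u. f v = h v"
  shows "\<forall>\<^sub>F v in nhds z. f v = h v"
proof -
  obtain r1 r2 where "r1 > 0" "f holomorphic_on ball z r1" "r2 > 0" "h holomorphic_on ball z r2"
    using assms(1,2) by (auto simp: analytic_at_ball)
  define r where "r = min r1 r2"
  have r: "r > 0" "f holomorphic_on ball z r" "h holomorphic_on ball z r"
    using \<open>r1 > 0\<close> \<open>r2 > 0\<close> \<open>f holomorphic_on ball z r1\<close> \<open>h holomorphic_on ball z r2\<close>
    unfolding r_def by (auto elim: holomorphic_on_subset)
  have "\<forall>\<^sub>F u in nhds z. u \<in> ball z r" using r by (intro eventually_nhds_in_open) auto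
  with assms(3) have "\<exists>\<^sub>F u in nhds z. (\<forall>\<^sub>F v in nhds u. f v = h v) \<and> u \<in> ball z r"
    by (rule frequently_eventually_frequently)
  then obtain u where u: "\<forall>\<^sub>F v in nhds u. f v = h v" "u \<in> ball z r" by (auto dest: frequently_ex)
  have "\<forall>\<^sub>F v in nhds u. v \<in> ball z r" using u by (intro eventually_nhds_in_open) auto
  with u(1) have "\<forall>\<^sub>F v in nhds u. f v = h v \<and> v \<in> ball z r" by eventually_elim auto
  then obtain S where S: "open S" "u \<in> S" "\<And>v. v \<in> S \<Longrightarrow> f v = h v \<and> v \<in> ball z r"
    by (auto simp: eventually_nhds)
  have "f v = h v" if "v \<in> ball z r" for v
    by (rule analytic_continuation_open[of S "ball z r" f h]) (use S r that in auto)
  moreover have "\<forall>\<^sub>F v in nhds z. v \<in> ball z r" using r by (intro eventually_nhds_in_open) auto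
  ultimately show ?thesis by (auto elim: eventually_mono)
qed

lemma eventually_neq_values:
  assumes "isCont f a" "isCont g b" "f a \<noteq> (g b :: complex)"
  shows "\<exists>U. open U \<and> a \<in> U \<and> (\<forall>\<^sub>F u in nhds b. \<forall>v\<in>U. f v \<noteq> g u)"
proof -
  obtain A B where AB: "open A" "open B" "f a \<in> A" "g b \<in> B" "A \<inter> B = {}"
    using hausdorff[OF assms(3)] by metis
  have "\<forall>\<^sub>F v in nhds a. f v \<in> A" using assms(1) AB
    by (simp add: isCont_def tendsto_at_iff_tendsto_nhds topological_tendstoD)
  then obtain U where U: "open U" "a \<in> U" "\<And>v. v \<in> U \<Longrightarrow> f v \<in> A" by (auto simp: eventually_nhds)
  have "\<forall>\<^sub>F u in nhds b. g u \<in> B" using assms(2) AB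
    by (simp add: isCont_def tendsto_at_iff_tendsto_nhds topological_tendstoD)
  then have "\<forall>\<^sub>F u in nhds b. \<forall>v\<in>U. f v \<noteq> g u"
  proof eventually_elim
    case (elim u)
    have "f v \<noteq> g u" if "v \<in> U" for v using U(3)[OF that] elim AB(5) by auto
    then show ?case by blast
  qed
  then show ?thesis using U by blast
qed

lemma isCont_phi_mirror: "z \<noteq> 0 \<Longrightarrow> mirror z \<in> N \<Longrightarrow> isCont (\<lambda>u. \<phi> (mirror u)) z"
  using isCont_o2[OF isCont_mirror phi_isCont] by simp

text \<open>No unexpected members appear near \<open>v0\<close>. If \<open>v0\<close> does not solve both equations at \<open>z0\<close>, continuity
  keeps members of nearby classes away. If it does, a member near \<open>v0\<close> of a class near \<open>z0\<close> lies on the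
  graph of the local inverse, and by the identity theorem this graph is then itself a germ at \<open>z0\<close>
  preserving both functions, so that \<open>v0\<close> is in the class of \<open>z0\<close>.\<close>

lemma cls_local_near_point:
  assumes z0: "z0 \<in> G" and g: "\<And>w. w \<in> cls z0 \<Longrightarrow> germ (g w) z0 \<and> g w z0 = w"
    and v0: "norm v0 \<le> 1"
  shows "\<exists>U. open U \<and> v0 \<in> U \<and> (\<forall>\<^sub>F u in nhds z0. \<forall>v\<in>cls u \<inter> U. \<exists>w\<in>cls z0. v = g w u)"
proof -
  have v0N: "v0 \<in> N" using v0 cball_subset_N by auto
  have z0': "z0 \<noteq> 0" "z0 \<in> N" "mirror z0 \<in> N" "\<phi> z0 \<notin> V" "\<phi> (mirror z0) \<notin> V"
    using z0 by (auto simp: G_def)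
  have sep: ?thesis if "open U" "v0 \<in> U" "\<forall>\<^sub>F u in nhds z0. \<forall>v\<in>U. v \<notin> cls u" for U
    by (rule exI[of _ U], use that in \<open>auto elim: eventually_mono\<close>)
  show ?thesis
  proof (cases "\<phi> v0 = \<phi> z0")
    case False
    obtain U where U: "open U" "v0 \<in> U" "\<forall>\<^sub>F u in nhds z0. \<forall>v\<in>U. \<phi> v \<noteq> \<phi> u"
      using eventually_neq_values[where f = \<phi> and a = v0 and g = \<phi> and b = z0] phi_isCont v0N z0' False by blast
    show ?thesis
      by (rule sep[OF U(1,2)], rule eventually_mono[OF U(3)]) (use cls_phi in blast)
  next
    case eq: True
    then have v00: "v0 \<noteq> 0" using z0' by (auto simp: V_def)
    show ?thesis
    proof (cases "mirror v0 \<in> N")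
      case False
      then have "is_pole \<phi> (mirror v0)" by (rule pole_outside_N)
      then have lim: "filterlim (\<lambda>v. \<phi> (mirror v)) at_infinity (at v0)"
        unfolding is_pole_def by (rule filterlim_compose[OF _ filterlim_mirror_at[OF v00]])
      then have "\<forall>\<^sub>F v in at v0. norm (\<phi> (mirror z0)) + 1 \<le> norm (\<phi> (mirror v))"
        unfolding filterlim_at_infinity[OF order_refl[of 0]]
        by (rule allE[of _ "norm (\<phi> (mirror z0)) + 1"]) (auto simp: add_nonneg_pos)
      then obtain U where U: "open U" "v0 \<in> U" "\<And>v. v \<in> U \<Longrightarrow> v \<noteq> v0 \<Longrightarrow> norm (\<phi> (mirror z0)) + 1 \<le> norm (\<phi> (mirror v))"
        by (auto simp: eventually_at_topological)
      have "((\<lambda>u. norm (\<phi> (mirror u))) \<longlongrightarrow> norm (\<phi> (mirror z0))) (nhds z0)"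
        by (intro tendsto_norm isCont_tendsto_nhds[OF isCont_phi_mirror[OF z0'(1,3)]])
      then have "\<forall>\<^sub>F u in nhds z0. norm (\<phi> (mirror u)) < norm (\<phi> (mirror z0)) + 1"
        by (rule order_tendstoD) simp
      then show ?thesis
      proof (intro sep[OF U(1,2)], elim eventually_mono, intro ballI notI)
        fix u v assume *: "norm (\<phi> (mirror u)) < norm (\<phi> (mirror z0)) + 1" "v \<in> U" "v \<in> cls u"
        have "v \<noteq> v0" using cls_G[OF *(3)] False by (auto simp: G_def)
        from U(3)[OF *(2) this] cls_phi[OF *(3)] *(1) show False by simp
      qed
    next
      case mN: True
      show ?thesis
      proof (cases "\<phi> (mirror v0) = \<phi> (mirror z0)")
        case False
        obtain U where U: "open U" "v0 \<in> U" "\<forall>\<^sub>F u in nhds z0. \<forall>v\<in>U. \<phi> (mirror v) \<noteq> \<phi> (mirror u)"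
          using eventually_neq_values[where f = "\<lambda>u. \<phi> (mirror u)" and a = v0 and g = "\<lambda>u. \<phi> (mirror u)" and b = z0]
            isCont_phi_mirror mN v00 z0' False by blast
        show ?thesis
          by (rule sep[OF U(1,2)], rule eventually_mono[OF U(3)]) (use cls_phi in blast)
      next
        case eq2: True
        have v0G: "v0 \<in> G" using v00 v0N mN eq eq2 z0' by (auto simp: G_def)
        obtain e d h where h: "e > 0" "d > 0" "h holomorphic_on ball z0 e" "h z0 = v0"
           "\<And>z. z \<in> ball z0 e \<Longrightarrow> h z \<in> ball v0 d"
           "\<And>z. z \<in> ball z0 e \<Longrightarrow> \<phi> (h z) = \<phi> z"
           "\<And>z u. z \<in> ball z0 e \<Longrightarrow> u \<in> ball v0 d \<Longrightarrow> \<phi> u = \<phi> z \<Longrightarrow> u = h z"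
          by (rule local_inverse[of v0 z0]) (use v0 eq z0' in auto)
        have han: "h analytic_on {z0}" using h(1,3) by (meson analytic_at_ball)
        have local_h: "\<forall>\<^sub>F v in nhds u. k v = h v"
          if "u \<in> ball z0 e" "k analytic_on {u}" "k u = h u" "\<forall>\<^sub>F v in nhds u. \<phi> (k v) = \<phi> v" for u k
        proof -
          have "filterlim k (nhds (k u)) (nhds u)"
            using analytic_at_imp_isCont[OF that(2)] by (simp add: isCont_def tendsto_at_iff_tendsto_nhds)
          moreover have "\<forall>\<^sub>F v in nhds (k u). v \<in> ball v0 d"
            using h(5)[OF that(1)] that(3) by (intro eventually_nhds_in_open) auto
          ultimately have "\<forall>\<^sub>F v in nhds u. k v \<in> ball v0 d" by (rule eventually_compose_filterlim[rotated])
          moreover have "\<forall>\<^sub>F v in nhds u. v \<in> ball z0 e"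
            using that(1) by (intro eventually_nhds_in_open) auto
          ultimately show ?thesis using that(4) by eventually_elim (use h(7) in auto)
        qed
        show ?thesis
        proof (cases "\<exists>\<^sub>F u in nhds z0. \<exists>v \<in> cls u \<inter> ball v0 d. True")
          case False
          then have "\<forall>\<^sub>F u in nhds z0. \<forall>v\<in>ball v0 d. v \<notin> cls u"
            by (simp add: not_frequently) (auto elim: eventually_mono)
          then show ?thesis by (intro sep[of "ball v0 d"]) (use h in auto)
        next
          case True
          have inb: "\<forall>\<^sub>F u in nhds z0. u \<in> ball z0 e" using h(1) by (intro eventually_nhds_in_open) auto
          have "\<exists>\<^sub>F u in nhds z0. \<forall>\<^sub>F x in nhds u. cnj (\<phi> (mirror (h x))) = cnj (\<phi> (mirror x))"
            using frequently_eventually_frequently[OF True inb]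
          proof (rule frequently_elim1)
            fix u assume "(\<exists>v\<in>cls u \<inter> ball v0 d. True) \<and> u \<in> ball z0 e"
            then obtain v where v: "v \<in> cls u" "v \<in> ball v0 d" "u \<in> ball z0 e" by auto
            have "v = h u" using h(7)[OF v(3,2)] cls_phi[OF v(1)] by simp
            obtain k where k: "germ k u" "k u = v" using v by (auto simp: cls_def)
            have "\<forall>\<^sub>F x in nhds u. k x = h x"
              by (rule local_h) (use k v \<open>v = h u\<close> in \<open>auto simp: germ_def elim: eventually_mono\<close>)
            moreover have "\<forall>\<^sub>F x in nhds u. \<phi> (mirror (k x)) = \<phi> (mirror x)"
              using k by (auto simp: germ_def elim: eventually_mono)
            ultimately show "\<forall>\<^sub>F x in nhds u. cnj (\<phi> (mirror (h x))) = cnj (\<phi> (mirror x))"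
              by eventually_elim simp
          qed
          then have "\<forall>\<^sub>F x in nhds z0. cnj (\<phi> (mirror (h x))) = cnj (\<phi> (mirror x))"
          proof (rule eventually_analytic_identity[rotated 2])
            have "(\<lambda>u. cnj (\<phi> (mirror u))) analytic_on {v0}"
              using analytic_cnj_mirror phi_analytic mN v00 by blast
            then have "(\<lambda>u. cnj (\<phi> (mirror u))) \<circ> h analytic_on {z0}"
              by (intro analytic_on_compose han) (use h in auto)
            then show "(\<lambda>x. cnj (\<phi> (mirror (h x)))) analytic_on {z0}" by (simp add: o_def)
            show "(\<lambda>x. cnj (\<phi> (mirror x))) analytic_on {z0}"
              using analytic_cnj_mirror phi_analytic z0' by blast
          qed
          moreover have "\<forall>\<^sub>F x in nhds z0. \<phi> (h x) = \<phi> x"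
            using inb by eventually_elim (use h in auto)
          ultimately have "\<forall>\<^sub>F x in nhds z0. \<phi> (h x) = \<phi> x \<and> \<phi> (mirror (h x)) = \<phi> (mirror x)"
            by eventually_elim simp
          then have "germ h z0" using han by (simp add: germ_def)
          then have v0c: "v0 \<in> cls z0" using v0G z0 h(4) by (auto simp: cls_def)
          have "\<forall>\<^sub>F x in nhds z0. g v0 x = h x"
            by (rule local_h) (use g[OF v0c] h in \<open>auto simp: germ_def elim: eventually_mono\<close>)
          with inb have "\<forall>\<^sub>F u in nhds z0. \<forall>v\<in>cls u \<inter> ball v0 d. \<exists>w\<in>cls z0. v = g w u"
          proof eventually_elim
            case (elim u)
            show ?case
            proof
              fix v assume v: "v \<in> cls u \<inter> ball v0 d"
              then have "v = h u" using h(7)[OF elim(1)] cls_phi[of v u] by auto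
              then show "\<exists>w\<in>cls z0. v = g w u" using elim v0c by (intro bexI[of _ v0]) simp_all
            qed
          qed
          then show ?thesis by (intro exI[of _ "ball v0 d"]) (use h in auto)
        qed
      qed
    qed
  qed
qed

lemma cls_local_disc:
  assumes z0: "z0 \<in> G" and g: "\<And>w. w \<in> cls z0 \<Longrightarrow> germ (g w) z0 \<and> g w z0 = w"
  shows "\<forall>\<^sub>F u in nhds z0. \<forall>v\<in>cls u. norm v \<le> 1 \<longrightarrow> (\<exists>w\<in>cls z0. v = g w u)"
proof -
  have "\<forall>v0\<in>cball 0 1. \<exists>U. open U \<and> v0 \<in> U \<and> (\<forall>\<^sub>F u in nhds z0. \<forall>v\<in>cls u \<inter> U. \<exists>w\<in>cls z0. v = g w u)"
    using cls_local_near_point[OF assms] by simp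
  from bchoice[OF this] obtain U where U: "\<And>v0. v0 \<in> cball 0 1 \<Longrightarrow> open (U v0) \<and> v0 \<in> U v0 \<and>
        (\<forall>\<^sub>F u in nhds z0. \<forall>v\<in>cls u \<inter> U v0. \<exists>w\<in>cls z0. v = g w u)"
    by blast
  obtain F where F: "F \<subseteq> cball 0 1" "finite F" "cball (0::complex) 1 \<subseteq> (\<Union>v\<in>F. U v)"
    using compactE_image[OF compact_cball[of "0::complex" 1], of "cball 0 1" U] U by blast
  have "\<forall>\<^sub>F u in nhds z0. \<forall>v0\<in>F. \<forall>v\<in>cls u \<inter> U v0. \<exists>w\<in>cls z0. v = g w u"
    using F U by (intro eventually_ball_finite) auto
  then show ?thesis
  proof eventually_elim
    case (elim u)
    show ?case
    proof (intro ballI impI)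
      fix v assume v: "v \<in> cls u" "norm v \<le> 1"
      then obtain v0 where "v0 \<in> F" "v \<in> U v0" using F(3) by auto
      then show "\<exists>w\<in>cls z0. v = g w u" using elim v by auto
    qed
  qed
qed

text \<open>The covering property. Members in the closed disc are caught by compactness of the disc, the
  others by applying the same statement to the reflected germs.\<close>

lemma cls_local_structure:
  assumes z0: "z0 \<in> G"
  obtains e g where "e > 0" "ball z0 e \<subseteq> G"
    "\<And>w. w \<in> cls z0 \<Longrightarrow> g w holomorphic_on ball z0 e \<and> g w z0 = w"
    "\<And>u. u \<in> ball z0 e \<Longrightarrow> bij_betw (\<lambda>w. g w u) (cls z0) (cls u)"
proof -
  have z00: "z0 \<noteq> 0" using z0 by (auto simp: G_def)
  obtain g where g: "\<And>w. w \<in> cls z0 \<Longrightarrow> germ (g w) z0 \<and> g w z0 = w"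
  proof -
    have "\<forall>w\<in>cls z0. \<exists>g. germ g z0 \<and> g z0 = w" by (auto simp: cls_def)
    from bchoice[OF this] show thesis using that by blast
  qed
  have an: "g w analytic_on {z0}" if "w \<in> cls z0" for w using g[OF that] by (simp add: germ_def)
  have e1: "\<forall>\<^sub>F u in nhds z0. \<forall>v\<in>cls u. norm v \<le> 1 \<longrightarrow> (\<exists>w\<in>cls z0. v = g w u)"
    by (rule cls_local_disc[OF z0 g])
  define g' where "g' = (\<lambda>w u. mirror (g (mirror w) (mirror u)))"
  have "\<forall>\<^sub>F u in nhds (mirror z0). \<forall>v\<in>cls u. norm v \<le> 1 \<longrightarrow> (\<exists>w\<in>cls (mirror z0). v = g' w u)"
  proof (rule cls_local_disc)
    fix w assume "w \<in> cls (mirror z0)"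
    then have w: "mirror w \<in> cls z0" using cls_mirror by fastforce
    then have "germ (g (mirror w)) z0" "g (mirror w) z0 \<noteq> 0" using g[OF w] cls_G[OF w] by (auto simp: G_def)
    from germ_mirror[OF this(1) z00 this(2)] g[OF w] show "germ (g' w) (mirror z0) \<and> g' w (mirror z0) = w"
      by (simp add: g'_def)
  qed (use z0 in auto)
  from eventually_compose_filterlim[OF this filterlim_mirror_nhds[OF z00]]
  have e2: "\<forall>\<^sub>F u in nhds z0. \<forall>v\<in>cls (mirror u). norm v \<le> 1 \<longrightarrow> (\<exists>w\<in>cls (mirror z0). v = g' w (mirror u))" .
  have e3: "\<forall>\<^sub>F u in nhds z0. \<forall>w\<in>cls z0. g w u \<in> cls u"
    using finite_cls germ_eventually_cls g cls_G by (intro eventually_ball_finite) auto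
  have e4: "\<forall>\<^sub>F u in nhds z0. \<forall>w\<in>cls z0. \<forall>w'\<in>cls z0. w \<noteq> w' \<longrightarrow> g w u \<noteq> g w' u"
  proof (intro eventually_ball_finite finite_cls ballI)
    fix w w' assume w: "w \<in> cls z0" "w' \<in> cls z0"
    show "\<forall>\<^sub>F u in nhds z0. w \<noteq> w' \<longrightarrow> g w u \<noteq> g w' u"
    proof (cases "w = w'")
      case False
      have "((\<lambda>u. g w u - g w' u) \<longlongrightarrow> w - w') (nhds z0)"
        using isCont_tendsto_nhds[OF analytic_at_imp_isCont[OF an[OF w(1)]]]
          isCont_tendsto_nhds[OF analytic_at_imp_isCont[OF an[OF w(2)]]] g w
        by (intro tendsto_diff) auto
      then have "\<forall>\<^sub>F u in nhds z0. g w u - g w' u \<noteq> 0"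
        by (rule tendsto_imp_eventually_ne) (use False in auto)
      then show ?thesis by eventually_elim auto
    qed auto
  qed
  have e5: "\<forall>\<^sub>F u in nhds z0. \<forall>w\<in>cls z0. g w analytic_on {u}"
  proof (intro eventually_ball_finite finite_cls ballI)
    fix w assume "w \<in> cls z0"
    then obtain s where s: "open s" "z0 \<in> s" "g w holomorphic_on s" using an by (auto simp: analytic_at)
    then have "\<forall>\<^sub>F u in nhds z0. u \<in> s" by (intro eventually_nhds_in_open)
    then show "\<forall>\<^sub>F u in nhds z0. g w analytic_on {u}" by eventually_elim (use s in \<open>auto simp: analytic_at\<close>)
  qed
  have e6: "\<forall>\<^sub>F u in nhds z0. u \<in> G" using z0 open_G by (intro eventually_nhds_in_open)
  from e1 e2 e3 e4 e5 e6
  have "\<forall>\<^sub>F u in nhds z0. u \<in> G \<and> (\<forall>w\<in>cls z0. g w analytic_on {u}) \<and> bij_betw (\<lambda>w. g w u) (cls z0) (cls u)"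
  proof eventually_elim
    case (elim u)
    have "cls u \<subseteq> (\<lambda>w. g w u) ` cls z0"
    proof
      fix v assume v: "v \<in> cls u"
      show "v \<in> (\<lambda>w. g w u) ` cls z0"
      proof (cases "norm v \<le> 1")
        case False
        then have "norm (mirror v) \<le> 1" using norm_mirror_less[of v] by simp
        then obtain w where w: "w \<in> cls (mirror z0)" "mirror v = g' w (mirror u)"
          using elim(2) cls_mirror[OF v] by blast
        then have "v = g (mirror w) u" by (simp add: g'_def)
        moreover have "mirror w \<in> cls z0" using cls_mirror[OF w(1)] by simp
        ultimately show ?thesis by blast
      qed (use elim(1) v in blast)
    qed
    then have "(\<lambda>w. g w u) ` cls z0 = cls u" using elim(3) by blast
    moreover have "inj_on (\<lambda>w. g w u) (cls z0)" using elim(4) by (auto simp: inj_on_def)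
    ultimately show ?case using elim by (simp add: bij_betw_def)
  qed
  then obtain e where e: "e > 0" "\<And>u. u \<in> ball z0 e \<Longrightarrow> u \<in> G \<and> (\<forall>w\<in>cls z0. g w analytic_on {u}) \<and> bij_betw (\<lambda>w. g w u) (cls z0) (cls u)"
    by (auto simp: eventually_nhds_metric dist_commute)
  show ?thesis
  proof (rule that[of e g])
    fix w assume w: "w \<in> cls z0"
    then have "g w analytic_on ball z0 e" using e(2) by (subst analytic_on_analytic_at) auto
    then show "g w holomorphic_on ball z0 e \<and> g w z0 = w" using g[OF w] analytic_imp_holomorphic by blast
  qed (use e in auto)
qed

section \<open>Symmetric functions of a class\<close>

text \<open>The number of sheets is locally constant, and the good points form a connected set.\<close>

lemma card_cls_constant:
  assumes "z \<in> G" "w \<in> G" shows "card (cls z) = card (cls w)"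
proof (rule connected_local_const[OF connected_G assms], intro ballI)
  fix a assume "a \<in> G"
  from cls_local_structure[OF this] obtain e g where e: "e > 0"
    "\<And>u. u \<in> ball a e \<Longrightarrow> bij_betw (\<lambda>w. g w u) (cls a) (cls u)" by metis
  have "card (cls a) = card (cls u)" if "u \<in> ball a e" for u
    using e(2)[OF that] by (rule bij_betw_same_card)
  then show "\<forall>\<^sub>F b in at a within G. card (cls a) = card (cls b)"
    using e(1) by (auto simp: eventually_at dist_commute intro!: exI[of _ e])
qed

lemma cls_symmetric_holomorphic:
  fixes f :: "complex \<Rightarrow> complex"
  assumes U: "open U" and W: "open W" "f holomorphic_on W"
    and cls: "\<And>z w. z \<in> U \<inter> G \<Longrightarrow> w \<in> cls z \<Longrightarrow> w \<in> W"
  shows "(\<lambda>z. \<Sum>w\<in>cls z. f w) holomorphic_on U \<inter> G"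
    and "(\<lambda>z. \<Prod>w\<in>cls z. f w) holomorphic_on U \<inter> G"
proof -
  have *: "(\<lambda>z. \<Sum>w\<in>cls z. f w) analytic_on {z0} \<and> (\<lambda>z. \<Prod>w\<in>cls z. f w) analytic_on {z0}"
    if z0: "z0 \<in> U \<inter> G" for z0
  proof -
    have "z0 \<in> G" using z0 by simp
    from cls_local_structure[OF this] obtain e1 g where e1: "e1 > 0"
      "\<And>w. w \<in> cls z0 \<Longrightarrow> g w holomorphic_on ball z0 e1 \<and> g w z0 = w"
      "\<And>u. u \<in> ball z0 e1 \<Longrightarrow> bij_betw (\<lambda>w. g w u) (cls z0) (cls u)"
      by metis
    have "open (ball z0 e1 \<inter> (U \<inter> G))" using U open_G by auto
    moreover have "z0 \<in> ball z0 e1 \<inter> (U \<inter> G)" using z0 e1 by auto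
    ultimately obtain e where e: "e > 0" "ball z0 e \<subseteq> ball z0 e1 \<inter> (U \<inter> G)"
      using open_contains_ball by meson
    have gW: "g w u \<in> W" if "w \<in> cls z0" "u \<in> ball z0 e" for w u
    proof (rule cls[of u])
      have "u \<in> ball z0 e1" using that e by blast
      from bij_betwE[OF e1(3)[OF this]] that(1) show "g w u \<in> cls u" by blast
    qed (use that e in auto)
    have fg: "(\<lambda>u. f (g w u)) holomorphic_on ball z0 e" if "w \<in> cls z0" for w
    proof -
      have "g w holomorphic_on ball z0 e" using e1(2)[OF that] e holomorphic_on_subset by blast
      moreover have "g w ` ball z0 e \<subseteq> W" using gW[OF that] by blast
      ultimately show ?thesis using holomorphic_on_compose_gen[OF _ W(2)] by (auto simp: o_def)
    qed
    have bij: "bij_betw (\<lambda>w. g w u) (cls z0) (cls u)" if "u \<in> ball z0 e" for u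
      by (rule e1(3)) (use that e in blast)
    have "(\<lambda>u. \<Sum>w\<in>cls z0. f (g w u)) holomorphic_on ball z0 e"
      by (intro holomorphic_intros fg)
    moreover have "(\<Sum>w\<in>cls z0. f (g w u)) = (\<Sum>w\<in>cls u. f w)" if "u \<in> ball z0 e" for u
      by (rule sum.reindex_bij_betw[OF bij[OF that]])
    ultimately have 1: "(\<lambda>u. \<Sum>w\<in>cls u. f w) holomorphic_on ball z0 e"
      by (rule holomorphic_transform)
    have "(\<lambda>u. \<Prod>w\<in>cls z0. f (g w u)) holomorphic_on ball z0 e"
      by (intro holomorphic_intros fg)
    moreover have "(\<Prod>w\<in>cls z0. f (g w u)) = (\<Prod>w\<in>cls u. f w)" if "u \<in> ball z0 e" for u
      by (rule prod.reindex_bij_betw[OF bij[OF that]])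
    ultimately have 2: "(\<lambda>u. \<Prod>w\<in>cls u. f w) holomorphic_on ball z0 e"
      by (rule holomorphic_transform)
    from 1 2 e(1) show ?thesis by (auto simp: analytic_at_ball)
  qed
  show "(\<lambda>z. \<Sum>w\<in>cls z. f w) holomorphic_on U \<inter> G"
    by (rule analytic_imp_holomorphic, subst analytic_on_analytic_at) (use * in blast)
  show "(\<lambda>z. \<Prod>w\<in>cls z. f w) holomorphic_on U \<inter> G"
    by (rule analytic_imp_holomorphic, subst analytic_on_analytic_at) (use * in blast)
qed

text \<open>The value at an exceptional point is the limit along good points only: the class of a bad point
  is empty, and bad points may accumulate at \<open>0\<close>, so the limit in the full neighbourhood need not
  exist.\<close>

definition ext :: "(complex \<Rightarrow> complex) \<Rightarrow> complex \<Rightarrow> complex" where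
  "ext F z = Lim (at z within G) F"

lemma ext_tendsto: "(F \<longlongrightarrow> l) (at z within G) \<Longrightarrow> ext F z = l"
  unfolding ext_def by (rule tendsto_Lim[OF G_dense])

lemma ext_eqI:
  assumes "g holomorphic_on A" "open A" "z \<in> A" "\<And>u. u \<in> A \<inter> G \<Longrightarrow> F u = g u"
  shows "ext F z = g z" "(F \<longlongrightarrow> g z) (at z within G)"
proof -
  have "isCont g z" using assms by (meson analytic_at_imp_isCont holomorphic_on_imp_analytic_at)
  then have g: "(g \<longlongrightarrow> g z) (at z within G)"
    by (auto simp: isCont_def intro: tendsto_within_subset)
  have "\<forall>\<^sub>F u in at z within G. u \<in> A \<inter> G"
    using assms(2,3) by (auto simp: eventually_at_topological)
  then have "\<forall>\<^sub>F u in at z within G. g u = F u" by eventually_elim (use assms(4) in auto)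
  with g show "(F \<longlongrightarrow> g z) (at z within G)" by (rule Lim_transform_eventually)
  then show "ext F z = g z" by (rule ext_tendsto)
qed

text \<open>Away from \<open>0\<close> the bad points are isolated and Riemann's theorem removes them one at a time; the
  resulting function has at \<open>0\<close> an isolated singularity, which is removed last.\<close>

lemma ext_holomorphic:
  assumes U: "open U" and F: "F holomorphic_on U \<inter> G"
    and bdd: "\<And>x. x \<in> U \<Longrightarrow> \<exists>C. \<forall>\<^sub>F z in at x within G. norm (F z) \<le> C"
  shows "ext F holomorphic_on U"
    and "\<And>z. z \<in> U \<inter> G \<Longrightarrow> ext F z = F z"
    and "\<And>z. z \<in> U \<Longrightarrow> (F \<longlongrightarrow> ext F z) (at z within G)"
proof -
  show onG: "ext F z = F z" if "z \<in> U \<inter> G" for z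
    by (rule ext_eqI(1)[OF F _ that]) (use U open_G in auto)
  have loc: "\<exists>A g. open A \<and> x \<in> A \<and> g holomorphic_on A \<and> (\<forall>z\<in>A. ext F z = g z)"
    if A: "open A" "x \<in> A" and h: "h holomorphic_on A - {x}" "\<And>z. z \<in> A \<inter> G - {x} \<Longrightarrow> F z = h z"
      and b: "\<forall>\<^sub>F z in at x. norm (h z) \<le> C" and x: "x \<in> U" and xx: "x \<notin> G \<or> F x = h x \<and> h holomorphic_on A"
    for A x h C
  proof (cases "h holomorphic_on A \<and> F x = h x")
    case True
    then show ?thesis
      using ext_eqI(1)[of h A _ F] h(2) A by (intro exI[of _ A] exI[of _ h]) blast
  next
    case False
    then have xG: "x \<notin> G" using xx by auto
    have "x \<in> interior A" using A by (simp add: interior_open)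
    from holomorphic_on_extend_bounded[OF h(1) this] b
    obtain g where g: "g holomorphic_on A" "\<And>z. z \<in> A - {x} \<Longrightarrow> g z = h z" by blast
    have eq: "F u = g u" if "u \<in> A \<inter> G" for u
    proof -
      have "u \<noteq> x" using that xG by auto
      then show ?thesis using g(2)[of u] h(2)[of u] that by auto
    qed
    have "ext F z = g z" if "z \<in> A" for z
      by (rule ext_eqI(1)[OF g(1) A(1) that eq])
    then show ?thesis using A g by blast
  qed
  have an: "ext F analytic_on {x}" if xU: "x \<in> U" "x \<noteq> 0" for x
  proof (cases "x \<in> G")
    case True
    have "ext F holomorphic_on U \<inter> G" by (rule holomorphic_transform[OF F]) (use onG in auto)
    then show ?thesis using True xU U open_G by (auto intro: holomorphic_on_imp_analytic_at)
  next
    case False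
    have "\<forall>\<^sub>F z in at x. z \<in> G \<and> z \<in> U"
      using eventually_G[OF xU(2)] eventually_at_in_open'[OF U xU(1)] by eventually_elim auto
    then obtain A where A: "open A" "x \<in> A" "\<And>z. z \<in> A \<Longrightarrow> z \<noteq> x \<Longrightarrow> z \<in> G \<and> z \<in> U"
      unfolding eventually_at_topological by blast
    obtain C where C: "\<forall>\<^sub>F z in at x within G. norm (F z) \<le> C" using bdd[OF xU(1)] by blast
    have "\<forall>\<^sub>F z in at x. norm (F z) \<le> C"
      using C eventually_G[OF xU(2)] by (auto simp: eventually_at_filter elim: eventually_elim2)
    moreover have "F holomorphic_on A - {x}" using F A(3) by (auto elim!: holomorphic_on_subset)
    ultimately obtain B g where "open B" "x \<in> B" "g holomorphic_on B" "\<forall>z\<in>B. ext F z = g z"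
      using loc[of A x F C] A(1,2) xU False by blast
    then have "ext F holomorphic_on B" by (intro holomorphic_transform[of g B "ext F"]) auto
    then show ?thesis using \<open>open B\<close> \<open>x \<in> B\<close> by (auto intro: holomorphic_on_imp_analytic_at)
  qed
  have "ext F analytic_on {x}" if xU: "x \<in> U" for x
  proof (cases "x = 0")
    case True
    have hol: "ext F holomorphic_on U - {0}"
      by (rule analytic_imp_holomorphic, subst analytic_on_analytic_at) (use an in auto)
    obtain C where "\<forall>\<^sub>F z in at 0 within G. norm (F z) \<le> C" using bdd[OF xU] True by blast
    then obtain S where S: "open S" "0 \<in> S" "\<And>z. z \<in> S \<Longrightarrow> z \<noteq> 0 \<Longrightarrow> z \<in> G \<Longrightarrow> norm (F z) \<le> C"
      unfolding eventually_at_topological by blast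
    have "norm (ext F z) \<le> C" if z: "z \<in> S \<inter> U" "z \<noteq> 0" for z
    proof (rule tendsto_upperbound[OF _ _ G_dense])
      have "isCont (ext F) z" using an z by (auto intro: analytic_at_imp_isCont)
      then show "((\<lambda>u. norm (ext F u)) \<longlongrightarrow> norm (ext F z)) (at z within G)"
        by (intro tendsto_norm) (auto simp: isCont_def intro: tendsto_within_subset)
      have "open (S \<inter> U - {0})" using S U by auto
      then have "\<forall>\<^sub>F u in at z within G. u \<in> S \<inter> U - {0} \<and> u \<in> G"
        using z by (auto simp: eventually_at_topological)
      then show "\<forall>\<^sub>F u in at z within G. norm (ext F u) \<le> C"
        by eventually_elim (use S onG in auto)
    qed
    moreover have "\<forall>\<^sub>F z in at 0. z \<in> S \<inter> U \<and> z \<noteq> 0"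
      using S U xU True unfolding eventually_at_topological by (intro exI[of _ "S \<inter> U"]) auto
    ultimately have "\<forall>\<^sub>F z in at 0. norm (ext F z) \<le> C" by (auto elim: eventually_mono)
    moreover have "0 \<notin> G" by (auto simp: G_def)
    ultimately obtain B g where "open B" "x \<in> B" "g holomorphic_on B" "\<forall>z\<in>B. ext F z = g z"
      using loc[of U 0 "ext F" C] U xU True hol onG by auto
    then have "ext F holomorphic_on B" by (intro holomorphic_transform[of g B "ext F"]) auto
    then show ?thesis using \<open>open B\<close> \<open>x \<in> B\<close> by (auto intro: holomorphic_on_imp_analytic_at)
  qed (use an xU in auto)
  then show hol: "ext F holomorphic_on U"
    by (intro analytic_imp_holomorphic) (subst analytic_on_analytic_at, blast)
  show "(F \<longlongrightarrow> ext F z) (at z within G)" if "z \<in> U" for z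
    by (rule ext_eqI(2)[OF hol U that]) (use onG in auto)
qed

lemma dense_le:
  fixes f h :: "complex \<Rightarrow> real"
  assumes "isCont f x" "isCont h x" "\<forall>\<^sub>F z in at x within G. f z \<le> h z"
  shows "f x \<le> h x"
proof (rule tendsto_le[OF G_dense _ _ assms(3)])
  show "(h \<longlongrightarrow> h x) (at x within G)" "(f \<longlongrightarrow> f x) (at x within G)"
    using assms(1,2) by (auto simp: isCont_def intro: tendsto_within_subset)
qed

section \<open>Classes of disc points stay in the disc\<close>

lemma eventually_cls_ball:
  assumes a: "a \<in> G" and P: "\<And>w. w \<in> cls a \<Longrightarrow> eventually (P w) (nhds w)"
  shows "\<forall>\<^sub>F z in nhds a. \<exists>h. bij_betw h (cls a) (cls z) \<and> (\<forall>w\<in>cls a. P w (h w))"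
proof -
  from cls_local_structure[OF a] obtain e g where g: "e > 0"
      "\<And>w. w \<in> cls a \<Longrightarrow> g w holomorphic_on ball a e \<and> g w a = w"
      "\<And>u. u \<in> ball a e \<Longrightarrow> bij_betw (\<lambda>w. g w u) (cls a) (cls u)" by metis
  have "\<forall>\<^sub>F z in nhds a. \<forall>w\<in>cls a. P w (g w z)"
  proof (intro eventually_ball_finite finite_cls ballI)
    fix w assume w: "w \<in> cls a"
    have "g w analytic_on {a}" using g(1) g(2)[OF w] by (auto simp: analytic_at_ball)
    then have "filterlim (g w) (nhds (g w a)) (nhds a)"
      by (intro isCont_tendsto_nhds analytic_at_imp_isCont)
    moreover have "eventually (P w) (nhds (g w a))" using P[OF w] g(2)[OF w] by simp
    ultimately show "\<forall>\<^sub>F z in nhds a. P w (g w z)" by (rule eventually_compose_filterlim[rotated])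
  qed
  moreover have "\<forall>\<^sub>F z in nhds a. z \<in> ball a e" using g(1) by (intro eventually_nhds_in_open) auto
  ultimately show ?thesis
  proof eventually_elim
    case (elim z)
    show ?case by (rule exI[of _ "\<lambda>w. g w z"]) (use elim g(3) in auto)
  qed
qed

lemma cls_locally_bounded:
  assumes a: "a \<in> G"
  shows "\<exists>C. \<forall>\<^sub>F z in nhds a. \<forall>w\<in>cls z. norm w \<le> C"
proof -
  have "finite (norm ` cls a)" using finite_cls by simp
  then obtain C where C: "\<And>w. w \<in> cls a \<Longrightarrow> norm w \<le> C"
    using bdd_above_finite[of "norm ` cls a"] by (auto simp: bdd_above_def)
  have "\<forall>\<^sub>F z in nhds a. \<exists>h. bij_betw h (cls a) (cls z) \<and> (\<forall>w\<in>cls a. norm (h w) < C + 1)"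
  proof (rule eventually_cls_ball[OF a])
    fix w assume "w \<in> cls a"
    then have w: "norm w < C + 1" using C by force
    have "w \<in> ball 0 (C + 1)" using w by simp
    from eventually_nhds_in_open[OF open_ball this] show "\<forall>\<^sub>F u in nhds w. norm u < C + 1" by simp
  qed
  then have "\<forall>\<^sub>F z in nhds a. \<forall>w\<in>cls z. norm w \<le> C + 1"
  proof eventually_elim
    case (elim z)
    then obtain h where h: "bij_betw h (cls a) (cls z)" "\<forall>w\<in>cls a. norm (h w) < C + 1" by blast
    have "cls z = h ` cls a" using h(1) by (simp add: bij_betw_def)
    then show ?case using h(2) by (auto simp: less_imp_le)
  qed
  then show ?thesis by blast
qed

lemma cls_bounded_on_compact:
  assumes "compact K" "K \<subseteq> G"
  shows "\<exists>C. \<forall>z\<in>K. \<forall>w\<in>cls z. norm w \<le> C"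
proof -
  have "\<forall>a\<in>K. \<exists>S. \<exists>C. open S \<and> a \<in> S \<and> (\<forall>z\<in>S. \<forall>w\<in>cls z. norm w \<le> C)"
  proof
    fix a assume "a \<in> K"
    then have "a \<in> G" using assms by auto
    from cls_locally_bounded[OF this] show "\<exists>S C. open S \<and> a \<in> S \<and> (\<forall>z\<in>S. \<forall>w\<in>cls z. norm w \<le> C)"
      unfolding eventually_nhds by blast
  qed
  from bchoice[OF this] obtain S where "\<forall>a\<in>K. \<exists>C. open (S a) \<and> a \<in> S a \<and> (\<forall>z\<in>S a. \<forall>w\<in>cls z. norm w \<le> C)" by blast
  from bchoice[OF this] obtain C where SC: "\<And>a. a \<in> K \<Longrightarrow> open (S a) \<and> a \<in> S a \<and> (\<forall>z\<in>S a. \<forall>w\<in>cls z. norm w \<le> C a)" by blast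
  obtain F where F: "F \<subseteq> K" "finite F" "K \<subseteq> (\<Union>a\<in>F. S a)"
    using compactE_image[OF assms(1), of K S] SC by blast
  obtain C0 where C0: "\<And>a. a \<in> F \<Longrightarrow> C a \<le> C0"
    using bdd_above_finite[of "C ` F"] F(2) by (auto simp: bdd_above_def)
  show ?thesis
  proof (intro exI[of _ C0] ballI)
    fix z w assume "z \<in> K" "w \<in> cls z"
    then obtain a where "a \<in> F" "z \<in> S a" using F by auto
    then show "norm w \<le> C0" using SC[of a] C0[of a] F(1) \<open>w \<in> cls z\<close> by force
  qed
qed

text \<open>If classes of points near \<open>z0\<close> reached arbitrarily far, then every remote good point would have an
  equivalent point near \<open>z0\<close>: on a small circle around \<open>z0\<close> consisting of good points classes are
  bounded by some \<open>R\<close>, so no equivalent of a point beyond \<open>R\<close> lies on this circle, and the existence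
  of an equivalent inside the circle is a locally constant property on a connected set. Then \<open>\<phi>\<close>
  would be bounded near \<open>\<infinity>\<close>, against Liouville's theorem.\<close>

lemma cls_bounded_entire:
  assumes N: "N = UNIV"
  shows "\<exists>C. \<forall>z\<in>G \<inter> cball 0 r. \<forall>w\<in>cls z. norm w \<le> C"
proof (rule ccontr)
  assume "\<not> ?thesis"
  then have "\<forall>n. \<exists>z. \<exists>w. z \<in> G \<inter> cball 0 r \<and> w \<in> cls z \<and> norm w > real n" by (meson linorder_not_le)
  then obtain zs where "\<forall>n. \<exists>w. zs n \<in> G \<inter> cball 0 r \<and> w \<in> cls (zs n) \<and> norm w > real n" by metis
  then obtain ws where zw: "\<And>n. zs n \<in> G \<inter> cball 0 r \<and> ws n \<in> cls (zs n) \<and> norm (ws n) > real n" by metis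
  then obtain z0 q where z0: "strict_mono q" "(zs \<circ> q) \<longlonglongrightarrow> z0"
    using compact_cball[of "0::complex" r] unfolding compact_def by (metis IntD2)
  \<comment> \<open>A radius for which the whole circle around \<open>z0\<close> is good exists because the bad points are countable.\<close>
  have "countable ((\<lambda>x. dist z0 x) ` (- G))" using countable_Compl_G by simp
  then have "\<not> {0<..<1} \<subseteq> (\<lambda>x. dist z0 x) ` (- G)"
    using uncountable_open_interval[of 0 "1::real"] countable_subset by (metis zero_less_one)
  then obtain \<eta> where "0 < \<eta>" "\<eta> \<notin> (\<lambda>x. dist z0 x) ` (- G)"
    by (meson greaterThanLessThan_iff subsetI)
  then have \<eta>: "0 < \<eta>" "\<And>x. dist z0 x = \<eta> \<Longrightarrow> x \<in> G" by blast+
  have "compact (sphere z0 \<eta>)" "sphere z0 \<eta> \<subseteq> G" using \<eta> by auto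
  from cls_bounded_on_compact[OF this] obtain R0 where "\<forall>z\<in>sphere z0 \<eta>. \<forall>w\<in>cls z. norm w \<le> R0" by blast
  then have R0: "\<And>z w. dist z0 z = \<eta> \<Longrightarrow> w \<in> cls z \<Longrightarrow> norm w \<le> R0" by simp
  define R where "R = max R0 0"
  define Y where "Y = (- cball 0 R) \<inter> G"
  have "connected (- cball (0::complex) R)"
    by (rule connected_complement_bounded_convex) auto
  then have Y: "connected Y" unfolding Y_def by (rule connected_Int_G[rotated]) (auto simp: R_def)
  define f where "f = (\<lambda>w. \<exists>z\<in>cls w. dist z0 z < \<eta>)"
  have loc: "\<forall>a\<in>Y. \<forall>\<^sub>F b in at a within Y. f a = f b"
  proof
    fix a assume a: "a \<in> Y"
    have "\<forall>\<^sub>F z in nhds a. \<exists>h. bij_betw h (cls a) (cls z) \<and> (\<forall>w\<in>cls a. dist z0 (h w) < \<eta> \<longleftrightarrow> dist z0 w < \<eta>)"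
    proof (rule eventually_cls_ball)
      fix w assume w: "w \<in> cls a"
      have "dist z0 w \<noteq> \<eta>" using R0[of w a] cls_sym[OF w] a by (auto simp: Y_def R_def)
      then consider "w \<in> ball z0 \<eta>" | "w \<in> - cball z0 \<eta>" by fastforce
      then show "\<forall>\<^sub>F u in nhds w. dist z0 u < \<eta> \<longleftrightarrow> dist z0 w < \<eta>"
      proof cases
        case 1
        from eventually_nhds_in_open[OF open_ball this] show ?thesis
          by eventually_elim (use 1 in auto)
      next
        case 2
        have "open (- cball z0 \<eta>)" by auto
        from eventually_nhds_in_open[OF this 2] show ?thesis
          by eventually_elim (use 2 in auto)
      qed
    qed (use a in \<open>auto simp: Y_def\<close>)
    then have "\<forall>\<^sub>F z in nhds a. f a = f z"
    proof eventually_elim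
      case (elim z)
      then obtain h where h: "bij_betw h (cls a) (cls z)" "\<forall>w\<in>cls a. dist z0 (h w) < \<eta> \<longleftrightarrow> dist z0 w < \<eta>" by blast
      have "cls z = h ` cls a" using h(1) by (simp add: bij_betw_def)
      then show ?case using h(2) by (auto simp: f_def)
    qed
    then show "\<forall>\<^sub>F b in at a within Y. f a = f b"
      by (auto simp: eventually_at_filter elim: eventually_mono)
  qed
  have "\<forall>\<^sub>F n in sequentially. dist ((zs \<circ> q) n) z0 < \<eta>" using z0(2) \<eta>(1) by (rule tendstoD)
  moreover have "\<forall>\<^sub>F n in sequentially. n \<ge> nat \<lceil>R\<rceil>" by (rule eventually_ge_at_top)
  ultimately have "\<forall>\<^sub>F n in sequentially. dist ((zs \<circ> q) n) z0 < \<eta> \<and> n \<ge> nat \<lceil>R\<rceil>" by eventually_elim auto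
  then obtain n where n: "dist (zs (q n)) z0 < \<eta>" "n \<ge> nat \<lceil>R\<rceil>"
    unfolding eventually_sequentially o_def by blast
  have "R \<le> real (q n)" using n(2) seq_suble[OF z0(1), of n] by linarith
  then have "norm (ws (q n)) > R" using zw[of "q n"] by simp
  moreover have wz: "ws (q n) \<in> cls (zs (q n))" using zw by blast
  ultimately have wY: "ws (q n) \<in> Y" using cls_G[OF wz] by (auto simp: Y_def)
  have "f (ws (q n))" using cls_sym[OF wz] n(1) by (auto simp: f_def dist_commute)
  then have all: "f w" if "w \<in> Y" for w
    using connected_local_const[OF Y wY that loc] by simp
  have cont: "continuous_on S \<phi>" for S
    using phi_isCont N by (simp add: continuous_at_imp_continuous_on)
  have "bounded (\<phi> ` cball z0 \<eta>)"
    by (intro compact_imp_bounded compact_continuous_image cont) auto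
  then obtain M1 where "\<forall>z\<in>cball z0 \<eta>. norm (\<phi> z) \<le> M1" by (auto simp: bounded_iff)
  then have M1: "\<And>z. dist z0 z \<le> \<eta> \<Longrightarrow> norm (\<phi> z) \<le> M1" by simp
  have "bounded (\<phi> ` cball 0 R)"
    by (intro compact_imp_bounded compact_continuous_image cont) auto
  then obtain M2 where "\<forall>z\<in>cball 0 R. norm (\<phi> z) \<le> M2" by (auto simp: bounded_iff)
  then have M2: "\<And>z. norm z \<le> R \<Longrightarrow> norm (\<phi> z) \<le> M2" by simp
  have "norm (\<phi> w) \<le> M1" if "norm w > R" for w
  proof (rule dense_le[where f = "\<lambda>z. norm (\<phi> z)" and x = w and h = "\<lambda>_. M1"])
    show "isCont (\<lambda>z. norm (\<phi> z)) w" using phi_isCont N by (intro continuous_intros) auto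
    have "\<forall>\<^sub>F z in at w within G. z \<in> - cball 0 R \<and> z \<in> G"
      using that unfolding eventually_at_topological by (intro exI[of _ "- cball 0 R"]) auto
    then show "\<forall>\<^sub>F z in at w within G. norm (\<phi> z) \<le> M1"
    proof eventually_elim
      case (elim z)
      then have "f z" using all by (auto simp: Y_def)
      then obtain u where "u \<in> cls z" "dist z0 u < \<eta>" by (auto simp: f_def)
      then show ?case using M1[of u] cls_phi[of u z] by simp
    qed
  qed simp
  with M2 have "norm (\<phi> w) \<le> max M1 M2" for w
    by (meson le_max_iff_disj linorder_not_le)
  then have "bounded (range \<phi>)" by (auto simp: bounded_iff)
  moreover have "\<phi> holomorphic_on UNIV" using phi_holomorphic N by simp
  ultimately have "\<phi> constant_on UNIV" using Liouville_theorem by blast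
  then show False using nonconst by simp
qed

text \<open>A Moebius map of the disc onto itself distorts the distance to the circle by a bounded factor.\<close>

lemma blaschke_factor_bounds:
  fixes s z :: complex
  assumes s: "norm s > 1" and z: "norm z < 1"
  shows "norm ((1 - cnj s * z) / (z - s)) \<le> 1 - (norm s - 1) / (2 * (norm s + 1)) * (1 - norm z)"
proof -
  define q where "q = norm ((1 - cnj s * z) / (z - s))"
  have zs: "z \<noteq> s" using assms by auto
  have id: "(norm (z - s))\<^sup>2 - (norm (1 - cnj s * z))\<^sup>2 = (1 - (norm z)\<^sup>2) * ((norm s)\<^sup>2 - 1)"
    unfolding cmod_power2 by (simp add: algebra_simps power2_eq_square)
  have pos: "(norm (z - s))\<^sup>2 > 0" using zs by simp
  have q2: "1 - q\<^sup>2 = (1 - (norm z)\<^sup>2) * ((norm s)\<^sup>2 - 1) / (norm (z - s))\<^sup>2"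
    using id pos by (simp add: q_def norm_divide power_divide field_simps)
  have "(norm (z - s))\<^sup>2 \<le> (norm s + 1)\<^sup>2"
    using norm_triangle_ineq4[of z s] z by (intro power_mono) auto
  moreover have nn: "(1 - (norm z)\<^sup>2) * ((norm s)\<^sup>2 - 1) \<ge> 0"
    using s z by (intro mult_nonneg_nonneg) (auto simp: power_le_one)
  ultimately have "1 - q\<^sup>2 \<ge> (1 - (norm z)\<^sup>2) * ((norm s)\<^sup>2 - 1) / (norm s + 1)\<^sup>2"
    unfolding q2 using pos s by (intro divide_left_mono mult_pos_pos) auto
  also have "(1 - (norm z)\<^sup>2) * ((norm s)\<^sup>2 - 1) / (norm s + 1)\<^sup>2 = (1 - (norm z)\<^sup>2) * ((norm s - 1) / (norm s + 1))"
  proof -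
    have "(norm s)\<^sup>2 - 1 = (norm s - 1) * (norm s + 1)" by (simp add: power2_eq_square algebra_simps)
    moreover have "norm s + 1 \<noteq> 0" using s by linarith
    ultimately show ?thesis by (simp add: power2_eq_square)
  qed
  finally have 1: "(1 - (norm z)\<^sup>2) * ((norm s - 1) / (norm s + 1)) \<le> 1 - q\<^sup>2" .
  have "norm z * norm z \<le> norm z * 1" using z by (intro mult_left_mono) auto
  then have "1 - norm z \<le> 1 - (norm z)\<^sup>2" by (simp add: power2_eq_square)
  then have "(1 - norm z) * ((norm s - 1) / (norm s + 1)) \<le> (1 - (norm z)\<^sup>2) * ((norm s - 1) / (norm s + 1))"
    using s by (intro mult_right_mono) auto
  with 1 have 2: "(1 - norm z) * ((norm s - 1) / (norm s + 1)) \<le> 1 - q\<^sup>2" by linarith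
  have "(q - 1)\<^sup>2 \<ge> 0" by simp
  then have "1 - q\<^sup>2 \<le> 2 * (1 - q)" by (simp add: power2_eq_square algebra_simps)
  with 2 have "(1 - norm z) * ((norm s - 1) / (norm s + 1)) \<le> 2 * (1 - q)" by linarith
  moreover have "(norm s - 1) / (2 * (norm s + 1)) * (1 - norm z) = ((1 - norm z) * ((norm s - 1) / (norm s + 1))) / 2"
    by (simp add: mult_ac)
  moreover have "x \<le> 1 - b" if "a \<le> 2 * (1 - x)" "b = a / 2" for a b x :: real
    unfolding that(2) using that(1) by (simp add: field_simps)
  ultimately show ?thesis unfolding q_def by blast
qed

text \<open>The factor \<open>\<beta>\<close> with its pole where \<open>\<phi>\<close> is unbounded: the identity if \<open>\<phi>\<close> is entire, otherwise the
  Moebius map with pole at a pole of \<open>\<phi>\<close>. The point \<open>p\<close> is its zero.\<close>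

lemma exists_disc_function:
  obtains \<beta> \<rho> C c p W where "\<rho> > 1" "cball 0 \<rho> \<subseteq> N" "open W" "G \<subseteq> W" "\<beta> holomorphic_on W"
    "\<And>w. w \<in> G \<Longrightarrow> norm (\<beta> (mirror w)) * norm (\<beta> w) = 1"
    "\<And>z w. z \<in> G \<inter> ball 0 \<rho> \<Longrightarrow> w \<in> cls z \<Longrightarrow> norm (\<beta> w) \<le> C"
    "norm p < 1" "(\<beta> \<longlongrightarrow> 0) (at p)"
    "c > 0" "\<And>z. norm z < 1 \<Longrightarrow> norm (\<beta> z) \<le> 1 - c * (1 - norm z)"
proof (cases "N = UNIV")
  case True
  obtain C where "\<forall>z\<in>G \<inter> cball 0 2. \<forall>w\<in>cls z. norm w \<le> C"
    using cls_bounded_entire[OF True] by blast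
  then show ?thesis
    by (intro that[of 2 UNIV "\<lambda>w. w" C 0 1]) (use True in \<open>auto simp: norm_mirror G_def\<close>)
next
  case False
  then obtain s where s: "s \<notin> N" by auto
  have s1: "norm s > 1" using s cball_subset_N by (meson linorder_not_le mem_cball_0 subsetD)
  obtain e where e: "e > 0" "(\<Union>x\<in>cball 0 1. ball x e) \<subseteq> N"
    using compact_subset_open_imp_ball_epsilon_subset[OF compact_cball open_N cball_subset_N] by blast
  define \<rho> where "\<rho> = 1 + e / 2"
  have \<rho>: "\<rho> > 1" using e by (simp add: \<rho>_def)
  have \<rho>N: "cball 0 \<rho> \<subseteq> N"
  proof
    fix z :: complex assume z: "z \<in> cball 0 \<rho>"
    show "z \<in> N"
    proof (cases "norm z \<le> 1")
      case False
      have "norm (z - z / norm z) = norm z * (1 - 1 / norm z)"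
      proof -
        have "z - z / norm z = z * of_real (1 - 1 / norm z)" by (simp add: algebra_simps)
        moreover have "1 - 1 / norm z \<ge> 0" using False by (simp add: divide_le_eq)
        ultimately show ?thesis by (simp only: norm_mult norm_of_real abs_of_nonneg)
      qed
      also have "\<dots> < e" using False z e by (simp add: \<rho>_def algebra_simps)
      finally have "z \<in> ball (z / norm z) e" by (simp add: dist_norm norm_minus_commute)
      moreover have "z / norm z \<in> cball 0 1" using False by (simp add: norm_divide)
      ultimately show ?thesis using e(2) by blast
    qed (use cball_subset_N in auto)
  qed
  have "bounded (\<phi> ` cball 0 \<rho>)"
    by (intro compact_imp_bounded compact_continuous_image continuous_at_imp_continuous_on ballI phi_isCont)
       (use \<rho>N in auto)
  then obtain M where "\<forall>z\<in>cball 0 \<rho>. norm (\<phi> z) \<le> M" by (auto simp: bounded_iff)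
  then have M: "\<And>z. norm z \<le> \<rho> \<Longrightarrow> norm (\<phi> z) \<le> M" by simp
  have "filterlim \<phi> at_infinity (at s)" using pole_outside_N[OF s] by (simp add: is_pole_def)
  then have "\<forall>\<^sub>F w in at s. max M 0 + 1 \<le> norm (\<phi> w)"
    unfolding filterlim_at_infinity[OF order_refl[of 0]]
    by (rule allE[of _ "max M 0 + 1"]) (auto simp: add_nonneg_pos)
  then obtain \<epsilon> where \<epsilon>: "\<epsilon> > 0" "\<And>w. w \<noteq> s \<Longrightarrow> dist w s < \<epsilon> \<Longrightarrow> max M 0 + 1 \<le> norm (\<phi> w)"
    by (auto simp: eventually_at)
  define \<beta> where "\<beta> = (\<lambda>w. (1 - cnj s * w) / (w - s))"
  have Gs: "w \<noteq> s" "w \<noteq> mirror s" if "w \<in> G" for w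
    using that s by (auto simp: G_def)
  show ?thesis
  proof (rule that[of \<rho> "- {s}" \<beta> "norm s + ((norm s)\<^sup>2 + 1) / \<epsilon>" "mirror s" "(norm s - 1) / (2 * (norm s + 1))"])
    show "\<beta> holomorphic_on - {s}" unfolding \<beta>_def by (intro holomorphic_intros) auto
    show "G \<subseteq> - {s}" using Gs by auto
    fix w assume w: "w \<in> G"
    then have w0: "w \<noteq> 0" by (auto simp: G_def)
    have n1: "1 - cnj s * w \<noteq> 0"
    proof
      assume "1 - cnj s * w = 0"
      then have "w * cnj s = 1" by (simp add: mult.commute)
      moreover have "cnj s \<noteq> 0" using s1 by auto
      ultimately have "w = 1 / cnj s" by (simp add: nonzero_eq_divide_eq)
      then show False using Gs(2)[OF w] by (simp add: mirror_def)
    qed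
    have "\<beta> (mirror w) = cnj ((w - s) / (1 - cnj s * w))"
      using w0 Gs(1)[OF w] n1 by (auto simp: \<beta>_def mirror_def divide_simps)
    then have "norm (\<beta> (mirror w)) = norm (w - s) / norm (1 - cnj s * w)"
      by (metis complex_mod_cnj norm_divide)
    then show "norm (\<beta> (mirror w)) * norm (\<beta> w) = 1"
      using n1 Gs(1)[OF w] by (simp add: \<beta>_def norm_divide)
  next
    fix z w assume z: "z \<in> G \<inter> ball 0 \<rho>" and w: "w \<in> cls z"
    have ws: "w \<noteq> s" using Gs cls_G[OF w] by auto
    \<comment> \<open>A class member near the pole would have a value of \<open>\<phi>\<close> larger than \<open>M\<close>.\<close>
    have "norm (\<phi> w) \<le> M" using cls_phi[OF w] M[of z] z by simp
    then have d: "norm (w - s) \<ge> \<epsilon>" using \<epsilon>(2)[OF ws] by (force simp: dist_norm)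
    have "\<beta> w = - cnj s + of_real (1 - (norm s)\<^sup>2) / (w - s)"
      unfolding of_real_diff of_real_1 complex_norm_square \<beta>_def
      using ws by (simp add: field_simps)
    also have "norm \<dots> \<le> norm (- cnj s) + norm (of_real (1 - (norm s)\<^sup>2) / (w - s))" by (rule norm_triangle_ineq)
    also have "norm (of_real (1 - (norm s)\<^sup>2) / (w - s)) \<le> ((norm s)\<^sup>2 + 1) / \<epsilon>"
      unfolding norm_divide norm_of_real using d \<epsilon>(1) by (intro frac_le) (auto simp: abs_le_iff)
    finally show "norm (\<beta> w) \<le> norm s + ((norm s)\<^sup>2 + 1) / \<epsilon>" by simp
  next
    show "norm (mirror s) < 1" by (rule norm_mirror_less[OF s1])
    have "mirror s \<noteq> s" using norm_mirror_less[OF s1] s1 by auto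
    then have "isCont \<beta> (mirror s)" unfolding \<beta>_def by (intro continuous_intros) auto
    moreover have "\<beta> (mirror s) = 0" using s1 by (auto simp: \<beta>_def mirror_def)
    ultimately show "(\<beta> \<longlongrightarrow> 0) (at (mirror s))" by (simp add: isCont_def)
    show "norm (\<beta> z) \<le> 1 - (norm s - 1) / (2 * (norm s + 1)) * (1 - norm z)" if "norm z < 1" for z
      unfolding \<beta>_def by (rule blaschke_factor_bounds[OF s1 that])
  qed (use \<rho> \<rho>N s1 in auto)
qed

text \<open>The product \<open>b\<close> of \<open>\<beta>\<close> over classes is an inner function that is constant on classes. A member
  outside the disc would give \<open>\<bar>b\<bar> \<ge> 1\<close>. For the quantitative bound, \<open>\<bar>b(z)\<bar> \<le> \<bar>\<beta>(z)\<bar>\<close> stays below 1 by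
  a multiple of \<open>1 - \<bar>z\<bar>\<close>, since all other factors have modulus at most 1, while
  \<open>1 - \<bar>b(w)\<bar>\<close> is at most a multiple of \<open>1 - \<bar>w\<bar>\<close>, since \<open>b\<close> is Lipschitz up to the circle.\<close>

lemma cls_in_disc:
  "\<exists>c. 0 < c \<and> c \<le> 1 \<and> (\<forall>z\<in>G. \<forall>w\<in>cls z. norm z < 1 \<longrightarrow> norm w < 1 \<and> norm w \<le> 1 - c * (1 - norm z))"
proof -
  obtain \<beta> \<rho> C c p W where \<rho>: "\<rho> > 1" and W: "open W" "G \<subseteq> W" and \<beta>: "\<beta> holomorphic_on W"
    and mirror: "\<And>w. w \<in> G \<Longrightarrow> norm (\<beta> (mirror w)) * norm (\<beta> w) = 1"
    and bounded: "\<And>z w. z \<in> G \<inter> ball 0 \<rho> \<Longrightarrow> w \<in> cls z \<Longrightarrow> norm (\<beta> w) \<le> C"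
    and p: "norm p < 1" "(\<beta> \<longlongrightarrow> 0) (at p)"
    and c: "c > 0" "\<And>z. norm z < 1 \<Longrightarrow> norm (\<beta> z) \<le> 1 - c * (1 - norm z)"
    by (rule exists_disc_function) blast
  have \<beta>1: "norm (\<beta> z) \<le> 1" if "norm z < 1" for z
    using c(2)[OF that] c(1) that by (smt (verit) mult_nonneg_nonneg)
  define P where "P = (\<lambda>z. \<Prod>w\<in>cls z. \<beta> w)"
  define D where "D = max C 1"
  obtain g0 where g0: "g0 \<in> G" using eventually_G[of 1] by (metis one_neq_zero eventually_happens trivial_limit_at)
  define d where "d = card (cls g0)"
  have card: "card (cls z) = d" if "z \<in> G" for z
    unfolding d_def by (rule card_cls_constant[OF that g0])
  have P_split: "P z = \<beta> z * (\<Prod>w\<in>cls z - {z}. \<beta> w)" if "z \<in> G" for z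
    unfolding P_def by (rule prod.remove[OF finite_cls cls_refl[OF that]])
  have P_le: "norm (P z) \<le> norm (\<beta> z) * D ^ d" if "z \<in> G \<inter> ball 0 \<rho>" for z
  proof -
    have "norm (\<Prod>w\<in>cls z - {z}. \<beta> w) \<le> (\<Prod>w\<in>cls z - {z}. D)"
      unfolding prod_norm[symmetric]
      by (rule prod_mono) (use bounded[OF that] in \<open>force simp: D_def\<close>)
    also have "\<dots> = D ^ card (cls z - {z})" by simp
    also have "\<dots> \<le> D ^ d"
      using card[of z] that finite_cls[of z] by (intro power_increasing) (auto simp: D_def card_Diff1_le)
    finally show ?thesis using P_split[of z] that by (simp add: norm_mult mult_left_mono)
  qed
  have \<beta>D: "norm (\<beta> z) \<le> D" if "z \<in> G \<inter> ball 0 \<rho>" for z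
    using bounded[OF that cls_refl] that by (simp add: D_def)
  have P_bd: "norm (P z) \<le> D * D ^ d" if "z \<in> G \<inter> ball 0 \<rho>" for z
  proof -
    have "norm (\<beta> z) * D ^ d \<le> D * D ^ d"
      by (intro mult_right_mono \<beta>D[OF that]) (auto simp: D_def)
    then show ?thesis using P_le[OF that] by linarith
  qed
  have Phol: "P holomorphic_on ball 0 \<rho> \<inter> G"
    unfolding P_def by (rule cls_symmetric_holomorphic(2)[OF open_ball W(1) \<beta>]) (use cls_G W(2) in blast)
  have bd: "\<exists>C. \<forall>\<^sub>F z in at x within G. norm (P z) \<le> C" if "x \<in> ball 0 \<rho>" for x
  proof -
    have "\<forall>\<^sub>F z in at x within G. z \<in> ball 0 \<rho> \<and> z \<in> G"
      using that unfolding eventually_at_topological by (intro exI[of _ "ball 0 \<rho>"]) auto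
    then have "\<forall>\<^sub>F z in at x within G. norm (P z) \<le> D * D ^ d" by eventually_elim (use P_bd in auto)
    then show ?thesis by blast
  qed
  define b where "b = ext P"
  have bhol: "b holomorphic_on ball 0 \<rho>" unfolding b_def by (rule ext_holomorphic(1)[OF open_ball Phol bd])
  have bP: "b z = P z" if "z \<in> G \<inter> ball 0 \<rho>" for z
    unfolding b_def by (rule ext_holomorphic(2)[OF open_ball Phol bd]) (use that in auto)
  have P_mirror: "norm (P (mirror z)) * norm (P z) = 1" if "z \<in> G" for z
  proof -
    have "norm (P (mirror z)) = (\<Prod>w\<in>cls z. norm (\<beta> (mirror w)))"
      unfolding P_def cls_mirror_eq prod_norm[symmetric] by (subst prod.reindex) (auto simp: inj_on_def)
    then have "norm (P (mirror z)) * norm (P z) = (\<Prod>w\<in>cls z. norm (\<beta> (mirror w)) * norm (\<beta> w))"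
      by (simp add: P_def prod_norm[symmetric] prod.distrib)
    also have "\<dots> = 1" by (rule prod.neutral) (use mirror cls_G in blast)
    finally show ?thesis .
  qed
  have cont_b: "isCont b z" if "norm z < \<rho>" for z
    using bhol that by (intro analytic_at_imp_isCont holomorphic_on_imp_analytic_at[of b "ball 0 \<rho>"]) auto
  \<comment> \<open>At good circle points the class is its own reflection; the bad circle points are isolated.\<close>
  have circle: "norm (b z) = 1" if z: "norm z = 1" for z
  proof -
    have nt: "at z within sphere 0 1 \<noteq> bot"
    proof -
      have "z islimpt sphere 0 1"
      proof (rule connected_imp_perfect)
        show "connected (sphere (0::complex) 1)" by (rule connected_sphere) simp
        show "sphere (0::complex) 1 \<noteq> {a}" for a
        proof
          assume eq: "sphere (0::complex) 1 = {a}"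
          have "1 \<in> sphere (0::complex) 1" "-1 \<in> sphere (0::complex) 1" by auto
          then have "a = 1" "a = -1" unfolding eq by auto
          then show False by simp
        qed
      qed (use z in simp)
      then show ?thesis by (simp add: trivial_limit_within)
    qed
    have "((\<lambda>u. norm (b u)) \<longlongrightarrow> norm (b z)) (at z within sphere 0 1)"
      using cont_b[of z] z \<rho> by (intro tendsto_norm) (auto simp: isCont_def intro: tendsto_within_subset)
    moreover have "\<forall>\<^sub>F u in at z. u \<in> G" using z by (intro eventually_G) auto
    then have "\<forall>\<^sub>F u in at z within sphere 0 1. norm (b u) = 1"
      unfolding eventually_at_filter
    proof eventually_elim
      case (elim u)
      show ?case
      proof (intro impI)
        assume "u \<noteq> z" "u \<in> sphere 0 1"
        then have u: "u \<in> G" "norm u = 1" using elim by auto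
        then have "norm (P u) * norm (P u) = 1" using P_mirror[of u] mirror_on_circle[of u] by simp
        then have "norm (P u) = 1" by (simp add: square_eq_1_iff) (smt (verit) norm_ge_zero)
        then show "norm (b u) = 1" using bP[of u] u \<rho> by simp
      qed
    qed
    then have "((\<lambda>u. norm (b u)) \<longlongrightarrow> 1) (at z within sphere 0 1)" by (rule tendsto_eventually)
    ultimately show ?thesis by (rule tendsto_unique[OF nt])
  qed
  have le1: "norm (b z) \<le> 1" if "norm z \<le> 1" for z
  proof (cases "norm z = 1")
    case False
    show ?thesis
    proof (rule maximum_modulus_frontier[of b "ball 0 1"])
      show "b holomorphic_on interior (ball 0 1)" using bhol \<rho> by (auto elim!: holomorphic_on_subset)
      show "continuous_on (closure (ball 0 1)) b"
        using cont_b \<rho> by (intro continuous_at_imp_continuous_on) auto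
    qed (use circle that False in auto)
  qed (use circle in auto)
  \<comment> \<open>The factor at the point itself tends to \<open>0\<close> at \<open>p\<close>; hence \<open>b\<close> is not a unimodular constant.\<close>
  have bp: "b p = 0" unfolding b_def
  proof (rule ext_tendsto, rule Lim_null_comparison[of P "\<lambda>z. norm (\<beta> z) * D ^ d"])
    have "\<forall>\<^sub>F z in at p within G. z \<in> ball 0 \<rho> \<and> z \<in> G"
      using p \<rho> unfolding eventually_at_topological by (intro exI[of _ "ball 0 \<rho>"]) auto
    then show "\<forall>\<^sub>F z in at p within G. norm (P z) \<le> norm (\<beta> z) * D ^ d"
      by eventually_elim (use P_le in auto)
    have "(\<beta> \<longlongrightarrow> 0) (at p within G)" using p(2) by (rule tendsto_within_subset) auto
    then show "((\<lambda>z. norm (\<beta> z) * D ^ d) \<longlongrightarrow> 0) (at p within G)"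
      by (intro tendsto_mult_left_zero tendsto_norm_zero)
  qed
  have lt1: "norm (b z) < 1" if z: "norm z < 1" for z
  proof (rule ccontr)
    assume "\<not> norm (b z) < 1"
    then have "norm (b z) = 1" using le1[of z] z by simp
    have "b constant_on ball 0 1"
      by (rule maximum_modulus_principle[of b "ball 0 1" "ball 0 1" z])
         (use z \<open>norm (b z) = 1\<close> le1 bhol \<rho> in \<open>auto elim!: holomorphic_on_subset\<close>)
    then have "b z = b p" using z p by (auto simp: constant_on_def)
    then show False using bp \<open>norm (b z) = 1\<close> by simp
  qed
  have inside: "norm w < 1" if z: "z \<in> G" "w \<in> cls z" "norm z < 1" for z w
  proof (rule ccontr)
    assume "\<not> norm w < 1"
    then have w: "norm (mirror w) \<le> 1" by (simp add: norm_mirror divide_le_eq)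
    have wG: "w \<in> G" using cls_G that by blast
    have "P w = P z" unfolding P_def using cls_eq[OF z(2)] by simp
    then have "norm (P w) < 1" using lt1[OF z(3)] bP[of z] z \<rho> by simp
    moreover have "norm (P (mirror w)) \<le> 1" using le1[OF w] bP[of "mirror w"] w wG \<rho> by simp
    ultimately have "norm (P (mirror w)) * norm (P w) < 1"
      by (smt (verit) mult_left_le_one_le norm_ge_zero)
    then show False using P_mirror[OF wG] by simp
  qed
  have upper: "norm (b z) \<le> 1 - c * (1 - norm z)" if z: "z \<in> G" "norm z < 1" for z
  proof -
    have "norm (\<Prod>w\<in>cls z - {z}. \<beta> w) \<le> 1"
      unfolding prod_norm[symmetric] by (rule prod_le_1) (use \<beta>1 inside z in auto)
    then have "norm (P z) \<le> norm (\<beta> z)"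
      using P_split[OF z(1)] by (simp add: norm_mult mult_left_le)
    also have "\<dots> \<le> 1 - c * (1 - norm z)" using c(2) z by blast
    finally show ?thesis using bP[of z] z \<rho> by simp
  qed
  have "continuous_on (ball 0 \<rho>) (deriv b)"
    using bhol by (intro holomorphic_on_imp_continuous_on holomorphic_deriv) auto
  then have "continuous_on (cball 0 1) (deriv b)" by (rule continuous_on_subset) (use \<rho> in auto)
  then have "bounded (deriv b ` cball 0 1)"
    by (intro compact_imp_bounded compact_continuous_image) auto
  then obtain L0 where "\<forall>z\<in>cball 0 1. norm (deriv b z) \<le> L0" by (auto simp: bounded_iff)
  then have L: "\<forall>z\<in>cball 0 1. norm (deriv b z) \<le> max L0 1" by force
  define L where "L = max L0 1"
  have L1: "L \<ge> 1" by (simp add: L_def)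
  have lower: "norm (b w) \<ge> 1 - L * (1 - norm w)" if w: "norm w < 1" "w \<noteq> 0" for w
  proof -
    have "norm (b w - b (w / norm w)) \<le> L * norm (w - w / norm w)"
    proof (rule field_differentiable_bound[of "cball 0 1" b "deriv b"])
      show "(b has_field_derivative deriv b z) (at z within cball 0 1)" if "z \<in> cball 0 1" for z
        using holomorphic_derivI[OF bhol open_ball, of z] that \<rho> by (auto intro: has_field_derivative_at_within)
    qed (use L w in \<open>auto simp: L_def norm_divide\<close>)
    also have "w - w / norm w = w * of_real (1 - 1 / norm w)" by (simp add: algebra_simps)
    also have "norm \<dots> = 1 - norm w"
    proof -
      have "1 - 1 / norm w \<le> 0" using w by simp
      then show ?thesis using w unfolding norm_mult norm_of_real by (simp add: algebra_simps)
    qed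
    finally have "norm (b w - b (w / norm w)) \<le> L * (1 - norm w)" .
    moreover have "norm (b (w / norm w)) = 1" by (rule circle) (use w in \<open>simp add: norm_divide\<close>)
    ultimately show ?thesis using norm_triangle_ineq3[of "b w" "b (w / norm w)"] by linarith
  qed
  show ?thesis
  proof (intro exI[of _ "min (c / L) 1"] conjI ballI impI)
    fix z w assume z: "z \<in> G" "w \<in> cls z" "norm z < 1"
    show w1: "norm w < 1" by (rule inside[OF z])
    have wG: "w \<in> G" using cls_G z by blast
    then have w0: "w \<noteq> 0" by (auto simp: G_def)
    have "b w = b z" using bP[of w] bP[of z] w1 wG z \<rho> cls_eq[OF z(2)] by (simp add: P_def)
    then have "1 - L * (1 - norm w) \<le> 1 - c * (1 - norm z)"
      using lower[OF w1 w0] upper[OF z(1,3)] by simp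
    then have "c / L * (1 - norm z) \<le> 1 - norm w" using L1 by (simp add: field_simps)
    moreover have "min (c / L) 1 * (1 - norm z) \<le> c / L * (1 - norm z)"
      using z(3) by (intro mult_right_mono) auto
    ultimately show "norm w \<le> 1 - min (c / L) 1 * (1 - norm z)" by linarith
  qed (use c L1 in auto)
qed

end

section \<open>Harmonic majorants and circular means\<close>

lemma Cauchy_integral_circle_cis:
  assumes "f holomorphic_on cball 0 R" "norm w < R"
  shows "integral {0..2 * pi} (\<lambda>t. f (of_real R * cis t) / (of_real R * cis t - w) * (of_real R * cis t)) = 2 * of_real pi * f w"
proof -
  have "((\<lambda>u. f u / (u - w)) has_contour_integral (2 * of_real pi * \<i> * f w)) (circlepath 0 R)"
    by (rule Cauchy_integral_circlepath_simple) (use assms in auto)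
  then have "contour_integral (circlepath 0 R) (\<lambda>u. f u / (u - w)) = 2 * of_real pi * \<i> * f w"
    by (rule contour_integral_unique)
  then have "integral {0..2 * pi} (\<lambda>t. f (of_real R * cis t) / (of_real R * cis t - w) * of_real R * \<i> * cis t) = 2 * of_real pi * \<i> * f w"
    unfolding circlepath_def by (subst (asm) contour_integral_part_circlepath_eq) auto
  moreover have "(\<lambda>t. f (of_real R * cis t) / (of_real R * cis t - w) * of_real R * \<i> * cis t) =
    (\<lambda>t. \<i> * (f (of_real R * cis t) / (of_real R * cis t - w) * (of_real R * cis t)))"
    by (auto simp: mult_ac)
  ultimately have "integral {0..2 * pi} (\<lambda>t. \<i> * (f (of_real R * cis t) / (of_real R * cis t - w) * (of_real R * cis t))) = \<i> * (2 * of_real pi * f w)"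
    by (simp only: mult_ac)
  then show ?thesis unfolding Henstock_Kurzweil_Integration.integral_mult_right by simp
qed

lemma circle_mean_value:
  assumes "f holomorphic_on cball 0 r" "0 \<le> r"
  shows "integral {0..2 * pi} (\<lambda>t. f (of_real r * cis t)) = 2 * of_real pi * f 0"
proof (cases "r = 0")
  case False
  then have "0 < r" using assms by simp
  have "integral {0..2 * pi} (\<lambda>t. f (of_real r * cis t) / (of_real r * cis t - 0) * (of_real r * cis t)) = 2 * of_real pi * f 0"
    by (rule Cauchy_integral_circle_cis) (use assms \<open>0 < r\<close> in auto)
  moreover have "f (of_real r * cis t) / (of_real r * cis t - 0) * (of_real r * cis t) = f (of_real r * cis t)" for t
    using False by simp
  ultimately show ?thesis by simp
qed (simp add: scaleR_conv_of_real)

lemma herglotz_kernel_Re: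
  fixes a w :: complex
  assumes "norm w < norm a"
  shows "Re ((a + w) / (a - w)) = ((norm a)\<^sup>2 - (norm w)\<^sup>2) / (norm (a - w))\<^sup>2"
proof -
  have "(a + w) / (a - w) = (a + w) * cnj (a - w) / of_real ((norm (a - w))\<^sup>2)"
    by (rule complex_div_cnj)
  also have "Re \<dots> = Re ((a + w) * cnj (a - w)) / (norm (a - w))\<^sup>2" by (rule Re_divide_of_real)
  also have "Re ((a + w) * cnj (a - w)) = (norm a)\<^sup>2 - (norm w)\<^sup>2"
    unfolding cmod_power2 by (simp add: algebra_simps power2_eq_square)
  finally show ?thesis .
qed

lemma poisson_kernel_bound:
  fixes a w :: complex
  assumes "norm w < norm a"
  shows "((norm a)\<^sup>2 - (norm w)\<^sup>2) / (norm (a - w))\<^sup>2 \<le> (norm a + norm w) / (norm a - norm w)"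
proof -
  have d: "norm a - norm w > 0" "norm (a - w) \<ge> norm a - norm w"
    using assms norm_triangle_ineq2[of a w] by auto
  have "((norm a)\<^sup>2 - (norm w)\<^sup>2) / (norm (a - w))\<^sup>2 \<le> ((norm a)\<^sup>2 - (norm w)\<^sup>2) / (norm a - norm w)\<^sup>2"
  proof (rule divide_left_mono)
    show "(norm a - norm w)\<^sup>2 \<le> (norm (a - w))\<^sup>2" using d by (intro power_mono) auto
    show "0 \<le> (norm a)\<^sup>2 - (norm w)\<^sup>2" using assms by (simp add: power_mono)
    show "0 < (norm (a - w))\<^sup>2 * (norm a - norm w)\<^sup>2" using d by (intro mult_pos_pos zero_less_power) auto
  qed
  also have "((norm a)\<^sup>2 - (norm w)\<^sup>2) / (norm a - norm w)\<^sup>2 = (norm a + norm w) / (norm a - norm w)"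
  proof -
    have "(norm a)\<^sup>2 - (norm w)\<^sup>2 = (norm a + norm w) * (norm a - norm w)"
      by (simp add: power2_eq_square algebra_simps)
    then show ?thesis using d by (simp add: power2_eq_square)
  qed
  finally show ?thesis .
qed

text \<open>The Herglotz integral of the boundary values of \<open>\<bar>f\<bar>\<^sup>2\<close> on the circle of radius \<open>R\<close>; its real part is
  their Poisson integral. The upper bound is Harnack's inequality.\<close>

lemma harmonic_majorant:
  assumes f: "f holomorphic_on ball 0 1" and R: "0 < R" "R < 1"
  obtains k where "k holomorphic_on ball 0 R"
    "\<And>w. norm w < R \<Longrightarrow> (norm (f w))\<^sup>2 \<le> Re (k w)"
    "\<And>w. norm w < R \<Longrightarrow> Re (k w) \<le> (R + norm w) / (R - norm w) * hardy_mean f R"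
proof -
  let ?I = "{0..2 * pi}"
  define a where "a = (\<lambda>t. of_real R * cis t)"
  have na: "norm (a t) = R" for t using R by (simp add: a_def norm_mult)
  have aw: "a t \<noteq> w" if "norm w < R" for t w using na[of t] that by auto
  have ca: "continuous_on S a" for S unfolding a_def by (intro continuous_intros)
  have cf: "continuous_on S (\<lambda>t. f (a t))" for S
    by (rule continuous_on_compose2[OF holomorphic_on_imp_continuous_on[OF f] ca]) (use na R in auto)
  have ca2: "continuous_on S (\<lambda>p. a (snd p))" for S :: "(complex \<times> real) set"
    by (rule continuous_on_compose2[OF ca[of UNIV]]) (auto intro: continuous_intros)
  have cf2: "continuous_on S (\<lambda>p. f (a (snd p)))" for S :: "(complex \<times> real) set"
    by (rule continuous_on_compose2[OF cf[of UNIV]]) (auto intro: continuous_intros)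
  define k where "k = (\<lambda>w. integral (cbox 0 (2 * pi)) (\<lambda>t. (a t + w) / (a t - w) * of_real ((norm (f (a t)))\<^sup>2)) / (2 * pi))"
  have khol: "k holomorphic_on ball 0 R"
    unfolding k_def
  proof (intro holomorphic_intros leibniz_rule_holomorphic[where fx = "\<lambda>w t. (2 * a t) / (a t - w)\<^sup>2 * of_real ((norm (f (a t)))\<^sup>2)"])
    show "((\<lambda>w. (a t + w) / (a t - w) * complex_of_real ((cmod (f (a t)))\<^sup>2)) has_field_derivative
         2 * a t / (a t - w)\<^sup>2 * complex_of_real ((cmod (f (a t)))\<^sup>2)) (at w within ball 0 R)"
      if "w \<in> ball 0 R" for w t
      using aw[of w t] that by (auto intro!: derivative_eq_intros simp: power2_eq_square field_simps)
    show "(\<lambda>t. (a t + w) / (a t - w) * complex_of_real ((cmod (f (a t)))\<^sup>2)) integrable_on cbox 0 (2 * pi)"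
      if "w \<in> ball 0 R" for w
      by (intro integrable_continuous continuous_intros ca cf) (use aw[of w] that in auto)
    have "continuous_on (ball 0 R \<times> cbox 0 (2 * pi)) (\<lambda>p. (2 * a (snd p)) / (a (snd p) - fst p)\<^sup>2 * of_real ((norm (f (a (snd p))))\<^sup>2))"
      by (intro continuous_intros ca2 cf2) (use aw in auto)
    then show "continuous_on (ball 0 R \<times> cbox 0 (2 * pi)) (\<lambda>(w, t). (2 * a t) / (a t - w)\<^sup>2 * of_real ((norm (f (a t)))\<^sup>2))"
      by (simp add: case_prod_unfold)
  qed (auto)
  define Q where "Q = (\<lambda>w t. (R\<^sup>2 - (norm w)\<^sup>2) / (norm (a t - w))\<^sup>2 * (norm (f (a t)))\<^sup>2)"
  have Re_k: "Re (k w) = integral ?I (Q w) / (2 * pi)" if "norm w < R" for w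
  proof -
    have int: "(\<lambda>t. (a t + w) / (a t - w) * of_real ((norm (f (a t)))\<^sup>2)) integrable_on ?I"
      by (intro integrable_continuous_real continuous_intros ca cf) (use aw[OF that] in auto)
    have "Re (k w) = Re (integral ?I (\<lambda>t. (a t + w) / (a t - w) * of_real ((norm (f (a t)))\<^sup>2))) / (2 * pi)"
      unfolding k_def using Re_divide_of_real[of _ "2 * pi"] by simp
    also have "Re (integral ?I (\<lambda>t. (a t + w) / (a t - w) * of_real ((norm (f (a t)))\<^sup>2))) =
        integral ?I (\<lambda>t. Re ((a t + w) / (a t - w) * of_real ((norm (f (a t)))\<^sup>2)))"
      using integral_linear[OF int bounded_linear_Re] by (simp add: o_def)
    also have "(\<lambda>t. Re ((a t + w) / (a t - w) * of_real ((norm (f (a t)))\<^sup>2))) = Q w"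
    proof
      fix t
      have "Re ((a t + w) / (a t - w)) = (R\<^sup>2 - (norm w)\<^sup>2) / (norm (a t - w))\<^sup>2"
        using herglotz_kernel_Re[of w "a t"] that na by simp
      moreover have "Re (x * of_real y) = Re x * y" for x y by simp
      ultimately show "Re ((a t + w) / (a t - w) * of_real ((norm (f (a t)))\<^sup>2)) = Q w t"
        by (simp only: Q_def)
    qed
    finally show ?thesis .
  qed
  have cQ: "continuous_on ?I (Q w)" if "norm w < R" for w :: complex
    unfolding Q_def by (intro continuous_intros ca cf) (use aw[OF that] in auto)
  have hm: "hardy_mean f R = integral ?I (\<lambda>t. (norm (f (a t)))\<^sup>2) / (2 * pi)"
    by (simp add: hardy_mean_def a_def)
  show thesis
  proof (rule that[OF khol])
    fix w :: complex assume w: "norm w < R"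
    have "integral ?I (Q w) \<le> integral ?I (\<lambda>t. (R + norm w) / (R - norm w) * (norm (f (a t)))\<^sup>2)"
    proof (rule integral_le)
      show "Q w integrable_on ?I" by (intro integrable_continuous_real cQ w)
      show "(\<lambda>t. (R + norm w) / (R - norm w) * (norm (f (a t)))\<^sup>2) integrable_on ?I"
        by (intro integrable_continuous_real continuous_intros cf)
      show "Q w t \<le> (R + norm w) / (R - norm w) * (norm (f (a t)))\<^sup>2" for t
        unfolding Q_def by (intro mult_right_mono) (use poisson_kernel_bound[of w "a t"] na w in auto)
    qed
    from divide_right_mono[OF this, of "2 * pi"]
    show "Re (k w) \<le> (R + norm w) / (R - norm w) * hardy_mean f R"
      unfolding Re_k[OF w] hm by simp
    \<comment> \<open>Cauchy's formula at \<open>w\<close> for this function: its value there is \<open>(f w)\<^sup>2\<close>, and on the circle the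
      modulus of the integrand is exactly the Poisson kernel times \<open>\<bar>f\<bar>\<^sup>2\<close>.\<close>
    define h where "h = (\<lambda>u. (f u)\<^sup>2 * (R\<^sup>2 - (norm w)\<^sup>2) / (R\<^sup>2 - cnj w * u))"
    have nz: "of_real R ^ 2 - cnj w * u \<noteq> 0" if "norm u \<le> R" for u
    proof
      assume "of_real R ^ 2 - cnj w * u = 0"
      then have "norm (cnj w * u) = norm (of_real R ^ 2 :: complex)" by simp
      then have "norm w * norm u = R * R" using R by (simp add: norm_mult norm_power power2_eq_square)
      moreover have "norm w * norm u \<le> norm w * R" using that by (intro mult_left_mono) auto
      moreover have "norm w * R < R * R" using w R by simp
      ultimately show False by simp
    qed
    have "h holomorphic_on cball 0 R"
      unfolding h_def using f R nz by (intro holomorphic_intros) (auto elim!: holomorphic_on_subset)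
    from Cauchy_integral_circle_cis[OF this w]
    have C: "integral ?I (\<lambda>t. h (a t) / (a t - w) * a t) = 2 * of_real pi * h w" by (simp add: a_def)
    have "of_real R ^ 2 - cnj w * w = of_real (R\<^sup>2 - (norm w)\<^sup>2)"
      unfolding of_real_diff complex_norm_square by (simp add: mult.commute)
    moreover have "of_real (R\<^sup>2 - (norm w)\<^sup>2) \<noteq> (0::complex)" using nz[of w] w calculation by auto
    ultimately have hw: "h w = (f w)\<^sup>2" by (simp add: h_def)
    have "norm (integral ?I (\<lambda>t. h (a t) / (a t - w) * a t)) \<le> integral ?I (Q w)"
    proof (rule Henstock_Kurzweil_Integration.integral_norm_bound_integral)
      show "(\<lambda>t. h (a t) / (a t - w) * a t) integrable_on ?I"
        unfolding h_def by (intro integrable_continuous_real continuous_intros ca cf) (use aw[OF w] nz na in auto)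
      show "Q w integrable_on ?I" by (intro integrable_continuous_real cQ w)
      fix t
      have "a t * cnj (a t) = of_real R ^ 2" using complex_norm_square[of "a t"] na by simp
      then have "of_real R ^ 2 - cnj w * a t = a t * cnj (a t - w)" by (simp add: algebra_simps)
      then have "norm (of_real R ^ 2 - cnj w * a t) = R * norm (a t - w)"
        by (simp only: norm_mult complex_mod_cnj na)
      moreover have "norm (complex_of_real (R\<^sup>2 - (norm w)\<^sup>2)) = R\<^sup>2 - (norm w)\<^sup>2"
        using w R by (simp only: norm_of_real) (simp add: power_mono)
      ultimately have "norm (h (a t)) = (norm (f (a t)))\<^sup>2 * (R\<^sup>2 - (norm w)\<^sup>2) / (R * norm (a t - w))"
        unfolding h_def norm_divide norm_mult norm_power by simp
      then have "norm (h (a t) / (a t - w) * a t) = (norm (f (a t)))\<^sup>2 * (R\<^sup>2 - (norm w)\<^sup>2) / (R * norm (a t - w)) / norm (a t - w) * R"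
        by (simp add: norm_mult norm_divide na)
      also have "\<dots> = Q w t" using R aw[OF w, of t] by (simp add: Q_def power2_eq_square field_simps)
      finally show "norm (h (a t) / (a t - w) * a t) \<le> Q w t" by simp
    qed
    then have "2 * pi * (norm (f w))\<^sup>2 \<le> integral ?I (Q w)" unfolding C hw by (simp add: norm_mult norm_power)
    then show "(norm (f w))\<^sup>2 \<le> Re (k w)" unfolding Re_k[OF w] by (simp add: field_simps)
  qed
qed

section \<open>Area integrals in polar coordinates\<close>

definition plane :: "real \<Rightarrow> real \<Rightarrow> complex" where
  "plane x y = of_real x + \<i> * of_real y"

lemma borel_measurable_plane [measurable]:
  assumes [measurable]: "f \<in> borel_measurable M" "g \<in> borel_measurable M"
  shows "(\<lambda>u. plane (f u) (g u)) \<in> borel_measurable M"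
  unfolding plane_def by measurable

lemma lborel_complex_eq:
  "(lborel :: complex measure) = distr (lborel \<Otimes>\<^sub>M lborel) borel (\<lambda>p. plane (fst p) (snd p))"
proof (rule lborel_eqI)
  fix l u :: complex assume le: "\<And>b. b \<in> Basis \<Longrightarrow> l \<bullet> b \<le> u \<bullet> b"
  have "Re l \<le> Re u" "Im l \<le> Im u" using le[of 1] le[of \<i>] by (auto simp: Basis_complex_def)
  have "(\<lambda>p. plane (fst p) (snd p)) -` box l u \<inter> space (lborel \<Otimes>\<^sub>M lborel) = {Re l<..<Re u} \<times> {Im l<..<Im u}"
    by (auto simp: in_box_complex_iff plane_def space_pair_measure)
  then have "emeasure (distr (lborel \<Otimes>\<^sub>M lborel) borel (\<lambda>p. plane (fst p) (snd p))) (box l u) =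
     emeasure (lborel \<Otimes>\<^sub>M lborel) ({Re l<..<Re u} \<times> {Im l<..<Im u})"
    by (subst emeasure_distr) auto
  also have "\<dots> = ennreal (Re u - Re l) * ennreal (Im u - Im l)"
    using \<open>Re l \<le> Re u\<close> \<open>Im l \<le> Im u\<close> by (subst lborel.emeasure_pair_measure_Times) auto
  also have "\<dots> = ennreal (\<Prod>b\<in>Basis. (u - l) \<bullet> b)"
    using \<open>Re l \<le> Re u\<close> \<open>Im l \<le> Im u\<close> by (simp add: Basis_complex_def ennreal_mult)
  finally show "emeasure (distr (lborel \<Otimes>\<^sub>M lborel) borel (\<lambda>p. plane (fst p) (snd p))) (box l u) = ennreal (\<Prod>b\<in>Basis. (u - l) \<bullet> b)" .
qed simp

lemma nn_integral_plane:
  fixes g :: "complex \<Rightarrow> ennreal"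
  assumes [measurable]: "g \<in> borel_measurable borel"
  shows "(\<integral>\<^sup>+z. g z \<partial>lborel) = (\<integral>\<^sup>+y. \<integral>\<^sup>+x. g (plane x y) \<partial>lborel \<partial>lborel)"
  unfolding lborel_complex_eq
  by (subst nn_integral_distr, simp, simp)
     (subst lborel_pair.nn_integral_snd[symmetric], simp_all)

text \<open>The angle \<open>t\<close> of a point of the upper half plane and its slope coordinate \<open>s = cot t\<close>, written as
  \<open>tan (pi / 2 - t)\<close> so that the branch of \<open>arctan\<close> fits. Both measures give the half line beyond \<open>x\<close>
  the mass \<open>pi / 2 - arctan x\<close>.\<close>

lemma tan_pushforward:
  fixes h :: "real \<Rightarrow> ennreal"
  assumes [measurable]: "h \<in> borel_measurable borel"
  shows "(\<integral>\<^sup>+s. ennreal (1 / (1 + s\<^sup>2)) * h s \<partial>lborel) = (\<integral>\<^sup>+t. h (tan (pi / 2 - t)) * indicator {0<..<pi} t \<partial>lborel)"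
proof -
  let ?s = "\<lambda>t. tan (pi / 2 - t)"
  have [measurable]: "?s \<in> borel_measurable borel" unfolding tan_def by measurable
  let ?M = "density lborel (\<lambda>s. ennreal (1 / (1 + s\<^sup>2)))"
  let ?N = "distr (density lborel (indicator {0<..<pi})) borel ?s"
  have lt: "?s t > x \<longleftrightarrow> t < pi / 2 - arctan x" if "0 < t" "t < pi" for t x
  proof -
    have "arctan (tan (pi / 2 - t)) = pi / 2 - t" using that by (intro arctan_tan) auto
    then show ?thesis using arctan_less_iff[of x "tan (pi / 2 - t)"] by auto
  qed
  have M: "emeasure ?M {x<..} = ennreal (pi / 2 - arctan x)" for x
  proof -
    have "(\<integral>\<^sup>+s. ennreal (1 / (1 + s\<^sup>2)) * indicator {x..} s \<partial>lborel) = ennreal (pi / 2 - arctan x)"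
      by (rule nn_integral_FTC_atLeast)
         (auto intro!: derivative_eq_intros tendsto_arctan_at_top simp: field_simps power2_eq_square add_nonneg_eq_0_iff)
    moreover have "(\<integral>\<^sup>+s. ennreal (1 / (1 + s\<^sup>2)) * indicator {x..} s \<partial>lborel) =
       (\<integral>\<^sup>+s. ennreal (1 / (1 + s\<^sup>2)) * indicator {x<..} s \<partial>lborel)"
      by (rule nn_integral_cong_AE) (use AE_lborel_singleton[of x] in \<open>eventually_elim, auto split: split_indicator\<close>)
    ultimately show ?thesis by (simp add: emeasure_density)
  qed
  have N: "emeasure ?N {x<..} = ennreal (pi / 2 - arctan x)" for x
  proof -
    have "emeasure ?N {x<..} = (\<integral>\<^sup>+t. indicator {0<..<pi} t * indicator (?s -` {x<..}) t \<partial>lborel)"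
    proof -
      have [measurable]: "?s -` {x<..} \<in> sets borel"
        using measurable_sets[of ?s borel borel "{x<..}"] by simp
      show ?thesis by (simp add: emeasure_distr) (subst emeasure_density, auto)
    qed
    also have "\<dots> = (\<integral>\<^sup>+t. indicator {0<..<pi / 2 - arctan x} t \<partial>lborel)"
      using lt arctan_lbound[of x] by (intro nn_integral_cong) (auto split: split_indicator)
    also have "\<dots> = ennreal (pi / 2 - arctan x)" using arctan_ubound[of x] by simp
    finally show ?thesis .
  qed
  have "?M = ?N" by (rule measure_eqI_lessThan) (simp_all add: M N)
  then have "(\<integral>\<^sup>+s. h s \<partial>?M) = (\<integral>\<^sup>+s. h s \<partial>?N)" by simp
  then show ?thesis by (simp add: nn_integral_density nn_integral_distr mult.commute)
qed

lemma tan_cis: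
  assumes "0 < t" "t < pi"
  shows "plane (tan (pi / 2 - t)) 1 = of_real (sqrt (1 + (tan (pi / 2 - t))\<^sup>2)) * cis t"
proof -
  have s: "sin t > 0" using assms by (simp add: sin_gt_zero)
  have tan: "tan (pi / 2 - t) = cos t / sin t" by (simp add: tan_def sin_diff cos_diff)
  have "1 + (cos t / sin t)\<^sup>2 = (1 / sin t)\<^sup>2"
    using s sin_cos_squared_add[of t] by (simp add: field_simps power2_eq_square)
  then have "sqrt (1 + (tan (pi / 2 - t))\<^sup>2) = 1 / sin t" using s unfolding tan by simp
  then show ?thesis unfolding tan using s by (simp add: plane_def complex_eq_iff)
qed

definition ray_integral :: "(complex \<Rightarrow> ennreal) \<Rightarrow> complex \<Rightarrow> ennreal" where
  "ray_integral g e = (\<integral>\<^sup>+r. ennreal r * g (of_real r * e) * indicator {0<..} r \<partial>lborel)"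

lemma borel_measurable_ray_integral [measurable]:
  assumes [measurable]: "g \<in> borel_measurable borel" "e \<in> borel_measurable M"
  shows "(\<lambda>x. ray_integral g (e x)) \<in> borel_measurable M"
  unfolding ray_integral_def by measurable

text \<open>The substitutions \<open>x = y s\<close>, then \<open>y = r / sqrt (1 + s\<^sup>2)\<close>, then \<open>s = cot t\<close>, each one-dimensional.\<close>

lemma nn_integral_upper_polar:
  fixes g :: "complex \<Rightarrow> ennreal"
  assumes [measurable]: "g \<in> borel_measurable borel"
  shows "(\<integral>\<^sup>+y. \<integral>\<^sup>+x. g (plane x y) * indicator {0<..} y \<partial>lborel \<partial>lborel) =
    (\<integral>\<^sup>+t. ray_integral g (cis t) * indicator {0<..<pi} t \<partial>lborel)"
proof -
  have "(\<integral>\<^sup>+x. g (plane x y) * indicator {0<..} y \<partial>lborel) =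
     (\<integral>\<^sup>+s. ennreal y * g (of_real y * plane s 1) * indicator {0<..} y \<partial>lborel)" for y :: real
  proof (cases "y > 0")
    case True
    have "(\<integral>\<^sup>+x. g (plane x y) * indicator {0<..} y \<partial>lborel) = (\<integral>\<^sup>+x. g (plane x y) \<partial>lborel)" using True by simp
    also have "\<dots> = ennreal \<bar>y\<bar> * (\<integral>\<^sup>+s. g (plane (0 + y * s) y) \<partial>lborel)"
      by (rule nn_integral_real_affine) (use True in auto)
    also have "\<dots> = (\<integral>\<^sup>+s. ennreal y * g (plane (y * s) y) \<partial>lborel)"
      using True by (subst nn_integral_cmult) auto
    finally show ?thesis using True by (simp add: plane_def algebra_simps)
  qed simp
  then have "(\<integral>\<^sup>+y. \<integral>\<^sup>+x. g (plane x y) * indicator {0<..} y \<partial>lborel \<partial>lborel) =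
     (\<integral>\<^sup>+y. \<integral>\<^sup>+s. ennreal y * g (of_real y * plane s 1) * indicator {0<..} y \<partial>lborel \<partial>lborel)" by simp
  also have "\<dots> = (\<integral>\<^sup>+s. \<integral>\<^sup>+y. ennreal y * g (of_real y * plane s 1) * indicator {0<..} y \<partial>lborel \<partial>lborel)"
    by (rule lborel_pair.Fubini') measurable
  also have "\<dots> = (\<integral>\<^sup>+s. ennreal (1 / (1 + s\<^sup>2)) *
      ray_integral g (plane s 1 / of_real (sqrt (1 + s\<^sup>2))) \<partial>lborel)"
  proof (rule nn_integral_cong)
    fix s :: real
    define c where "c = 1 / sqrt (1 + s\<^sup>2)"
    have "1 + s\<^sup>2 > 0" by (simp add: add_pos_nonneg)
    then have c: "c > 0" "c * c = 1 / (1 + s\<^sup>2)" by (auto simp: c_def)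
    have "(\<integral>\<^sup>+y. ennreal y * g (of_real y * plane s 1) * indicator {0<..} y \<partial>lborel) =
      ennreal \<bar>c\<bar> * (\<integral>\<^sup>+r. ennreal (0 + c * r) * g (of_real (0 + c * r) * plane s 1) * indicator {0<..} (0 + c * r) \<partial>lborel)"
      by (rule nn_integral_real_affine) (use c in auto)
    also have "\<dots> = (\<integral>\<^sup>+r. ennreal c * (ennreal (c * r) * g (of_real (c * r) * plane s 1) * indicator {0<..} (c * r)) \<partial>lborel)"
      using c by (subst nn_integral_cmult) auto
    also have "\<dots> = (\<integral>\<^sup>+r. ennreal (c * c) * (ennreal r * g (of_real r * (plane s 1 / of_real (sqrt (1 + s\<^sup>2)))) * indicator {0<..} r) \<partial>lborel)"
    proof (rule nn_integral_cong)
      fix r :: real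
      show "ennreal c * (ennreal (c * r) * g (of_real (c * r) * plane s 1) * indicator {0<..} (c * r)) =
         ennreal (c * c) * (ennreal r * g (of_real r * (plane s 1 / of_real (sqrt (1 + s\<^sup>2)))) * indicator {0<..} r)"
      proof (cases "r > 0")
        case True
        have "ennreal c * ennreal (c * r) = ennreal (c * c) * ennreal r"
          using c(1) True by (simp add: ennreal_mult[symmetric] mult_ac)
        moreover have "of_real (c * r) * plane s 1 = of_real r * (plane s 1 / of_real (sqrt (1 + s\<^sup>2)))"
          by (simp add: c_def)
        ultimately show ?thesis using True c(1) by (simp add: mult.assoc[symmetric])
      next
        case False
        then have "\<not> c * r > 0" using c(1) by (simp add: zero_less_mult_iff)
        then show ?thesis using False by simp
      qed
    qed
    also have "\<dots> = ennreal (c * c) * ray_integral g (plane s 1 / of_real (sqrt (1 + s\<^sup>2)))"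
      unfolding ray_integral_def by (rule nn_integral_cmult) measurable
    finally show "(\<integral>\<^sup>+y. ennreal y * g (of_real y * plane s 1) * indicator {0<..} y \<partial>lborel) =
      ennreal (1 / (1 + s\<^sup>2)) * ray_integral g (plane s 1 / of_real (sqrt (1 + s\<^sup>2)))"
      using c by simp
  qed
  also have "\<dots> = (\<integral>\<^sup>+t. ray_integral g (plane (tan (pi / 2 - t)) 1 / of_real (sqrt (1 + (tan (pi / 2 - t))\<^sup>2))) * indicator {0<..<pi} t \<partial>lborel)"
    by (rule tan_pushforward) measurable
  also have "\<dots> = (\<integral>\<^sup>+t. ray_integral g (cis t) * indicator {0<..<pi} t \<partial>lborel)"
  proof (rule nn_integral_cong)
    fix t :: real
    have "plane (tan (pi / 2 - t)) 1 / of_real (sqrt (1 + (tan (pi / 2 - t))\<^sup>2)) = cis t" if "0 < t" "t < pi"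
    proof -
      have "sqrt (1 + (tan (pi / 2 - t))\<^sup>2) \<noteq> 0" by (smt (verit) real_sqrt_eq_zero_cancel_iff zero_le_power2)
      then show ?thesis unfolding tan_cis[OF that] by simp
    qed
    note e = this
    show "ray_integral g (plane (tan (pi / 2 - t)) 1 / of_real (sqrt (1 + (tan (pi / 2 - t))\<^sup>2))) * indicator {0<..<pi} t =
      ray_integral g (cis t) * indicator {0<..<pi} t"
    proof (cases "0 < t \<and> t < pi")
      case True
      then show ?thesis by (simp only: e)
    qed simp
  qed
  finally show ?thesis .
qed

text \<open>The lower half plane is the image of the upper one under \<open>z \<mapsto> - z\<close>, a shift of the angle by \<open>pi\<close>.\<close>

lemma nn_integral_polar:
  fixes g :: "complex \<Rightarrow> ennreal"
  assumes [measurable]: "g \<in> borel_measurable borel"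
  shows "(\<integral>\<^sup>+z. g z \<partial>lborel) =
    (\<integral>\<^sup>+t. ray_integral g (cis t) * indicator {0..2 * pi} t \<partial>lborel)"
proof -
  define \<Phi> where "\<Phi> = (\<lambda>t. ray_integral g (cis t))"
  have [measurable]: "cis \<in> borel_measurable borel" unfolding cis_conv_exp by measurable
  have [measurable]: "\<Phi> \<in> borel_measurable borel" unfolding \<Phi>_def by measurable
  define J where "J = (\<lambda>y. \<integral>\<^sup>+x. g (plane x y) \<partial>lborel)"
  have [measurable]: "J \<in> borel_measurable borel" unfolding J_def by measurable
  have up: "(\<integral>\<^sup>+y. J y * indicator {0<..} y \<partial>lborel) = (\<integral>\<^sup>+t. \<Phi> t * indicator {0<..<pi} t \<partial>lborel)"
  proof -
    have "J y * indicator {0<..} y = (\<integral>\<^sup>+x. g (plane x y) * indicator {0<..} y \<partial>lborel)" for y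
      unfolding J_def by (subst nn_integral_multc) auto
    then show ?thesis using nn_integral_upper_polar[of g] by (simp add: \<Phi>_def)
  qed
  have down: "(\<integral>\<^sup>+y. J y * indicator {..<0} y \<partial>lborel) = (\<integral>\<^sup>+t. \<Phi> t * indicator {pi<..<2 * pi} t \<partial>lborel)"
  proof -
    have "(\<integral>\<^sup>+y. J y * indicator {..<0} y \<partial>lborel) = ennreal \<bar>-1\<bar> * (\<integral>\<^sup>+y. J (0 + (-1) * y) * indicator {..<0} (0 + (-1) * y) \<partial>lborel)"
      by (rule nn_integral_real_affine) auto
    also have "\<dots> = (\<integral>\<^sup>+y. J (- y) * indicator {..<0} (- y) \<partial>lborel)" by simp
    also have "\<dots> = (\<integral>\<^sup>+y. \<integral>\<^sup>+x. g (- plane x y) * indicator {0<..} y \<partial>lborel \<partial>lborel)"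
    proof (rule nn_integral_cong)
      fix y :: real
      have "J (- y) = ennreal \<bar>-1\<bar> * (\<integral>\<^sup>+x. g (plane (0 + (-1) * x) (- y)) \<partial>lborel)"
        unfolding J_def by (rule nn_integral_real_affine) auto
      also have "\<dots> = (\<integral>\<^sup>+x. g (- plane x y) \<partial>lborel)" by (simp add: plane_def)
      finally have "J (- y) = (\<integral>\<^sup>+x. g (- plane x y) \<partial>lborel)" .
      then show "J (- y) * indicator {..<0} (- y) = (\<integral>\<^sup>+x. g (- plane x y) * indicator {0<..} y \<partial>lborel)"
        by (subst nn_integral_multc) (auto split: split_indicator)
    qed
    also have "\<dots> = (\<integral>\<^sup>+t. ray_integral (\<lambda>z. g (- z)) (cis t) * indicator {0<..<pi} t \<partial>lborel)"
      by (rule nn_integral_upper_polar) measurable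
    also have "\<dots> = (\<integral>\<^sup>+t. \<Phi> (pi + 1 * t) * indicator {pi<..<2 * pi} (pi + 1 * t) \<partial>lborel)"
    proof (rule nn_integral_cong)
      fix t :: real
      have "cis (pi + 1 * t) = - cis t" by (simp add: cis_mult[symmetric])
      then show "ray_integral (\<lambda>z. g (- z)) (cis t) * indicator {0<..<pi} t =
        \<Phi> (pi + 1 * t) * indicator {pi<..<2 * pi} (pi + 1 * t)"
        unfolding \<Phi>_def ray_integral_def by (auto split: split_indicator)
    qed
    also have "\<dots> = ennreal \<bar>1\<bar> * (\<integral>\<^sup>+t. \<Phi> (pi + 1 * t) * indicator {pi<..<2 * pi} (pi + 1 * t) \<partial>lborel)" by simp
    also have "\<dots> = (\<integral>\<^sup>+t. \<Phi> t * indicator {pi<..<2 * pi} t \<partial>lborel)"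
      by (rule nn_integral_real_affine[symmetric]) auto
    finally show ?thesis .
  qed
  have "(\<integral>\<^sup>+z. g z \<partial>lborel) = (\<integral>\<^sup>+y. J y \<partial>lborel)" unfolding J_def by (rule nn_integral_plane) measurable
  also have "\<dots> = (\<integral>\<^sup>+y. J y * indicator {0<..} y + J y * indicator {..<0} y \<partial>lborel)"
    by (rule nn_integral_cong_AE) (use AE_lborel_singleton[of 0] in \<open>eventually_elim, auto split: split_indicator\<close>)
  also have "\<dots> = (\<integral>\<^sup>+t. \<Phi> t * indicator {0<..<pi} t \<partial>lborel) + (\<integral>\<^sup>+t. \<Phi> t * indicator {pi<..<2 * pi} t \<partial>lborel)"
    unfolding up[symmetric] down[symmetric] by (rule nn_integral_add) auto
  also have "\<dots> = (\<integral>\<^sup>+t. \<Phi> t * indicator {0<..<pi} t + \<Phi> t * indicator {pi<..<2 * pi} t \<partial>lborel)"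
    by (rule nn_integral_add[symmetric]) auto
  also have "\<dots> = (\<integral>\<^sup>+t. \<Phi> t * indicator {0..2 * pi} t \<partial>lborel)"
    by (rule nn_integral_cong_AE)
       (use AE_lborel_singleton[of 0] AE_lborel_singleton[of pi] AE_lborel_singleton[of "2 * pi"] in
         \<open>eventually_elim, auto split: split_indicator\<close>)
  finally show ?thesis by (simp add: \<Phi>_def)
qed

lemma circle_integral_nn:
  assumes f: "f holomorphic_on ball 0 1" and r: "0 \<le> r" "r < 1"
  shows "(\<integral>\<^sup>+t. ennreal ((norm (f (of_real r * cis t)))\<^sup>2) * indicator {0..2 * pi} t \<partial>lborel) =
    ennreal (2 * pi * hardy_mean f r)"
proof -
  have "(\<lambda>t. (norm (f (of_real r * cis t)))\<^sup>2) integrable_on {0..2 * pi}"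
    by (intro integrable_continuous_real continuous_intros
          continuous_on_compose2[OF holomorphic_on_imp_continuous_on[OF f]])
       (use r in \<open>auto simp: norm_mult\<close>)
  from nn_integral_has_integral_lebesgue'[OF _ integrable_integral[OF this]]
  show ?thesis by (simp add: hardy_mean_def)
qed

text \<open>The inner integral \<open>Hm\<close> is kept as a nonnegative integral, because its measurability in \<open>r\<close> then
  comes for free.\<close>

lemma nn_integral_disc_polar:
  assumes f: "f holomorphic_on ball 0 1"
  defines "Hm \<equiv> \<lambda>r. \<integral>\<^sup>+t. ennreal ((norm (f (of_real r * cis t)))\<^sup>2) * indicator (ball 0 1) (of_real r * cis t) * indicator {0..2 * pi} t \<partial>lborel"
  shows "Hm \<in> borel_measurable borel"
    and "\<And>r. 0 \<le> r \<Longrightarrow> r < 1 \<Longrightarrow> Hm r = ennreal (2 * pi * hardy_mean f r)"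
    and "(\<integral>\<^sup>+z. ennreal ((norm (f z))\<^sup>2) * indicator (ball 0 1) z \<partial>lborel) =
      (\<integral>\<^sup>+r. ennreal r * Hm r * indicator {0<..<1} r \<partial>lborel)"
proof -
  define g where "g = (\<lambda>z. ennreal ((norm (f z))\<^sup>2) * indicator (ball 0 1) z)"
  have "(\<lambda>z. indicator (ball 0 1) z *\<^sub>R (norm (f z))\<^sup>2) \<in> borel_measurable borel"
    by (intro borel_measurable_continuous_on_indicator continuous_intros holomorphic_on_imp_continuous_on f) auto
  then have "(\<lambda>z. ennreal (indicator (ball 0 1) z *\<^sub>R (norm (f z))\<^sup>2)) \<in> borel_measurable borel" by measurable
  moreover have "(\<lambda>z. ennreal (indicator (ball 0 1) z *\<^sub>R (norm (f z))\<^sup>2)) = g"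
    by (auto simp: g_def fun_eq_iff split: split_indicator)
  ultimately have g [measurable]: "g \<in> borel_measurable borel" by (simp only:)
  have [measurable]: "cis \<in> borel_measurable borel" unfolding cis_conv_exp by measurable
  have Hm: "Hm = (\<lambda>r. \<integral>\<^sup>+t. g (of_real r * cis t) * indicator {0..2 * pi} t \<partial>lborel)"
    by (simp add: Hm_def g_def)
  show [measurable]: "Hm \<in> borel_measurable borel" unfolding Hm by measurable
  show "Hm r = ennreal (2 * pi * hardy_mean f r)" if "0 \<le> r" "r < 1" for r
  proof -
    have "indicator (ball 0 1) (of_real r * cis t) = (1 :: ennreal)" for t
      using that by (simp add: indicator_def norm_mult)
    then show ?thesis using circle_integral_nn[OF f that] by (simp add: Hm_def)
  qed
  have "(\<integral>\<^sup>+z. g z \<partial>lborel) =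
    (\<integral>\<^sup>+t. (\<integral>\<^sup>+r. ennreal r * g (of_real r * cis t) * indicator {0<..} r \<partial>lborel) * indicator {0..2 * pi} t \<partial>lborel)"
    unfolding ray_integral_def[symmetric] by (rule nn_integral_polar) measurable
  also have "\<dots> = (\<integral>\<^sup>+t. \<integral>\<^sup>+r. ennreal r * g (of_real r * cis t) * indicator {0<..} r * indicator {0..2 * pi} t \<partial>lborel \<partial>lborel)"
    by (intro nn_integral_cong nn_integral_multc[symmetric]) measurable
  also have "\<dots> = (\<integral>\<^sup>+r. \<integral>\<^sup>+t. ennreal r * g (of_real r * cis t) * indicator {0<..} r * indicator {0..2 * pi} t \<partial>lborel \<partial>lborel)"
    by (rule lborel_pair.Fubini') measurable
  also have "\<dots> = (\<integral>\<^sup>+r. ennreal r * Hm r * indicator {0<..<1} r \<partial>lborel)"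
  proof (rule nn_integral_cong)
    fix r :: real
    have "(\<integral>\<^sup>+t. ennreal r * g (of_real r * cis t) * indicator {0<..} r * indicator {0..2 * pi} t \<partial>lborel)
      = (\<integral>\<^sup>+t. (ennreal r * indicator {0<..} r) * (g (of_real r * cis t) * indicator {0..2 * pi} t) \<partial>lborel)"
      by (simp add: mult_ac)
    also have "\<dots> = (ennreal r * indicator {0<..} r) * Hm r"
      unfolding Hm by (rule nn_integral_cmult) measurable
    also have "\<dots> = ennreal r * Hm r * indicator {0<..<1} r"
    proof (cases "0 < r \<and> r \<ge> 1")
      case True
      then have "g (of_real r * cis t) = 0" for t by (simp add: g_def norm_mult)
      then have "Hm r = 0" by (simp add: Hm)
      then show ?thesis by simp
    qed (auto split: split_indicator simp: mult_ac)
    finally show "(\<integral>\<^sup>+t. ennreal r * g (of_real r * cis t) * indicator {0<..} r * indicator {0..2 * pi} t \<partial>lborel)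
      = ennreal r * Hm r * indicator {0<..<1} r" .
  qed
  finally show "(\<integral>\<^sup>+z. ennreal ((norm (f z))\<^sup>2) * indicator (ball 0 1) z \<partial>lborel) =
      (\<integral>\<^sup>+r. ennreal r * Hm r * indicator {0<..<1} r \<partial>lborel)" by (simp add: g_def)
qed

text \<open>The affine substitution \<open>\<rho> = 1 - c * (1 - r)\<close> maps \<open>(0, 1)\<close> onto \<open>(1 - c, 1)\<close>, where the density \<open>\<rho>\<close> of the
  area measure is at least \<open>1 - c\<close>.\<close>

lemma area_integral_le_of_hardy_mean_le:
  assumes f: "f holomorphic_on ball 0 1" and F: "F holomorphic_on ball 0 1"
    and c: "0 < c" "c < 1" and K: "K \<ge> 0"
    and le: "\<And>r. 0 \<le> r \<Longrightarrow> r < 1 \<Longrightarrow> hardy_mean F r \<le> K * hardy_mean f (1 - c * (1 - r))"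
  shows "(\<integral>\<^sup>+z. ennreal ((norm (F z))\<^sup>2) * indicator (ball 0 1) z \<partial>lborel)
    \<le> ennreal (K / (c * (1 - c))) * (\<integral>\<^sup>+z. ennreal ((norm (f z))\<^sup>2) * indicator (ball 0 1) z \<partial>lborel)"
proof -
  define Hf where "Hf r = \<integral>\<^sup>+t. ennreal ((norm (f (of_real r * cis t)))\<^sup>2) * indicator (ball 0 1) (of_real r * cis t) * indicator {0..2 * pi} t \<partial>lborel" for r
  define HF where "HF r = \<integral>\<^sup>+t. ennreal ((norm (F (of_real r * cis t)))\<^sup>2) * indicator (ball 0 1) (of_real r * cis t) * indicator {0..2 * pi} t \<partial>lborel" for r
  note pf = nn_integral_disc_polar[OF f, folded Hf_def]
  note pF = nn_integral_disc_polar[OF F, folded HF_def]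
  note [measurable] = pf(1) pF(1)
  define Gf where "Gf = (\<lambda>\<rho>. ennreal K * Hf \<rho> * indicator {1 - c<..<1} \<rho>)"
  have [measurable]: "Gf \<in> borel_measurable borel" unfolding Gf_def by measurable
  have "(\<integral>\<^sup>+z. ennreal ((norm (F z))\<^sup>2) * indicator (ball 0 1) z \<partial>lborel) = (\<integral>\<^sup>+r. ennreal r * HF r * indicator {0<..<1} r \<partial>lborel)"
    by (rule pF(3))
  also have "\<dots> \<le> (\<integral>\<^sup>+r. Gf ((1 - c) + c * r) \<partial>lborel)"
  proof (rule nn_integral_mono)
    fix r :: real
    show "ennreal r * HF r * indicator {0<..<1} r \<le> Gf ((1 - c) + c * r)"
    proof (cases "0 < r \<and> r < 1")
      case True
      define \<rho> where "\<rho> = 1 - c + c * r"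
      have "c * r > 0" "c * r < c" using True c by auto
      then have \<rho>: "1 - c < \<rho>" "\<rho> < 1" by (auto simp: \<rho>_def)
      have "1 - c * (1 - r) = \<rho>" by (simp add: \<rho>_def algebra_simps)
      then have l: "hardy_mean F r \<le> K * hardy_mean f \<rho>" using le[of r] True by simp
      have "ennreal r * HF r \<le> 1 * HF r" using True by (intro mult_right_mono) auto
      also have "\<dots> = ennreal (2 * pi * hardy_mean F r)" using pF(2)[of r] True by simp
      also have "\<dots> \<le> ennreal (K * (2 * pi * hardy_mean f \<rho>))"
        using l by (intro ennreal_leI) (simp add: mult_ac)
      also have "\<dots> = ennreal K * Hf \<rho>" using pf(2)[of \<rho>] \<rho> c K by (simp add: ennreal_mult')
      finally show ?thesis using True \<rho> by (simp add: Gf_def \<rho>_def)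
    qed simp
  qed
  also have "\<dots> = ennreal (1 / c) * (ennreal \<bar>c\<bar> * (\<integral>\<^sup>+r. Gf ((1 - c) + c * r) \<partial>lborel))"
    using c by (simp add: mult.assoc[symmetric] ennreal_mult[symmetric])
  also have "ennreal \<bar>c\<bar> * (\<integral>\<^sup>+r. Gf ((1 - c) + c * r) \<partial>lborel) = (\<integral>\<^sup>+\<rho>. Gf \<rho> \<partial>lborel)"
    by (rule nn_integral_real_affine[symmetric]) (use c in auto)
  also have "(\<integral>\<^sup>+\<rho>. Gf \<rho> \<partial>lborel) \<le> (\<integral>\<^sup>+\<rho>. ennreal (K / (1 - c)) * (ennreal \<rho> * Hf \<rho> * indicator {0<..<1} \<rho>) \<partial>lborel)"
  proof (rule nn_integral_mono)
    fix \<rho> :: real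
    show "Gf \<rho> \<le> ennreal (K / (1 - c)) * (ennreal \<rho> * Hf \<rho> * indicator {0<..<1} \<rho>)"
    proof (cases "1 - c < \<rho> \<and> \<rho> < 1")
      case True
      have "K = K / (1 - c) * (1 - c)" using c by simp
      also have "\<dots> \<le> K / (1 - c) * \<rho>" using True K c by (intro mult_left_mono) auto
      finally have "ennreal K \<le> ennreal (K / (1 - c)) * ennreal \<rho>"
        using True c K by (simp add: ennreal_mult[symmetric] ennreal_leI)
      then have "ennreal K * Hf \<rho> \<le> ennreal (K / (1 - c)) * ennreal \<rho> * Hf \<rho>" by (rule mult_right_mono) simp
      then show ?thesis using True c by (simp add: Gf_def mult.assoc)
    qed (simp add: Gf_def)
  qed
  also have "\<dots> = ennreal (K / (1 - c)) * (\<integral>\<^sup>+z. ennreal ((norm (f z))\<^sup>2) * indicator (ball 0 1) z \<partial>lborel)"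
    unfolding pf(3) by (rule nn_integral_cmult) measurable
  finally have "(\<integral>\<^sup>+z. ennreal ((norm (F z))\<^sup>2) * indicator (ball 0 1) z \<partial>lborel) \<le>
     ennreal (1 / c) * (ennreal (K / (1 - c)) * (\<integral>\<^sup>+z. ennreal ((norm (f z))\<^sup>2) * indicator (ball 0 1) z \<partial>lborel))"
    by (simp add: mult_left_mono)
  also have "\<dots> = ennreal (K / (c * (1 - c))) * (\<integral>\<^sup>+z. ennreal ((norm (f z))\<^sup>2) * indicator (ball 0 1) z \<partial>lborel)"
    using c K by (simp add: mult.assoc[symmetric] ennreal_mult[symmetric])
  finally show ?thesis .
qed

section \<open>Summation over classes\<close>

context nonconst_mero begin

definition contraction :: real where
  "contraction = (SOME c. 0 < c \<and> c \<le> 1 \<and>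
     (\<forall>z\<in>G. \<forall>w\<in>cls z. norm z < 1 \<longrightarrow> norm w < 1 \<and> norm w \<le> 1 - c * (1 - norm z)))"

lemma contraction: "0 < contraction" "contraction \<le> 1"
  "w \<in> cls z \<Longrightarrow> norm z < 1 \<Longrightarrow> norm w < 1"
  "w \<in> cls z \<Longrightarrow> norm z < 1 \<Longrightarrow> norm w \<le> 1 - contraction * (1 - norm z)"
  using someI_ex[OF cls_in_disc] cls_G(1) unfolding contraction_def[symmetric] by blast+

text \<open>The common cardinality of all classes.\<close>

definition sheets :: nat where "sheets = card (cls (SOME z. z \<in> G))"

lemma card_cls: "z \<in> G \<Longrightarrow> card (cls z) = sheets"
  unfolding sheets_def by (rule card_cls_constant) (auto intro: someI)

lemma sheets_pos: "sheets > 0"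
proof -
  obtain z where z: "z \<in> G"
    using eventually_G[of 1] by (metis one_neq_zero eventually_happens trivial_limit_at)
  then have "z \<in> cls z" by (rule cls_refl)
  then have "card (cls z) > 0" using finite_cls card_gt_0_iff by blast
  then show ?thesis using card_cls[OF z] by simp
qed

definition cls_sum :: "(complex \<Rightarrow> complex) \<Rightarrow> complex \<Rightarrow> complex" where
  "cls_sum f = (\<lambda>z. \<Sum>w\<in>cls z. f w)"

lemma eventually_within_G:
  assumes "norm x < r" shows "\<forall>\<^sub>F z in at x within G. z \<in> ball 0 r \<and> z \<in> G"
  using assms unfolding eventually_at_topological by (intro exI[of _ "ball 0 r"]) auto

text \<open>By the contraction estimate, classes of points of modulus less than \<open>r\<close> lie in the disc on which
  \<open>f\<close> is given, and locally uniformly in a smaller compact disc, so their sums are locally bounded.\<close>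

lemma ext_cls_sum:
  assumes r: "r \<le> 1" and f: "f holomorphic_on ball 0 (1 - contraction * (1 - r))"
  shows "ext (cls_sum f) holomorphic_on ball 0 r"
    and "\<And>z. z \<in> G \<Longrightarrow> norm z < r \<Longrightarrow> ext (cls_sum f) z = cls_sum f z"
    and "\<And>z. norm z < r \<Longrightarrow> (cls_sum f \<longlongrightarrow> ext (cls_sum f) z) (at z within G)"
proof -
  define R where "R = 1 - contraction * (1 - r)"
  have inR: "norm w < R" if "w \<in> cls z" "norm z < r" for z w
  proof -
    have "norm w \<le> 1 - contraction * (1 - norm z)" using contraction(4)[OF that(1)] that r by simp
    also have "\<dots> < R" using that contraction(1) by (simp add: R_def)
    finally show ?thesis .
  qed
  have hol: "cls_sum f holomorphic_on ball 0 r \<inter> G"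
    unfolding cls_sum_def by (rule cls_symmetric_holomorphic(1)[OF open_ball open_ball f]) (use inR R_def in auto)
  have bd: "\<exists>C. \<forall>\<^sub>F z in at x within G. norm (cls_sum f z) \<le> C" if x: "x \<in> ball 0 r" for x
  proof -
    define r1 where "r1 = (norm x + r) / 2"
    define R1 where "R1 = 1 - contraction * (1 - r1)"
    have r1: "norm x < r1" "r1 < r" using x by (auto simp: r1_def)
    have "R1 < R" using r1 contraction(1) by (simp add: R1_def R_def)
    have "bounded (f ` cball 0 R1)"
    proof (intro compact_imp_bounded compact_continuous_image)
      show "continuous_on (cball 0 R1) f"
        by (rule continuous_on_subset[OF holomorphic_on_imp_continuous_on[OF f]]) (use \<open>R1 < R\<close> R_def in auto)
    qed auto
    then obtain M where "\<forall>w\<in>cball 0 R1. norm (f w) \<le> M" by (auto simp: bounded_iff)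
    then have M: "norm (f w) \<le> M" if "norm w \<le> R1" for w using that by simp
    have "\<forall>\<^sub>F z in at x within G. norm (cls_sum f z) \<le> real sheets * M"
      using eventually_within_G[OF r1(1)]
    proof eventually_elim
      case (elim z)
      have "norm (f w) \<le> M" if w: "w \<in> cls z" for w
      proof (rule M)
        have "norm w \<le> 1 - contraction * (1 - norm z)" using contraction(4)[OF w] elim r r1 by simp
        also have "\<dots> \<le> R1" using elim contraction(1) by (simp add: R1_def)
        finally show "norm w \<le> R1" .
      qed
      then have "norm (cls_sum f z) \<le> (\<Sum>w\<in>cls z. M)" unfolding cls_sum_def by (rule sum_norm_le)
      then show ?case using card_cls elim by simp
    qed
    then show ?thesis by blast
  qed
  show "ext (cls_sum f) holomorphic_on ball 0 r" by (rule ext_holomorphic(1)[OF open_ball hol bd])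
  show "ext (cls_sum f) z = cls_sum f z" if "z \<in> G" "norm z < r" for z
    by (rule ext_holomorphic(2)[OF open_ball hol bd]) (use that in auto)
  show "(cls_sum f \<longlongrightarrow> ext (cls_sum f) z) (at z within G)" if "norm z < r" for z
    by (rule ext_holomorphic(3)[OF open_ball hol bd]) (use that in auto)
qed

lemma ext_cls_sum_disc:
  assumes f: "f holomorphic_on ball 0 1"
  shows "ext (cls_sum f) holomorphic_on ball 0 1"
    and "\<And>z. z \<in> G \<Longrightarrow> norm z < 1 \<Longrightarrow> ext (cls_sum f) z = cls_sum f z"
    and "\<And>z. norm z < 1 \<Longrightarrow> (cls_sum f \<longlongrightarrow> ext (cls_sum f) z) (at z within G)"
  using ext_cls_sum[of 1 f] f by auto

definition mean_const :: real where "mean_const = 8 * (real sheets)\<^sup>2 / contraction"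

lemma mean_const_pos: "mean_const > 0"
  using sheets_pos contraction(1) by (simp add: mean_const_def)

text \<open>Let \<open>k\<close> be the majorant with \<open>\<bar>f\<bar>\<^sup>2 \<le> Re k\<close> on the disc of radius \<open>R\<close>. By the Cauchy--Schwarz inequality
  the squared class sum of \<open>f\<close> is at most \<open>sheets\<close> times the real part of the class sum of \<open>k\<close>. The
  latter is holomorphic, so its circular mean is its value at \<open>0\<close>, and this is controlled by Harnack's
  inequality because classes of points near \<open>0\<close> keep away from the circle of radius \<open>R\<close>.\<close>

lemma hardy_mean_cls_sum:
  assumes f: "f holomorphic_on ball 0 1" and r: "0 \<le> r" "r < 1"
  shows "hardy_mean (ext (cls_sum f)) r \<le> mean_const * hardy_mean f (1 - contraction / 2 * (1 - r))"
proof -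
  define c where "c = contraction"
  have c: "0 < c" "c \<le> 1" using contraction by (auto simp: c_def)
  \<comment> \<open>The circle of radius \<open>r\<close> must lie inside the disc on which the class sum of \<open>k\<close> is defined.\<close>
  define r' where "r' = (1 + r) / 2"
  define R where "R = 1 - c / 2 * (1 - r)"
  have r': "r < r'" "r' < 1" "r' \<ge> 1 / 2" using r by (auto simp: r'_def)
  have R_eq: "R = 1 - contraction * (1 - r')" by (simp add: R_def r'_def c_def field_simps)
  have "c * (1 - r) \<le> 1 * 1" using r c by (intro mult_mono) auto
  then have R: "0 < R" "R < 1" "R \<ge> 1 - c / 2" using r c by (auto simp: R_def)
  obtain k where k: "k holomorphic_on ball 0 R"
    "\<And>w. norm w < R \<Longrightarrow> (norm (f w))\<^sup>2 \<le> Re (k w)"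
    "\<And>w. norm w < R \<Longrightarrow> Re (k w) \<le> (R + norm w) / (R - norm w) * hardy_mean f R"
    by (rule harmonic_majorant[OF f R(1,2)]) blast
  have khol: "k holomorphic_on ball 0 (1 - contraction * (1 - r'))" using k(1) R_eq by simp
  note Ek = ext_cls_sum[OF less_imp_le[OF r'(2)] khol]
  note Ef = ext_cls_sum_disc[OF f]
  have inR: "norm w < R" if "w \<in> cls z" "norm z < r'" for z w
  proof -
    have "norm w \<le> 1 - contraction * (1 - norm z)" using contraction(4)[OF that(1)] that r' by simp
    also have "\<dots> < R" using that contraction(1) by (simp add: R_eq)
    finally show ?thesis .
  qed
  have pointwise: "(norm (ext (cls_sum f) x))\<^sup>2 \<le> real sheets * Re (ext (cls_sum k) x)" if x: "norm x < r'" for x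
  proof (rule dense_le[where f = "\<lambda>x. (norm (ext (cls_sum f) x))\<^sup>2" and h = "\<lambda>x. real sheets * Re (ext (cls_sum k) x)"])
    have "isCont (ext (cls_sum f)) x" using x r'
      by (intro analytic_at_imp_isCont holomorphic_on_imp_analytic_at[OF Ef(1)]) auto
    then show "isCont (\<lambda>x. (norm (ext (cls_sum f) x))\<^sup>2) x" by (intro continuous_intros)
    have "isCont (ext (cls_sum k)) x" using x
      by (intro analytic_at_imp_isCont holomorphic_on_imp_analytic_at[OF Ek(1)]) auto
    then show "isCont (\<lambda>x. real sheets * Re (ext (cls_sum k) x)) x"
      by (intro continuous_intros bounded_linear.isCont[OF bounded_linear_Re])
    show "\<forall>\<^sub>F z in at x within G. (norm (ext (cls_sum f) z))\<^sup>2 \<le> real sheets * Re (ext (cls_sum k) z)"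
      using eventually_within_G[OF x]
    proof eventually_elim
      case (elim z)
      have "(norm (cls_sum f z))\<^sup>2 \<le> (\<Sum>w\<in>cls z. norm (f w))\<^sup>2"
        unfolding cls_sum_def by (intro power_mono norm_sum) auto
      also have "\<dots> \<le> (\<Sum>w\<in>cls z. (norm (f w))\<^sup>2) * real (card (cls z))"
        by (rule sum_squared_le_sum_of_squares)
      also have "\<dots> \<le> (\<Sum>w\<in>cls z. Re (k w)) * real (card (cls z))"
        by (intro mult_right_mono sum_mono k(2) inR[of _ z]) (use elim in auto)
      also have "\<dots> = real sheets * Re (cls_sum k z)"
        using card_cls[of z] elim by (simp add: cls_sum_def Re_sum)
      finally show ?case using Ef(2)[of z] Ek(2)[of z] elim r' by simp
    qed
  qed
  have at0: "Re (ext (cls_sum k) 0) \<le> real sheets * (8 / c) * hardy_mean f R"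
  proof (rule dense_le[where f = "\<lambda>x. Re (ext (cls_sum k) x)" and x = 0 and h = "\<lambda>x. real sheets * (8 / c) * hardy_mean f R"])
    have "isCont (ext (cls_sum k)) 0" using r'
      by (intro analytic_at_imp_isCont holomorphic_on_imp_analytic_at[OF Ek(1)]) auto
    then show "isCont (\<lambda>x. Re (ext (cls_sum k) x)) 0"
      by (intro bounded_linear.isCont[OF bounded_linear_Re])
    have "norm (0::complex) < 1 / 4" by simp
    from eventually_within_G[OF this]
    show "\<forall>\<^sub>F z in at 0 within G. Re (ext (cls_sum k) z) \<le> real sheets * (8 / c) * hardy_mean f R"
    proof eventually_elim
      case (elim z)
      have z: "norm z < r'" "z \<in> G" "norm z < 1 / 4" using elim r' by auto
      have hm: "hardy_mean f R \<ge> 0" unfolding hardy_mean_def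
        by (intro divide_nonneg_nonneg Henstock_Kurzweil_Integration.integral_nonneg integrable_continuous_real
            continuous_intros continuous_on_compose2[OF holomorphic_on_imp_continuous_on[OF f]])
           (use R in \<open>auto simp: norm_mult\<close>)
      have "Re (k w) \<le> 8 / c * hardy_mean f R" if w: "w \<in> cls z" for w
      proof -
        have wR: "norm w < R" using inR[OF w z(1)] .
        have "norm w \<le> 1 - c * (1 - norm z)" using contraction(4)[OF w] z by (simp add: c_def)
        also have "\<dots> \<le> 1 - c * (3 / 4)" using z c by simp
        finally have gap: "R - norm w \<ge> c / 4" using R(3) by simp
        have "(R + norm w) / (R - norm w) \<le> 2 / (c / 4)"
          using gap c wR R by (intro frac_le) auto
        then have "(R + norm w) / (R - norm w) * hardy_mean f R \<le> 8 / c * hardy_mean f R"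
          using hm by (intro mult_right_mono) auto
        then show ?thesis using k(3)[OF wR] by linarith
      qed
      then have "Re (cls_sum k z) \<le> (\<Sum>w\<in>cls z. 8 / c * hardy_mean f R)"
        unfolding cls_sum_def Re_sum by (rule sum_mono)
      then show ?case using Ek(2)[OF z(2,1)] card_cls[OF z(2)] by simp
    qed
  qed simp
  have circ: "continuous_on S (\<lambda>t. of_real r * cis t)" for S by (intro continuous_intros)
  have nr: "norm (of_real r * cis t) = r" for t using r by (simp add: norm_mult)
  have ck: "continuous_on S (\<lambda>t. ext (cls_sum k) (of_real r * cis t))" for S
    by (rule continuous_on_compose2[OF holomorphic_on_imp_continuous_on[OF Ek(1)] circ]) (use nr r' in auto)
  have cf: "continuous_on S (\<lambda>t. ext (cls_sum f) (of_real r * cis t))" for S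
    by (rule continuous_on_compose2[OF holomorphic_on_imp_continuous_on[OF Ef(1)] circ]) (use nr r' in auto)
  have "integral {0..2 * pi} (\<lambda>t. (norm (ext (cls_sum f) (of_real r * cis t)))\<^sup>2)
      \<le> integral {0..2 * pi} (\<lambda>t. real sheets * Re (ext (cls_sum k) (of_real r * cis t)))"
    by (intro integral_le integrable_continuous_real continuous_intros ck cf pointwise) (use nr r' in auto)
  also have "\<dots> = real sheets * Re (integral {0..2 * pi} (\<lambda>t. ext (cls_sum k) (of_real r * cis t)))"
    using integral_linear[OF integrable_continuous_real[OF ck] bounded_linear_Re] by (simp add: o_def)
  also have "integral {0..2 * pi} (\<lambda>t. ext (cls_sum k) (of_real r * cis t)) = 2 * of_real pi * ext (cls_sum k) 0"
    by (rule circle_mean_value) (use Ek(1) r' r in \<open>auto elim!: holomorphic_on_subset\<close>)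
  also have "real sheets * Re (2 * of_real pi * ext (cls_sum k) 0) = 2 * pi * (real sheets * Re (ext (cls_sum k) 0))"
    by simp
  finally have "hardy_mean (ext (cls_sum f)) r \<le> real sheets * Re (ext (cls_sum k) 0)"
    unfolding hardy_mean_def by (simp add: field_simps)
  also have "\<dots> \<le> real sheets * (real sheets * (8 / c) * hardy_mean f R)"
    by (intro mult_left_mono at0) auto
  also have "\<dots> = mean_const * hardy_mean f R"
    by (simp add: mean_const_def c_def power2_eq_square)
  finally show ?thesis by (simp add: R_def c_def)
qed

end

section \<open>The operator of summation over classes\<close>

lemma space_carrierD:
  assumes "f \<in> space_carrier H"
  shows "f holomorphic_on ball 0 1" "\<And>z. norm z \<ge> 1 \<Longrightarrow> f z = 0"
  using assms by (cases H; auto)+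

lemma area_integral_measurable:
  assumes "f holomorphic_on ball 0 1"
  shows "(\<lambda>z. indicator (ball 0 1) z *\<^sub>R (norm (f z))\<^sup>2) \<in> borel_measurable lborel"
proof -
  have "(\<lambda>z. indicator (ball 0 1) z *\<^sub>R (norm (f z))\<^sup>2) \<in> borel_measurable borel"
    by (intro borel_measurable_continuous_on_indicator continuous_intros holomorphic_on_imp_continuous_on assms) auto
  then show ?thesis by simp
qed

lemma area_integral_eq_nn:
  assumes f: "f holomorphic_on ball 0 1"
    and fin: "(\<integral>\<^sup>+z. ennreal ((norm (f z))\<^sup>2) * indicator (ball 0 1) z \<partial>lborel) < \<infinity>"
  shows "set_integrable lborel (ball 0 1) (\<lambda>z. (norm (f z))\<^sup>2)"
    and "(\<integral>\<^sup>+z. ennreal ((norm (f z))\<^sup>2) * indicator (ball 0 1) z \<partial>lborel) =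
      ennreal (set_lebesgue_integral lborel (ball 0 1) (\<lambda>z. (norm (f z))\<^sup>2))"
proof -
  have eq: "(\<integral>\<^sup>+z. ennreal ((norm (f z))\<^sup>2) * indicator (ball 0 1) z \<partial>lborel) =
    (\<integral>\<^sup>+z. ennreal (indicator (ball 0 1) z *\<^sub>R (norm (f z))\<^sup>2) \<partial>lborel)"
    by (intro nn_integral_cong) (auto split: split_indicator)
  show int: "set_integrable lborel (ball 0 1) (\<lambda>z. (norm (f z))\<^sup>2)"
    unfolding set_integrable_def
    by (rule integrableI_nonneg[OF area_integral_measurable[OF f]]) (use fin eq in auto)
  show "(\<integral>\<^sup>+z. ennreal ((norm (f z))\<^sup>2) * indicator (ball 0 1) z \<partial>lborel) =
      ennreal (set_lebesgue_integral lborel (ball 0 1) (\<lambda>z. (norm (f z))\<^sup>2))"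
    unfolding eq set_lebesgue_integral_def
    by (rule nn_integral_eq_integral) (use int in \<open>auto simp: set_integrable_def\<close>)
qed

lemma area_integral_finite:
  assumes "f holomorphic_on ball 0 1" "set_integrable lborel (ball 0 1) (\<lambda>z. (norm (f z))\<^sup>2)"
  shows "(\<integral>\<^sup>+z. ennreal ((norm (f z))\<^sup>2) * indicator (ball 0 1) z \<partial>lborel) < \<infinity>"
proof -
  have "(\<integral>\<^sup>+z. ennreal (norm (indicator (ball 0 1) z *\<^sub>R (norm (f z))\<^sup>2)) \<partial>lborel) < \<infinity>"
    using assms(2) unfolding set_integrable_def integrable_iff_bounded by blast
  moreover have "(\<integral>\<^sup>+z. ennreal ((norm (f z))\<^sup>2) * indicator (ball 0 1) z \<partial>lborel) =
    (\<integral>\<^sup>+z. ennreal (norm (indicator (ball 0 1) z *\<^sub>R (norm (f z))\<^sup>2)) \<partial>lborel)"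
    by (intro nn_integral_cong) (auto split: split_indicator)
  ultimately show ?thesis by simp
qed

text \<open>The constant function 1 as an element of both spaces.\<close>

definition disc_one :: "complex \<Rightarrow> complex" where
  "disc_one z = (if norm z < 1 then 1 else 0)"

lemma disc_one_holomorphic: "disc_one holomorphic_on ball 0 1"
  by (rule holomorphic_transform[of "\<lambda>_. 1"]) (auto simp: disc_one_def)

lemma disc_one_carrier: "disc_one \<in> space_carrier H"
proof (cases H)
  case Hardy
  have "hardy_mean disc_one r \<le> 1" if "r \<in> {0..<1}" for r
    using that by (simp add: hardy_mean_def disc_one_def norm_mult)
  then have "bdd_above (hardy_mean disc_one ` {0..<1})" by (rule bdd_aboveI2)
  then show ?thesis using Hardy disc_one_holomorphic by (auto simp: disc_one_def)
next
  case Bergman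
  have "(\<integral>\<^sup>+z. ennreal ((norm (disc_one z))\<^sup>2) * indicator (ball 0 1) z \<partial>lborel) =
    (\<integral>\<^sup>+z. indicator (ball 0 1) (z::complex) \<partial>lborel)"
    by (intro nn_integral_cong) (auto split: split_indicator simp: disc_one_def)
  also have "\<dots> < \<infinity>" using emeasure_lborel_ball_finite[of "0::complex" 1] by simp
  finally have "set_integrable lborel (ball 0 1) (\<lambda>z. (norm (disc_one z))\<^sup>2)"
    by (rule area_integral_eq_nn(1)[OF disc_one_holomorphic])
  then show ?thesis using Bergman disc_one_holomorphic by (auto simp: disc_one_def)
qed

context nonconst_mero begin

definition cls_operator :: "(complex \<Rightarrow> complex) \<Rightarrow> complex \<Rightarrow> complex" where
  "cls_operator f = (\<lambda>z. if norm z < 1 then ext (cls_sum f) z else 0)"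

lemma cls_operator_holomorphic:
  assumes "f holomorphic_on ball 0 1" shows "cls_operator f holomorphic_on ball 0 1"
  by (rule holomorphic_transform[OF ext_cls_sum_disc(1)[OF assms]]) (auto simp: cls_operator_def)

lemma cls_operator_on_G:
  "f holomorphic_on ball 0 1 \<Longrightarrow> z \<in> G \<Longrightarrow> norm z < 1 \<Longrightarrow> cls_operator f z = (\<Sum>w\<in>cls z. f w)"
  using ext_cls_sum_disc(2)[of f z] by (simp add: cls_operator_def cls_sum_def)

lemma cls_operator_eqI:
  assumes z: "norm z < 1" and lim: "(h \<longlongrightarrow> l) (at z within G)"
    and eq: "\<And>u. u \<in> G \<Longrightarrow> norm u < 1 \<Longrightarrow> cls_sum f u = h u"
  shows "cls_operator f z = l"
proof -
  have "\<forall>\<^sub>F u in at z within G. h u = cls_sum f u"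
    using eventually_within_G[OF z] by eventually_elim (use eq in auto)
  with lim have "(cls_sum f \<longlongrightarrow> l) (at z within G)" by (rule Lim_transform_eventually)
  then show ?thesis using z ext_tendsto by (simp add: cls_operator_def)
qed

lemma cls_operator_tendsto:
  "f holomorphic_on ball 0 1 \<Longrightarrow> norm z < 1 \<Longrightarrow> (cls_sum f \<longlongrightarrow> cls_operator f z) (at z within G)"
  using ext_cls_sum_disc(3)[of f z] by (simp add: cls_operator_def)

lemma cls_operator_add:
  assumes "f holomorphic_on ball 0 1" "g holomorphic_on ball 0 1"
  shows "cls_operator (\<lambda>z. f z + g z) = (\<lambda>z. cls_operator f z + cls_operator g z)"
proof
  fix z show "cls_operator (\<lambda>z. f z + g z) z = cls_operator f z + cls_operator g z"
  proof (cases "norm z < 1")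
    case True
    show ?thesis
      by (rule cls_operator_eqI[OF True tendsto_add[OF cls_operator_tendsto cls_operator_tendsto]])
         (use assms True in \<open>auto simp: cls_sum_def sum.distrib\<close>)
  qed (simp add: cls_operator_def)
qed

lemma cls_operator_mult:
  assumes f: "f holomorphic_on ball 0 1" and h: "h holomorphic_on ball 0 1"
    and inv: "\<And>z w. z \<in> G \<Longrightarrow> norm z < 1 \<Longrightarrow> w \<in> cls z \<Longrightarrow> h w = h z"
  shows "cls_operator (\<lambda>z. h z * f z) = (\<lambda>z. h z * cls_operator f z)"
proof
  fix z show "cls_operator (\<lambda>z. h z * f z) z = h z * cls_operator f z"
  proof (cases "norm z < 1")
    case True
    have "isCont h z" using h True
      by (intro analytic_at_imp_isCont holomorphic_on_imp_analytic_at[of h "ball 0 1"]) auto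
    then have "(h \<longlongrightarrow> h z) (at z within G)" by (auto simp: isCont_def intro: tendsto_within_subset)
    from tendsto_mult[OF this cls_operator_tendsto[OF f True]]
    show ?thesis
      by (rule cls_operator_eqI[OF True])
         (auto simp: cls_sum_def sum_distrib_left inv intro!: sum.cong)
  qed (simp add: cls_operator_def)
qed

lemma hardy_mean_cls_operator:
  assumes f: "f holomorphic_on ball 0 1" and r: "0 \<le> r" "r < 1"
  shows "hardy_mean (cls_operator f) r \<le> mean_const * hardy_mean f (1 - contraction / 2 * (1 - r))"
proof -
  have "hardy_mean (cls_operator f) r = hardy_mean (ext (cls_sum f)) r"
    unfolding hardy_mean_def using r by (simp add: cls_operator_def norm_mult)
  then show ?thesis using hardy_mean_cls_sum[OF assms] by simp
qed

lemma cls_operator_bounded_Hardy: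
  assumes "f \<in> space_carrier Hardy"
  shows "cls_operator f \<in> space_carrier Hardy"
    and "space_norm Hardy (cls_operator f) \<le> sqrt mean_const * space_norm Hardy f"
proof -
  have f: "f holomorphic_on ball 0 1" and bdd: "bdd_above (hardy_mean f ` {0..<1})"
    using assms by auto
  have le: "hardy_mean (cls_operator f) r \<le> mean_const * (SUP r\<in>{0..<1}. hardy_mean f r)" if r: "r \<in> {0..<1}" for r
  proof -
    have "contraction / 2 * (1 - r) \<le> 1 / 2 * 1"
      using contraction r by (intro mult_mono) auto
    moreover have "contraction / 2 * (1 - r) > 0" using contraction r by simp
    ultimately have "1 - contraction / 2 * (1 - r) \<in> {0..<1}" by simp
    then have "hardy_mean f (1 - contraction / 2 * (1 - r)) \<le> (SUP r\<in>{0..<1}. hardy_mean f r)"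
      by (intro cSUP_upper bdd)
    then have "mean_const * hardy_mean f (1 - contraction / 2 * (1 - r)) \<le> mean_const * (SUP r\<in>{0..<1}. hardy_mean f r)"
      using mean_const_pos by (intro mult_left_mono) auto
    then show ?thesis using hardy_mean_cls_operator[OF f, of r] r by simp
  qed
  then have "bdd_above (hardy_mean (cls_operator f) ` {0..<1})" by (rule bdd_aboveI2)
  then show "cls_operator f \<in> space_carrier Hardy"
    using cls_operator_holomorphic[OF f] by (auto simp: cls_operator_def)
  have "(SUP r\<in>{0..<1}. hardy_mean (cls_operator f) r) \<le> mean_const * (SUP r\<in>{0..<1}. hardy_mean f r)"
    by (intro cSUP_least le) auto
  then show "space_norm Hardy (cls_operator f) \<le> sqrt mean_const * space_norm Hardy f"
    by (simp add: real_sqrt_mult[symmetric])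
qed

lemma cls_operator_bounded_Bergman:
  assumes "f \<in> space_carrier Bergman"
  shows "cls_operator f \<in> space_carrier Bergman"
    and "space_norm Bergman (cls_operator f) \<le>
      sqrt (mean_const / (contraction / 2 * (1 - contraction / 2))) * space_norm Bergman f"
proof -
  let ?A = "\<lambda>f. \<integral>\<^sup>+z. ennreal ((norm (f z))\<^sup>2) * indicator (ball 0 1) z \<partial>lborel"
  let ?K = "mean_const / (contraction / 2 * (1 - contraction / 2))"
  have f: "f holomorphic_on ball 0 1" and int: "set_integrable lborel (ball 0 1) (\<lambda>z. (norm (f z))\<^sup>2)"
    using assms by auto
  have c: "0 < contraction / 2" "contraction / 2 < 1" using contraction by auto
  have K: "?K \<ge> 0" using c mean_const_pos by simp
  note F = cls_operator_holomorphic[OF f]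
  have le: "?A (cls_operator f) \<le> ennreal ?K * ?A f"
    by (rule area_integral_le_of_hardy_mean_le[OF f F c])
       (use mean_const_pos hardy_mean_cls_operator[OF f] in auto)
  have finf: "?A f < \<infinity>" by (rule area_integral_finite[OF f int])
  then have "ennreal ?K * ?A f < \<infinity>" by (simp add: ennreal_mult_less_top)
  with le have fin: "?A (cls_operator f) < \<infinity>" by (rule le_less_trans)
  show "cls_operator f \<in> space_carrier Bergman"
    using area_integral_eq_nn(1)[OF F fin] F by (auto simp: cls_operator_def)
  let ?I = "\<lambda>f. set_lebesgue_integral lborel (ball 0 1) (\<lambda>z. (norm (f z))\<^sup>2)"
  have nonneg: "?I g \<ge> 0" for g :: "complex \<Rightarrow> complex"
    unfolding set_lebesgue_integral_def by (intro Bochner_Integration.integral_nonneg) auto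
  have "ennreal (?I (cls_operator f)) \<le> ennreal (?K * ?I f)"
    using le unfolding area_integral_eq_nn(2)[OF F fin] area_integral_eq_nn(2)[OF f finf] ennreal_mult[OF K nonneg] .
  then have "?I (cls_operator f) \<le> ?K * ?I f"
    using ennreal_le_iff[OF mult_nonneg_nonneg[OF K nonneg]] by blast
  then have "?I (cls_operator f) / pi \<le> ?K * (?I f / pi)"
    using divide_right_mono[OF _ pi_ge_zero] by (simp only: times_divide_eq_right)
  then have "sqrt (?I (cls_operator f) / pi) \<le> sqrt (?K * (?I f / pi))" by (rule real_sqrt_le_mono)
  then show "space_norm Bergman (cls_operator f) \<le> sqrt ?K * space_norm Bergman f"
    by (simp only: space_norm.simps real_sqrt_mult)
qed

lemma cls_operator_commutant: "cls_operator \<in> commutant H (mult_operator \<phi>)"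
proof -
  have hol: "\<phi> holomorphic_on ball 0 1"
    using phi_holomorphic cball_subset_N by (auto elim!: holomorphic_on_subset)
  have const: "cls_operator (\<lambda>z. c * f z) = (\<lambda>z. c * cls_operator f z)" if "f holomorphic_on ball 0 1" for c f
    by (rule cls_operator_mult[OF that]) auto
  have bounded: "cls_operator f \<in> space_carrier H \<and> space_norm H (cls_operator f) \<le>
       (if H = Hardy then sqrt mean_const else sqrt (mean_const / (contraction / 2 * (1 - contraction / 2)))) * space_norm H f"
    if "f \<in> space_carrier H" for f
    using cls_operator_bounded_Hardy[of f] cls_operator_bounded_Bergman[of f] that by (cases H) auto
  have "bounded_operator H cls_operator"
    unfolding bounded_operator_def
    using bounded const cls_operator_add space_carrierD(1) by blast
  moreover have "cls_operator (mult_operator \<phi> f) = mult_operator \<phi> (cls_operator f)" if "f \<in> space_carrier H" for f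
    unfolding mult_operator_def
    by (rule cls_operator_mult[OF space_carrierD(1)[OF that] hol]) (use cls_phi in auto)
  ultimately show ?thesis by (simp add: commutant_def)
qed

text \<open>Evaluated on the constant 1, commutation says that \<open>B(z)\<close> is the average of \<open>B\<close> over the class of \<open>z\<close>.
  Equivalent points have the same class, hence the same average.\<close>

lemma commutant_imp_invariant:
  assumes B: "B holomorphic_on ball 0 1" and comm: "cls_operator \<in> commutant H (mult_operator B)"
    and z: "z \<in> G" "norm z < 1" and w: "w \<in> cls z"
  shows "B w = B z"
proof -
  have eq: "cls_operator (mult_operator B disc_one) = mult_operator B (cls_operator disc_one)"
    using comm disc_one_carrier[of H] by (simp add: commutant_def)
  have hol: "mult_operator B disc_one holomorphic_on ball 0 1"
    unfolding mult_operator_def by (intro holomorphic_intros B disc_one_holomorphic)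
  have average: "(\<Sum>v\<in>cls u. B v) = B u * of_nat (card (cls u))" if u: "u \<in> G" "norm u < 1" for u
  proof -
    have one: "disc_one v = 1" if "v \<in> cls u" for v
      using contraction(3)[OF that u(2)] by (simp add: disc_one_def)
    have "cls_operator (mult_operator B disc_one) u = (\<Sum>v\<in>cls u. B v)"
      using cls_operator_on_G[OF hol u] one by (simp add: mult_operator_def)
    moreover have "cls_operator disc_one u = of_nat (card (cls u))"
      using cls_operator_on_G[OF disc_one_holomorphic u] one by simp
    ultimately show ?thesis using fun_cong[OF eq, of u] by (simp add: mult_operator_def)
  qed
  have wG: "w \<in> G" "norm w < 1" using cls_G(2)[OF w] contraction(3)[OF w z(2)] by auto
  have "B w * of_nat (card (cls z)) = B z * of_nat (card (cls z))"
    using average[OF z] average[OF wG] unfolding cls_eq[OF w] by simp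
  moreover have "card (cls z) \<noteq> 0" using card_cls[OF z(1)] sheets_pos by simp
  ultimately show ?thesis by simp
qed

end

section \<open>Pairs of circle points with equal values\<close>

text \<open>The nonvanishing factor is written as an exponential so that roots of every order can be taken.\<close>

lemma local_factorization:
  assumes f: "f analytic_on {a}" and ne: "\<forall>\<^sub>F z in at a. f z \<noteq> f a"
  obtains n r L where "n > 0" "r > 0" "L holomorphic_on ball a r"
    "\<And>z. z \<in> ball a r \<Longrightarrow> f z - f a = (z - a) ^ n * exp (L z)"
proof -
  obtain e where e: "e > 0" "f holomorphic_on ball a e" using f by (auto simp: analytic_at_ball)
  have nc: "\<not> (\<lambda>z. f z - f a) constant_on ball a e"
  proof
    assume "(\<lambda>z. f z - f a) constant_on ball a e"
    then have eq: "f z = f a" if "z \<in> ball a e" for z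
      using that e(1) unfolding constant_on_def by (metis centre_in_ball diff_add_cancel)
    have "\<forall>\<^sub>F z in at a. z \<in> ball a e" using e(1) by (intro eventually_at_in_open') auto
    with ne have "\<forall>\<^sub>F z in at a. False" by eventually_elim (use eq in auto)
    then show False by simp
  qed
  have hol: "(\<lambda>z. f z - f a) holomorphic_on ball a e" by (intro holomorphic_intros e)
  obtain g r n where g: "0 < n" "0 < r" "ball a r \<subseteq> ball a e" "g holomorphic_on ball a r"
     "\<And>w. w \<in> ball a r \<Longrightarrow> f w - f a = (w - a) ^ n * g w" "\<And>w. w \<in> ball a r \<Longrightarrow> g w \<noteq> 0"
    by (rule holomorphic_factor_zero_nonconstant[OF hol open_ball connected_ball _ _ nc, of a]) (use e in auto)
  obtain L where "L holomorphic_on ball a r" "\<And>z. z \<in> ball a r \<Longrightarrow> g z = exp (L z)"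
    using contractible_imp_holomorphic_log[OF g(4) convex_imp_contractible[OF convex_ball] g(6)] by blast
  then show thesis using that[of n r L] g by auto
qed

lemma eventually_nhds_ball:
  "eventually P (nhds (x :: 'a :: metric_space)) \<Longrightarrow> \<exists>e>0. \<forall>u\<in>ball x e. P u"
  by (auto simp: eventually_nhds_metric dist_commute)

context nonconst_mero begin

lemma circle_in_N: "norm z = 1 \<Longrightarrow> z \<in> N \<and> mirror z \<in> N \<and> z \<noteq> 0"
  using cball_subset_N mirror_on_circle[of z] by auto

text \<open>Otherwise infinitely many pairs of circle points \<open>(z, w)\<close> with \<open>\<phi>(w) = \<phi>(z)\<close> that are not equivalent
  accumulate at some \<open>(z0, w0)\<close>. The solutions of this equation near \<open>(z0, w0)\<close> are finitely many
  Puiseux branches \<open>z = z0 + t\<^sup>m\<close>, \<open>w = W(t)\<close>, one for each \<open>m\<close>-th root of unity, and one branch contains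
  infinitely many of the pairs. Along it the values of \<open>\<phi>\<^sup>*\<close> agree infinitely often near \<open>t = 0\<close>, hence
  always, so the branch provides a germ at each of these pairs.\<close>

lemma finite_nongerm_pairs:
  "finite {z \<in> sphere 0 1. \<exists>w\<in>sphere 0 1. \<phi> w = \<phi> z \<and> w \<notin> cls z}" (is "finite ?E")
proof (rule ccontr)
  assume "infinite ?E"
  then obtain z0 where z0: "z0 \<in> sphere 0 1" "z0 islimpt ?E"
    using compact_sphere[of "0::complex" 1] unfolding compact_eq_Bolzano_Weierstrass
    by (metis (no_types, lifting) mem_Collect_eq subsetI)
  then obtain xs where xs: "\<And>n. xs n \<in> ?E - {z0}" "xs \<longlonglongrightarrow> z0"
    unfolding islimpt_sequential by blast
  then have "\<forall>n. \<exists>w. w \<in> sphere 0 1 \<and> \<phi> w = \<phi> (xs n) \<and> w \<notin> cls (xs n)" by blast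
  then obtain ys where ys: "\<And>n. ys n \<in> sphere 0 1 \<and> \<phi> (ys n) = \<phi> (xs n) \<and> ys n \<notin> cls (xs n)"
    by metis
  obtain w0 q where w0: "w0 \<in> sphere 0 1" "strict_mono q" "(ys \<circ> q) \<longlonglongrightarrow> w0"
    using compact_sphere[of "0::complex" 1] ys unfolding compact_def by metis
  define zs where "zs = xs \<circ> q"
  define ws where "ws = ys \<circ> q"
  have zs: "norm (zs n) = 1" "zs n \<noteq> z0" for n using xs(1)[of "q n"] by (auto simp: zs_def)
  have ws: "norm (ws n) = 1" "\<phi> (ws n) = \<phi> (zs n)" "ws n \<notin> cls (zs n)" for n
    using ys[of "q n"] by (auto simp: ws_def zs_def)
  have zlim: "zs \<longlonglongrightarrow> z0" unfolding zs_def using xs(2) w0(2) by (rule LIMSEQ_subseq_LIMSEQ)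
  have wlim: "ws \<longlonglongrightarrow> w0" using w0(3) by (simp add: ws_def)
  have z0N: "z0 \<in> N" "mirror z0 \<in> N" "z0 \<noteq> 0" and w0N: "w0 \<in> N" "mirror w0 \<in> N" "w0 \<noteq> 0"
    using circle_in_N z0 w0 by auto
  have eq0: "\<phi> w0 = \<phi> z0"
  proof (rule LIMSEQ_unique)
    show "(\<lambda>n. \<phi> (ws n)) \<longlonglongrightarrow> \<phi> w0" using isCont_tendsto_compose[OF phi_isCont[OF w0N(1)] wlim] .
    show "(\<lambda>n. \<phi> (ws n)) \<longlonglongrightarrow> \<phi> z0" using isCont_tendsto_compose[OF phi_isCont[OF z0N(1)] zlim] ws by simp
  qed
  obtain m rw Lw where Lw: "m > 0" "rw > 0" "Lw holomorphic_on ball w0 rw"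
    "\<And>w. w \<in> ball w0 rw \<Longrightarrow> \<phi> w - \<phi> w0 = (w - w0) ^ m * exp (Lw w)"
    by (rule local_factorization[OF phi_analytic[OF w0N(1)] eventually_ne]) blast
  obtain p rz Lz where Lz: "p > 0" "rz > 0" "Lz holomorphic_on ball z0 rz"
    "\<And>z. z \<in> ball z0 rz \<Longrightarrow> \<phi> z - \<phi> z0 = (z - z0) ^ p * exp (Lz z)"
    by (rule local_factorization[OF phi_analytic[OF z0N(1)] eventually_ne]) blast
  have root: "exp (x / of_nat m) ^ m = exp x" for x :: complex
    using Lw(1) by (simp add: exp_of_nat_mult[symmetric])
  \<comment> \<open>A local coordinate at \<open>w0\<close> in which \<open>\<phi> - \<phi>(w0)\<close> is the \<open>m\<close>-th power.\<close>
  define k where "k = (\<lambda>w. (w - w0) * exp (Lw w / of_nat m))"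
  have k_pow: "k w ^ m = \<phi> w - \<phi> w0" if "w \<in> ball w0 rw" for w
    using Lw(4)[OF that] root by (simp add: k_def power_mult_distrib)
  have khol: "k holomorphic_on ball w0 rw" unfolding k_def using Lw by (intro holomorphic_intros) auto
  have "(k has_field_derivative exp (Lw w0 / of_nat m)) (at w0)"
  proof -
    have "(Lw has_field_derivative deriv Lw w0) (at w0)"
      using holomorphic_derivI[OF Lw(3) open_ball, of w0] Lw by auto
    then show ?thesis unfolding k_def using Lw by (auto intro!: derivative_eq_intros)
  qed
  then have "deriv k w0 \<noteq> 0" by (simp add: DERIV_imp_deriv)
  then obtain d where d: "d > 0" "ball w0 d \<subseteq> ball w0 rw" "open (k ` ball w0 d)" "inj_on k (ball w0 d)"
    using has_complex_derivative_locally_invertible[OF khol _ open_ball, of w0] Lw by (metis centre_in_ball)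
  have khol': "k holomorphic_on ball w0 d" using khol d(2) holomorphic_on_subset by blast
  obtain \<kappa> where \<kappa>: "\<kappa> holomorphic_on k ` ball w0 d" "\<And>w. w \<in> ball w0 d \<Longrightarrow> \<kappa> (k w) = w"
    using holomorphic_has_inverse[OF khol' open_ball d(4)] by metis
  \<comment> \<open>Along \<open>z = z0 + t\<^sup>m\<close> the function \<open>\<phi> - \<phi>(z0)\<close> is an \<open>m\<close>-th power too, and \<open>a\<close> is a root of it.\<close>
  define a where "a = (\<lambda>t. t ^ p * exp (Lz (z0 + t ^ m) / of_nat m))"
  have a_pow: "a t ^ m = \<phi> (z0 + t ^ m) - \<phi> z0" if "z0 + t ^ m \<in> ball z0 rz" for t
    using Lz(4)[OF that] root
    by (simp add: a_def power_mult_distrib power_mult[symmetric] mult.commute)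
  define ts where "ts = (\<lambda>n. exp (Ln (zs n - z0) / of_nat m))"
  have ts: "ts n ^ m = zs n - z0" "ts n \<noteq> 0" for n
    using zs(2)[of n] root by (auto simp: ts_def)
  have ts_small: "\<forall>\<^sub>F n in sequentially. norm (ts n) < \<delta>" if "\<delta> > 0" for \<delta>
  proof -
    have "\<forall>\<^sub>F n in sequentially. dist (zs n) z0 < \<delta> ^ m" using zlim by (rule tendstoD) (use that in simp)
    then show ?thesis
    proof eventually_elim
      case (elim n)
      then have "norm (ts n) ^ m < \<delta> ^ m" using ts(1)[of n] by (simp add: norm_power[symmetric] dist_norm)
      then show ?case by (rule power_less_imp_less_base) (use that in simp)
    qed
  qed
  define \<omega>s where "\<omega>s = (\<lambda>n. k (ws n) / a (ts n))"
  have near: "\<forall>\<^sub>F n in sequentially. ws n \<in> ball w0 d \<and> zs n \<in> ball z0 rz"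
  proof -
    have "\<forall>\<^sub>F n in sequentially. dist (ws n) w0 < d" using wlim d(1) by (rule tendstoD)
    moreover have "\<forall>\<^sub>F n in sequentially. dist (zs n) z0 < rz" using zlim Lz(2) by (rule tendstoD)
    ultimately show ?thesis by eventually_elim (auto simp: dist_commute)
  qed
  then obtain n0 where n0: "\<And>n. n \<ge> n0 \<Longrightarrow> ws n \<in> ball w0 d \<and> zs n \<in> ball z0 rz"
    unfolding eventually_sequentially by blast
  have \<omega>s: "\<omega>s n ^ m = 1" "a (ts n) \<noteq> 0" if "n \<ge> n0" for n
  proof -
    have z: "z0 + ts n ^ m = zs n" using ts(1)[of n] by simp
    show "a (ts n) \<noteq> 0" using ts(2)[of n] by (simp add: a_def)
    then have "a (ts n) ^ m \<noteq> 0" by simp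
    moreover have "a (ts n) ^ m = \<phi> (zs n) - \<phi> z0" using a_pow[of "ts n"] n0[OF that] z by simp
    moreover have "k (ws n) ^ m = \<phi> (ws n) - \<phi> w0" using k_pow n0[OF that] d(2) by blast
    ultimately show "\<omega>s n ^ m = 1" using ws(2)[of n] eq0 by (simp add: \<omega>s_def power_divide)
  qed
  have "finite (\<omega>s ` {n0..})"
    by (rule finite_subset[OF _ finite_roots_unity[of m]]) (use \<omega>s Lw(1) in auto)
  then obtain n1 where "n1 \<in> {n0..}" and inf: "infinite {n \<in> {n0..}. \<omega>s n = \<omega>s n1}"
    using pigeonhole_infinite[of "{n0..}" \<omega>s] infinite_Ici by blast
  define \<omega> where "\<omega> = \<omega>s n1"
  have \<omega>: "\<omega> ^ m = 1" using \<omega>s(1)[of n1] \<open>n1 \<in> {n0..}\<close> by (simp add: \<omega>_def)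
  define J where "J = {n \<in> {n0..}. \<omega>s n = \<omega>}"
  have J: "\<exists>n\<in>J. P n" if ev_P: "eventually P sequentially" for P
  proof -
    obtain n2 where n2: "\<And>n. n \<ge> n2 \<Longrightarrow> P n" using ev_P unfolding eventually_sequentially by blast
    have "infinite J" using inf by (simp add: J_def \<omega>_def)
    then obtain n where "n \<ge> n2" "n \<in> J" by (metis infinite_nat_iff_unbounded_le)
    then show ?thesis using n2 by blast
  qed
  define W where "W = (\<lambda>t. \<kappa> (\<omega> * a t))"
  have Wt: "W (ts n) = ws n" if "n \<in> J" for n
  proof -
    have "n \<ge> n0" "\<omega>s n = \<omega>" using that by (auto simp: J_def)
    then have "\<omega> * a (ts n) = k (ws n)" using \<omega>s(2)[of n] by (auto simp: \<omega>s_def)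
    then show ?thesis using \<kappa>(2) n0[OF \<open>n \<ge> n0\<close>] by (simp add: W_def)
  qed
  have a_an: "a analytic_on {t}" if "z0 + t ^ m \<in> ball z0 rz" for t
  proof -
    have "Lz analytic_on {z0 + t ^ m}" using Lz(3) that by (intro holomorphic_on_imp_analytic_at) auto
    then have "(Lz \<circ> (\<lambda>t. z0 + t ^ m)) analytic_on {t}"
      by (intro analytic_on_compose analytic_intros) auto
    then show ?thesis unfolding a_def o_def using Lw(1) by (intro analytic_intros) auto
  qed
  have a0: "a 0 = 0" using Lz(1) by (simp add: a_def)
  have k0: "k w0 = 0" by (simp add: k_def)
  have in0: "0 \<in> k ` ball w0 d" using k0 d(1) by (metis centre_in_ball image_eqI)
  have W0: "W 0 = w0" using \<kappa>(2)[of w0] k0 a0 d(1) by (simp add: W_def)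
  have W_an: "W analytic_on {t}" if "z0 + t ^ m \<in> ball z0 rz" "\<omega> * a t \<in> k ` ball w0 d" for t
  proof -
    have "\<kappa> analytic_on {\<omega> * a t}" using \<kappa>(1) d(3) that(2) by (rule holomorphic_on_imp_analytic_at)
    moreover have "(\<lambda>t. \<omega> * a t) analytic_on {t}" by (intro analytic_intros a_an that)
    ultimately have "(\<kappa> \<circ> (\<lambda>t. \<omega> * a t)) analytic_on {t}" by (intro analytic_on_compose) auto
    then show ?thesis by (simp add: W_def o_def)
  qed
  have Z_an: "(\<lambda>t. z0 + t ^ m) analytic_on {t}" for t by (intro analytic_intros)
  have ev: "\<forall>\<^sub>F t in nhds 0. h t \<in> S" if "h analytic_on {0}" "open S" "h 0 \<in> S" for h :: "complex \<Rightarrow> complex" and S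
    using isCont_tendsto_nhds[OF analytic_at_imp_isCont[OF that(1)]] that(2,3) by (simp add: topological_tendstoD)
  have mN: "open {u. u \<noteq> 0 \<and> mirror u \<in> N}"
  proof -
    have "open (- {0::complex} \<inter> mirror -` N)"
      by (rule continuous_open_preimage) (auto simp: open_N intro!: continuous_at_imp_continuous_on isCont_mirror)
    moreover have "- {0::complex} \<inter> mirror -` N = {u. u \<noteq> 0 \<and> mirror u \<in> N}" by auto
    ultimately show ?thesis by simp
  qed
  have "\<forall>\<^sub>F t in nhds 0. z0 + t ^ m \<in> ball z0 rz" using Lz(2) Lw(1) by (intro ev[OF Z_an]) (auto simp: zero_power)
  moreover have "\<forall>\<^sub>F t in nhds 0. \<omega> * a t \<in> k ` ball w0 d"
    using in0 a0 d(3) Lw(1) Lz(2)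
    by (intro ev[of "\<lambda>t. \<omega> * a t"] analytic_intros a_an) (auto simp: zero_power)
  moreover have "\<forall>\<^sub>F t in nhds 0. z0 + t ^ m \<in> {u. u \<noteq> 0 \<and> mirror u \<in> N}"
    using Lw(1) z0N by (intro ev[OF Z_an mN]) (auto simp: zero_power)
  moreover have "\<forall>\<^sub>F t in nhds 0. W t \<in> {u. u \<noteq> 0 \<and> mirror u \<in> N}"
    using W0 w0N Lw(1) Lz(2) in0 a0 by (intro ev[OF W_an mN]) (auto simp: zero_power)
  ultimately have "\<forall>\<^sub>F t in nhds 0. z0 + t ^ m \<in> ball z0 rz \<and> \<omega> * a t \<in> k ` ball w0 d \<and>
       z0 + t ^ m \<in> {u. u \<noteq> 0 \<and> mirror u \<in> N} \<and> W t \<in> {u. u \<noteq> 0 \<and> mirror u \<in> N}"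
    by eventually_elim auto
  from eventually_nhds_ball[OF this] obtain \<delta> where \<delta>: "\<delta> > 0" and reg: "\<And>t. t \<in> ball 0 \<delta> \<Longrightarrow> z0 + t ^ m \<in> ball z0 rz \<and> \<omega> * a t \<in> k ` ball w0 d \<and>
       z0 + t ^ m \<in> {u. u \<noteq> 0 \<and> mirror u \<in> N} \<and> W t \<in> {u. u \<noteq> 0 \<and> mirror u \<in> N}"
    by blast
  have phiW: "\<phi> (W t) = \<phi> (z0 + t ^ m)" if "t \<in> ball 0 \<delta>" for t
  proof -
    from reg[OF that] obtain w where w: "w \<in> ball w0 d" "\<omega> * a t = k w" by blast
    then have "W t = w" using \<kappa>(2) by (simp add: W_def)
    then have "\<phi> (W t) - \<phi> w0 = (\<omega> * a t) ^ m" using k_pow[of w] w d(2) by auto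
    also have "\<dots> = \<phi> (z0 + t ^ m) - \<phi> z0" using a_pow[of t] reg[OF that] \<omega> by (simp add: power_mult_distrib)
    finally show ?thesis using eq0 by simp
  qed
  \<comment> \<open>The difference of the values of \<open>\<phi>\<^sup>*\<close> along the branch.\<close>
  define D where "D = (\<lambda>t. cnj (\<phi> (mirror (W t))) - cnj (\<phi> (mirror (z0 + t ^ m))))"
  have D_an: "D analytic_on {t}" if "t \<in> ball 0 \<delta>" for t
  proof -
    have W: "W analytic_on {t}" by (rule W_an) (use reg[OF that] in auto)
    have "(\<lambda>u. cnj (\<phi> (mirror u))) analytic_on {W t}"
      by (rule analytic_cnj_mirror) (use reg[OF that] phi_analytic in auto)
    then have "(\<lambda>u. cnj (\<phi> (mirror u))) \<circ> W analytic_on {t}" using W by (intro analytic_on_compose) auto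
    moreover have "(\<lambda>u. cnj (\<phi> (mirror u))) analytic_on {z0 + t ^ m}"
      by (rule analytic_cnj_mirror) (use reg[OF that] phi_analytic in auto)
    then have "(\<lambda>u. cnj (\<phi> (mirror u))) \<circ> (\<lambda>t. z0 + t ^ m) analytic_on {t}"
      using Z_an by (intro analytic_on_compose) auto
    ultimately show ?thesis unfolding D_def o_def by (intro analytic_intros)
  qed
  have D_zero: "D (ts n) = 0" if "n \<in> J" for n
    using Wt[OF that] ts(1)[of n] ws[of n] zs[of n] mirror_on_circle by (simp add: D_def)
  have D0: "D t = 0" if "t \<in> ball 0 \<delta>" for t
  proof (rule analytic_continuation[of D "ball 0 \<delta>" "{t \<in> ball 0 \<delta>. D t = 0}" 0])
    show "D holomorphic_on ball 0 \<delta>"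
      by (rule analytic_imp_holomorphic, subst analytic_on_analytic_at) (use D_an in auto)
    show "0 islimpt {t \<in> ball 0 \<delta>. D t = 0}"
      unfolding islimpt_approachable
    proof (intro allI impI)
      fix e :: real assume "e > 0"
      then obtain n where "n \<in> J" "norm (ts n) < min e \<delta>"
        using J[OF ts_small[of "min e \<delta>"]] \<delta> by auto
      then show "\<exists>x'\<in>{t \<in> ball 0 \<delta>. D t = 0}. x' \<noteq> 0 \<and> dist x' 0 < e"
        using D_zero[of n] ts(2)[of n] by (intro bexI[of _ "ts n"]) auto
    qed
  qed (use \<delta> that in auto)
  have "\<forall>\<^sub>F z in at z0. z \<in> G" by (rule eventually_G[OF z0N(3)])
  moreover have "filterlim zs (at z0) sequentially"
    using zlim zs(2) by (auto simp: filterlim_at)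
  ultimately have "\<forall>\<^sub>F n in sequentially. zs n \<in> G" by (rule eventually_compose_filterlim)
  with ts_small[OF \<delta>] have "\<forall>\<^sub>F n in sequentially. norm (ts n) < \<delta> \<and> zs n \<in> G" by eventually_elim auto
  then obtain n where n: "n \<in> J" "norm (ts n) < \<delta>" "zs n \<in> G" using J by blast
  \<comment> \<open>The branch of \<open>t = (z - z0) powr (1 / m)\<close> near \<open>zs n\<close> that takes the value \<open>ts n\<close> there.\<close>
  define \<tau> where "\<tau> = (\<lambda>z. ts n * exp (Ln ((z - z0) / (zs n - z0)) / of_nat m))"
  have zz: "zs n - z0 \<noteq> 0" using zs(2)[of n] by simp
  have \<tau>_an: "\<tau> analytic_on {zs n}"
    unfolding \<tau>_def using zz Lw(1) by (intro analytic_intros) auto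
  have \<tau>0: "\<tau> (zs n) = ts n" using zz by (simp add: \<tau>_def)
  have \<tau>_pow: "z0 + \<tau> z ^ m = z" if "z \<noteq> z0" for z
    using that zz ts(1)[of n] root[of "Ln ((z - z0) / (zs n - z0))"] by (simp add: \<tau>_def power_mult_distrib)
  have "\<forall>\<^sub>F z in nhds (zs n). \<tau> z \<in> ball 0 \<delta>"
    using isCont_tendsto_nhds[OF analytic_at_imp_isCont[OF \<tau>_an]] \<tau>0 n(2)
    by (intro topological_tendstoD[where f = \<tau>]) auto
  moreover have "\<forall>\<^sub>F z in nhds (zs n). z \<in> - {z0}" using zs(2)[of n] by (intro eventually_nhds_in_open) auto
  ultimately have "\<forall>\<^sub>F z in nhds (zs n). \<phi> (W (\<tau> z)) = \<phi> z \<and> \<phi> (mirror (W (\<tau> z))) = \<phi> (mirror z)"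
  proof eventually_elim
    case (elim z)
    then have "z0 + \<tau> z ^ m = z" using \<tau>_pow by simp
    then show ?case using phiW[OF elim(1)] D0[OF elim(1)] by (simp add: D_def)
  qed
  moreover have "W \<circ> \<tau> analytic_on {zs n}"
    using \<tau>_an W_an[of "ts n"] reg[of "ts n"] n(2) \<tau>0 by (intro analytic_on_compose) auto
  ultimately have "germ (W \<circ> \<tau>) (zs n)" by (simp add: germ_def)
  moreover have "(W \<circ> \<tau>) (zs n) = ws n" using \<tau>0 Wt[OF n(1)] by simp
  moreover have "ws n \<in> G"
  proof -
    have "mirror (ws n) = ws n" "mirror (zs n) = zs n" using ws zs mirror_on_circle by auto
    then show ?thesis using n(3) ws(2)[of n] circle_in_N[OF ws(1)[of n]] by (auto simp: G_def)
  qed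
  ultimately have "ws n \<in> cls (zs n)" using n(3) unfolding cls_def by blast
  then show False using ws(3) by simp
qed

end

section \<open>Finite Blaschke products\<close>

lemma blaschke_factor_norm:
  fixes a z :: complex
  assumes a: "norm a < 1"
  shows "norm z < 1 \<Longrightarrow> norm (z - a) < norm (1 - cnj a * z)"
    and "norm z = 1 \<Longrightarrow> norm (z - a) = norm (1 - cnj a * z)"
    and "norm z \<ge> 1 \<Longrightarrow> norm (z - a) \<ge> norm (1 - cnj a * z)"
proof -
  have id: "(norm (1 - cnj a * z))\<^sup>2 - (norm (z - a))\<^sup>2 = (1 - (norm z)\<^sup>2) * (1 - (norm a)\<^sup>2)"
    unfolding cmod_power2 by (simp add: algebra_simps power2_eq_square)
  have a2: "1 - (norm a)\<^sup>2 > 0" using a by (simp add: power_less_one_iff abs_square_less_1)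
  show "norm (z - a) < norm (1 - cnj a * z)" if "norm z < 1"
  proof (rule power2_less_imp_less)
    have "1 - (norm z)\<^sup>2 > 0" using that by (simp add: power_less_one_iff abs_square_less_1)
    then have "(1 - (norm z)\<^sup>2) * (1 - (norm a)\<^sup>2) > 0" using a2 by simp
    then show "(norm (z - a))\<^sup>2 < (norm (1 - cnj a * z))\<^sup>2" using id by linarith
  qed simp
  show "norm (z - a) = norm (1 - cnj a * z)" if "norm z = 1"
    using id that by (simp add: power2_eq_iff_nonneg)
  show "norm (z - a) \<ge> norm (1 - cnj a * z)" if "norm z \<ge> 1"
  proof (rule power2_le_imp_le)
    have "1 - (norm z)\<^sup>2 \<le> 0" using that by simp
    then have "(1 - (norm z)\<^sup>2) * (1 - (norm a)\<^sup>2) \<le> 0" using a2 by (intro mult_nonpos_nonneg) auto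
    then show "(norm (1 - cnj a * z))\<^sup>2 \<le> (norm (z - a))\<^sup>2" using id by linarith
  qed simp
qed

text \<open>The formula for \<open>B\<close> makes sense on a neighbourhood of the closed disc. Each factor separates the
  inside, the circle and the outside, so a nonempty product does.\<close>

lemma finite_blaschke_extension:
  assumes "finite_blaschke B"
  obtains (const) c where "\<And>z. norm z < 1 \<Longrightarrow> B z = c"
    | (proper) b U where "open U" "cball 0 1 \<subseteq> U" "b holomorphic_on U"
      "\<And>z. norm z < 1 \<Longrightarrow> b z = B z"
      "\<And>z. z \<in> U \<Longrightarrow> norm (b z) < 1 \<longleftrightarrow> norm z < 1"
      "\<And>z. norm z = 1 \<Longrightarrow> norm (b z) = 1"
proof -
  obtain n :: nat and a c where c: "norm c = 1" and a: "\<And>i. i < n \<Longrightarrow> norm (a i) < 1"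
    and B: "\<And>z. z \<in> ball 0 1 \<Longrightarrow> B z = c * (\<Prod>i<n. (z - a i) / (1 - cnj (a i) * z))"
    using assms unfolding finite_blaschke_def by blast
  show thesis
  proof (cases "n = 0")
    case True
    show thesis by (rule const[of c]) (use B True in auto)
  next
    case False
    define U where "U = (\<Inter>i<n. {z. 1 - cnj (a i) * z \<noteq> 0})"
    define b where "b = (\<lambda>z. c * (\<Prod>i<n. (z - a i) / (1 - cnj (a i) * z)))"
    have nb: "norm (b z) = (\<Prod>i<n. norm (z - a i) / norm (1 - cnj (a i) * z))" for z
      by (simp add: b_def norm_mult c prod_norm[symmetric] norm_divide)
    have nz: "1 - cnj (a i) * z \<noteq> 0" if "norm z \<le> 1" "i < n" for z i
    proof
      assume "1 - cnj (a i) * z = 0"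
      then have "norm (cnj (a i) * z) = 1" by (metis norm_one right_minus_eq)
      moreover have "norm (a i) * norm z \<le> norm (a i) * 1" using that by (intro mult_left_mono) auto
      ultimately show False using a[OF that(2)] by (simp add: norm_mult)
    qed
    show thesis
    proof (rule proper[of U b])
      show "open U" unfolding U_def
        by (intro open_INT finite_lessThan ballI open_Collect_neq continuous_intros)
      show "cball 0 1 \<subseteq> U" using nz by (auto simp: U_def)
      show "b holomorphic_on U" unfolding b_def U_def by (intro holomorphic_intros) auto
      show "b z = B z" if "norm z < 1" for z using B[of z] that by (simp add: b_def)
      show "norm (b z) = 1" if "norm z = 1" for z
        unfolding nb using blaschke_factor_norm(2)[OF a that] nz[of z] that by (intro prod.neutral) auto
      show "norm (b z) < 1 \<longleftrightarrow> norm z < 1" if z: "z \<in> U" for z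
      proof
        assume z1: "norm z < 1"
        have "(\<Prod>i<n. norm (z - a i) / norm (1 - cnj (a i) * z)) < (\<Prod>i<n. 1)"
        proof (rule prod_mono_strict)
          show "0 \<in> {..<n}" using False by simp
        qed (use blaschke_factor_norm(1)[OF a z1] nz[of z] z1 False in \<open>auto simp: divide_less_eq less_imp_le\<close>)
        then show "norm (b z) < 1" unfolding nb by simp
      next
        assume lt: "norm (b z) < 1"
        show "norm z < 1"
        proof (rule ccontr)
          assume "\<not> norm z < 1"
          then have z1: "norm z \<ge> 1" by simp
          have "1 \<le> (\<Prod>i<n. norm (z - a i) / norm (1 - cnj (a i) * z))"
            by (rule prod_ge_1) (use blaschke_factor_norm(3)[OF a z1] z in \<open>auto simp: U_def le_divide_eq\<close>)
          then show False using lt unfolding nb by simp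
        qed
      qed
    qed
  qed
qed

text \<open>The properties of a nonconstant finite Blaschke product that the argument uses.\<close>

locale proper_disc_map =
  fixes b :: "complex \<Rightarrow> complex" and U :: "complex set"
  assumes open_U: "open U" and cball_U: "cball 0 1 \<subseteq> U" and b_hol: "b holomorphic_on U"
    and b_disc: "\<And>z. z \<in> U \<Longrightarrow> norm (b z) < 1 \<longleftrightarrow> norm z < 1"
    and b_circle: "\<And>z. norm z = 1 \<Longrightarrow> norm (b z) = 1"
begin

lemma in_U: "norm z \<le> 1 \<Longrightarrow> z \<in> U"
  using cball_U by auto

lemma b_isCont: "z \<in> U \<Longrightarrow> isCont b z"
  using b_hol open_U by (intro analytic_at_imp_isCont holomorphic_on_imp_analytic_at)

text \<open>The map is not constant near a circle point, as its modulus is less than 1 at the disc points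
  nearby, and not constant near a disc point, as it would be constant on the disc and hence at 1.\<close>

lemma b_open_image:
  assumes z: "norm z \<le> 1" and \<delta>: "\<delta> > 0" "ball z \<delta> \<subseteq> U"
  shows "open (b ` ball z \<delta>)"
proof (cases "norm z = 1")
  case True
  have nc: "\<not> b constant_on ball z \<delta>"
  proof
    assume "b constant_on ball z \<delta>"
    then have const: "b u = b z" if "u \<in> ball z \<delta>" for u
      using that \<delta>(1) unfolding constant_on_def by (metis centre_in_ball)
    define s where "s = 1 - min 1 (\<delta> / 2)"
    have s: "0 \<le> s" "s < 1" "1 - s < \<delta>" using \<delta>(1) by (auto simp: s_def)
    have "dist z (of_real s * z) = norm (of_real (1 - s) * z)" by (simp add: dist_norm algebra_simps)
    also have "\<dots> = 1 - s" using s True by (simp only: norm_mult norm_of_real) simp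
    finally have in_ball: "of_real s * z \<in> ball z \<delta>" using s by simp
    have "norm (of_real s * z) < 1" using s True by (simp add: norm_mult)
    then have "norm (b (of_real s * z)) < 1" using b_disc[of "of_real s * z"] in_ball \<delta>(2) by blast
    then show False using const[OF in_ball] b_circle[OF True] by simp
  qed
  have "b holomorphic_on ball z \<delta>" using b_hol \<delta>(2) holomorphic_on_subset by blast
  from open_mapping_thm[OF this open_ball connected_ball open_ball order_refl nc] show ?thesis .
next
  case False
  have nc: "\<not> b constant_on ball 0 1"
  proof
    assume "b constant_on ball 0 1"
    then obtain v where v: "\<And>u. u \<in> ball 0 1 \<Longrightarrow> b u = v" by (auto simp: constant_on_def)
    have "b 1 = v"
    proof (rule tendsto_unique)
      show "at (1::complex) within ball 0 1 \<noteq> bot"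
        using islimpt_ball[of 1 "0::complex" 1] by (simp add: trivial_limit_within)
      show "(b \<longlongrightarrow> b 1) (at 1 within ball 0 1)"
        using b_isCont[OF in_U[of 1]] by (auto simp: isCont_def intro: tendsto_within_subset)
      show "(b \<longlongrightarrow> v) (at 1 within ball 0 1)"
        by (rule tendsto_eventually) (use v in \<open>auto simp: eventually_at_filter\<close>)
    qed
    moreover have "norm (b 1) = 1" by (rule b_circle) simp
    moreover have "norm (b 0) < 1" using b_disc[OF in_U[of 0]] by simp
    ultimately show False using v[of 0] by simp
  qed
  have bad: "\<not> b constant_on ball z \<delta>"
  proof
    assume "b constant_on ball z \<delta>"
    then obtain v where v: "\<And>u. u \<in> ball z \<delta> \<Longrightarrow> b u = v" by (auto simp: constant_on_def)
    have z1: "norm z < 1" using z False by simp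
    have "z \<in> ball z \<delta> \<inter> ball 0 1" using z1 \<delta>(1) by simp
    then have ne: "ball z \<delta> \<inter> ball 0 1 \<noteq> {}" by blast
    have "b u = v" if "u \<in> ball 0 1" for u
      by (rule analytic_continuation_open[OF _ _ ne, of "ball 0 1" b "\<lambda>_. v"])
         (use v that b_hol cball_U in \<open>auto elim!: holomorphic_on_subset\<close>)
    then show False using nc by (auto simp: constant_on_def)
  qed
  have "b holomorphic_on ball z \<delta>" using b_hol \<delta>(2) holomorphic_on_subset by blast
  from open_mapping_thm[OF this open_ball connected_ball open_ball order_refl bad] show ?thesis .
qed

lemma b_cball_subset: "b ` cball 0 1 \<subseteq> cball 0 1"
proof
  fix w assume "w \<in> b ` cball 0 1"
  then obtain z where z: "norm z \<le> 1" "w = b z" by auto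
  then show "w \<in> cball 0 1"
    using b_disc[of z] b_circle[of z] cball_U by (cases "norm z = 1") (auto simp: less_imp_le)
qed

lemma compact_b_cball: "compact (b ` cball 0 1)"
  by (intro compact_continuous_image continuous_at_imp_continuous_on ballI b_isCont) (use cball_U in auto)

text \<open>The image is open, and it is closed in the disc because circle points go to the circle.\<close>

lemma b_surj_ball: "ball 0 1 \<subseteq> b ` ball 0 1"
proof -
  have eq: "b ` ball 0 1 = ball 0 1 \<inter> b ` cball 0 1"
  proof (intro equalityI subsetI)
    fix w assume "w \<in> b ` ball 0 1"
    then obtain z where z: "norm z < 1" "w = b z" by auto
    then show "w \<in> ball 0 1 \<inter> b ` cball 0 1" using b_disc[OF in_U[of z]] by auto
  next
    fix w assume "w \<in> ball 0 1 \<inter> b ` cball 0 1"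
    then obtain z where z: "norm z \<le> 1" "w = b z" "norm (b z) < 1" by auto
    then show "w \<in> b ` ball 0 1" using b_disc[of z] cball_U by auto
  qed
  have "ball 0 1 \<subseteq> U" using cball_U by auto
  then have "open (b ` ball 0 1)" by (intro b_open_image) auto
  then have "openin (top_of_set (ball 0 1)) (b ` ball 0 1)"
    using eq by (metis inf_le1 openin_open_eq open_ball)
  moreover have "closedin (top_of_set (ball 0 1)) (b ` ball 0 1)"
    unfolding eq using compact_b_cball by (intro closedin_closed_Int compact_imp_closed)
  moreover have "b ` ball 0 1 \<noteq> {}" by simp
  ultimately have "b ` ball 0 1 = ball 0 1"
    using connected_ball[of "0::complex" 1] connected_clopen by blast
  then show ?thesis by simp
qed

lemma b_surj: "b ` cball 0 1 = cball 0 1"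
proof
  have "ball 0 1 \<subseteq> b ` cball 0 1" using b_surj_ball ball_subset_cball by blast
  then have "closure (ball 0 1) \<subseteq> b ` cball 0 1"
    by (rule closure_minimal) (rule compact_imp_closed[OF compact_b_cball])
  then show "cball 0 1 \<subseteq> b ` cball 0 1" by simp
qed (rule b_cball_subset)

lemma b_lift:
  assumes "norm w = 1" obtains z where "norm z = 1" "b z = w"
proof -
  obtain z where z: "norm z \<le> 1" "b z = w" using b_surj assms by (metis imageE mem_cball_0 order_refl)
  then have "norm z = 1" using b_disc[of z] assms cball_U by fastforce
  then show thesis using that z by blast
qed

text \<open>Near a circle point \<open>z\<close> every disc point close to \<open>b(z)\<close> is an image of a disc point close to \<open>z\<close>, so \<open>\<psi>\<close>
  has the limit \<open>\<phi>(z)\<close> at \<open>b(z)\<close>. The extension is continuous because \<open>b\<close> is a closed map of the closed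
  disc onto itself.\<close>

lemma factor_extends:
  assumes \<phi>: "\<And>z. norm z \<le> 1 \<Longrightarrow> isCont \<phi> z" and fac: "\<And>z. norm z < 1 \<Longrightarrow> \<psi> (b z) = \<phi> z"
  obtains \<Psi> :: "complex \<Rightarrow> complex" where "\<And>z. norm z < 1 \<Longrightarrow> \<Psi> z = \<psi> z" "continuous_on (cball 0 1) \<Psi>"
    "\<And>z. norm z \<le> 1 \<Longrightarrow> \<Psi> (b z) = \<phi> z"
proof -
  have lim: "(\<psi> \<longlongrightarrow> \<phi> z) (at (b z) within ball 0 1)" if z: "norm z = 1" for z
  proof (rule tendstoI)
    fix \<epsilon> :: real assume "\<epsilon> > 0"
    then have "\<forall>\<^sub>F u in nhds z. dist (\<phi> u) (\<phi> z) < \<epsilon>"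
      using isCont_tendsto_nhds[OF \<phi>] z by (intro tendstoD) auto
    moreover have "\<forall>\<^sub>F u in nhds z. u \<in> U" using open_U cball_U z by (intro eventually_nhds_in_open) auto
    ultimately have "\<forall>\<^sub>F u in nhds z. dist (\<phi> u) (\<phi> z) < \<epsilon> \<and> u \<in> U" by eventually_elim auto
    then obtain \<delta> where \<delta>: "\<delta> > 0" "\<And>u. u \<in> ball z \<delta> \<Longrightarrow> dist (\<phi> u) (\<phi> z) < \<epsilon> \<and> u \<in> U"
      using eventually_nhds_ball by blast
    have "open (b ` ball z \<delta>)" using z \<delta> by (intro b_open_image) auto
    moreover have "b z \<in> b ` ball z \<delta>" using \<delta>(1) by auto
    ultimately have "\<forall>\<^sub>F x in nhds (b z). x \<in> b ` ball z \<delta>" by (intro eventually_nhds_in_open)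
    then show "\<forall>\<^sub>F x in at (b z) within ball 0 1. dist (\<psi> x) (\<phi> z) < \<epsilon>"
      unfolding eventually_at_filter
    proof eventually_elim
      case (elim x)
      then obtain u where u: "u \<in> ball z \<delta>" "x = b u" by auto
      show ?case
      proof (intro impI)
        assume "x \<in> ball 0 1"
        then have "norm u < 1" using u b_disc[of u] \<delta>(2)[OF u(1)] by auto
        then show "dist (\<psi> x) (\<phi> z) < \<epsilon>" using fac[of u] u \<delta>(2)[OF u(1)] by simp
      qed
    qed
  qed
  define \<Psi> where "\<Psi> = (\<lambda>w. if norm w < 1 then \<psi> w else Lim (at w within ball 0 1) \<psi>)"
  have \<Psi>b: "\<Psi> (b z) = \<phi> z" if "norm z \<le> 1" for z
  proof (cases "norm z = 1")
    case True
    have "b z islimpt ball 0 1" using b_circle[OF True] by (simp add: islimpt_ball)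
    then have "at (b z) within ball 0 1 \<noteq> bot" by (simp add: trivial_limit_within)
    from tendsto_Lim[OF this lim[OF True]] show ?thesis using b_circle[OF True] by (simp add: \<Psi>_def)
  next
    case False
    then have "norm z < 1" using that by simp
    moreover have "norm (b z) < 1" using b_disc[OF in_U[of z]] \<open>norm z < 1\<close> by auto
    ultimately show ?thesis using fac by (simp add: \<Psi>_def)
  qed
  have "closed (\<Psi> -` C \<inter> cball 0 1)" if C: "closed C" for C
  proof -
    have "\<Psi> -` C \<inter> cball 0 1 = b ` (\<phi> -` C \<inter> cball 0 1)"
    proof (intro equalityI subsetI)
      fix w assume w: "w \<in> \<Psi> -` C \<inter> cball 0 1"
      then obtain z where "norm z \<le> 1" "w = b z" using b_surj by (metis IntD2 imageE mem_cball_0)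
      then show "w \<in> b ` (\<phi> -` C \<inter> cball 0 1)" using w \<Psi>b by auto
    next
      fix w assume "w \<in> b ` (\<phi> -` C \<inter> cball 0 1)"
      then show "w \<in> \<Psi> -` C \<inter> cball 0 1" using \<Psi>b b_cball_subset by auto
    qed
    moreover have "continuous_on (cball 0 1) \<phi>"
      using \<phi> by (intro continuous_at_imp_continuous_on) auto
    then have "closed (\<phi> -` C \<inter> cball 0 1)"
      using C continuous_on_closed_vimage[OF closed_cball] by blast
    then have "compact (\<phi> -` C \<inter> cball 0 1)"
      by (metis compact_cball closed_Int_compact inf.idem inf_assoc)
    then have "compact (b ` (\<phi> -` C \<inter> cball 0 1))"
      by (rule compact_continuous_image[rotated])
         (intro continuous_at_imp_continuous_on ballI b_isCont, use cball_U in auto)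
    ultimately show ?thesis using compact_imp_closed by simp
  qed
  then have "continuous_on (cball 0 1) \<Psi>"
    using continuous_on_closed_vimage[OF closed_cball, of 0 1 \<Psi>] by blast
  then show thesis using that[of \<Psi>] \<Psi>b by (simp add: \<Psi>_def)
qed

end

section \<open>Self-intersections of the factor on the circle\<close>

context nonconst_mero begin

lemma finite_circle_minus_G: "finite (sphere 0 1 - G)"
proof -
  have "- G sparse_in sphere 0 1" by (rule sparse_in_subset[OF G_sparse]) auto
  from sparse_in_compact_finite[OF this compact_sphere] show ?thesis by (simp add: Diff_eq)
qed

text \<open>A germ between circle points maps the disc points near \<open>z\<close> to disc points of the same class; let
  them tend to \<open>z\<close>.\<close>

lemma invariant_on_circle:
  assumes inv: "\<And>z w. z \<in> G \<Longrightarrow> norm z < 1 \<Longrightarrow> w \<in> cls z \<Longrightarrow> b w = b z"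
    and cont: "\<And>z. norm z = 1 \<Longrightarrow> isCont b z"
    and z: "norm z = 1" and w: "norm w = 1" "w \<in> cls z"
  shows "(b w :: complex) = b z"
proof -
  obtain g where g: "g z = w" "germ g z" "z \<in> G" "w \<in> G" using w(2) by (auto simp: cls_def)
  have nt: "at z within ball 0 1 \<noteq> bot"
    using z by (simp add: trivial_limit_within islimpt_ball)
  have "(g \<longlongrightarrow> w) (at z within ball 0 1)"
    using analytic_at_imp_isCont[of g z] g by (auto simp: germ_def isCont_def intro: tendsto_within_subset)
  then have 1: "((\<lambda>u. b (g u)) \<longlongrightarrow> b w) (at z within ball 0 1)"
    using isCont_tendsto_compose[OF cont[OF w(1)]] by blast
  have "\<forall>\<^sub>F u in nhds z. g u \<in> cls u" using germ_eventually_cls[OF g(2,3)] g by simp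
  then have "\<forall>\<^sub>F u in at z within ball 0 1. b (g u) = b u"
    unfolding eventually_at_filter by eventually_elim (use inv cls_G in auto)
  then have "((\<lambda>u. b u) \<longlongrightarrow> b w) (at z within ball 0 1)" by (rule Lim_transform_eventually[OF 1])
  moreover have "(b \<longlongrightarrow> b z) (at z within ball 0 1)"
    using cont[OF z] by (auto simp: isCont_def intro: tendsto_within_subset)
  ultimately show ?thesis by (rule tendsto_unique[OF nt])
qed

lemma finite_noninvariant_pairs:
  assumes inv: "\<And>z w. z \<in> G \<Longrightarrow> norm z < 1 \<Longrightarrow> w \<in> cls z \<Longrightarrow> b w = b z"
    and cont: "\<And>z. norm z = 1 \<Longrightarrow> isCont b z"
  shows "finite {z \<in> sphere 0 1. \<exists>w\<in>sphere 0 1. \<phi> w = \<phi> z \<and> (b w :: complex) \<noteq> b z}"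
proof (rule finite_subset[OF _ finite_UnI[OF finite_nongerm_pairs finite_circle_minus_G]])
  show "{z \<in> sphere 0 1. \<exists>w\<in>sphere 0 1. \<phi> w = \<phi> z \<and> b w \<noteq> b z} \<subseteq>
    {z \<in> sphere 0 1. \<exists>w\<in>sphere 0 1. \<phi> w = \<phi> z \<and> w \<notin> cls z} \<union> (sphere 0 1 - G)"
    using invariant_on_circle[of b, OF inv cont] by auto
qed

end

theorem theorem4p1:
  fixes H :: disk_space and \<phi> \<psi> B :: "complex \<Rightarrow> complex"
  assumes "\<phi> \<in> mero_no_pole_cdisk"
    and "\<not> \<phi> constant_on UNIV"
    and "cowen_thomson_rep H \<phi> \<psi> B"
  shows "\<exists>\<Psi>. (\<forall>z\<in>ball 0 1. \<Psi> z = \<psi> z) \<and> FSI_property \<Psi>"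
proof -
  interpret nonconst_mero \<phi> by unfold_locales (use assms in auto)
  have B: "finite_blaschke B" and \<psi>: "\<psi> holomorphic_on ball 0 1"
    and fac: "\<And>z. norm z < 1 \<Longrightarrow> \<phi> z = \<psi> (B z)"
    and comm: "commutant H (mult_operator \<phi>) = commutant H (mult_operator B)"
    using assms(3) by (auto simp: cowen_thomson_rep_def)
  from B show ?thesis
  proof (cases rule: finite_blaschke_extension)
    case (const c)
    \<comment> \<open>A constant \<open>B\<close> would make \<open>\<phi>\<close> constant on the disc.\<close>
    have "(0::complex) \<in> ball 0 1" by simp
    then have "\<forall>\<^sub>F z in at (0::complex). z \<in> ball 0 1" by (intro eventually_at_in_open') auto
    with eventually_ne[of "\<psi> c" 0] have "\<forall>\<^sub>F z in at (0::complex). False"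
      by eventually_elim (use fac const in auto)
    then show ?thesis by simp
  next
    case (proper b U)
    interpret proper_disc_map b U by unfold_locales (use proper in auto)
    have \<phi>_cont: "isCont \<phi> z" if "norm z \<le> 1" for z
      using that cball_subset_N by (intro phi_isCont) auto
    obtain \<Psi> where \<Psi>: "\<And>z. norm z < 1 \<Longrightarrow> \<Psi> z = \<psi> z" "continuous_on (cball 0 1) \<Psi>"
      "\<And>z. norm z \<le> 1 \<Longrightarrow> \<Psi> (b z) = \<phi> z"
      by (rule factor_extends[of \<phi> \<psi>]) (use \<phi>_cont fac proper(4) in auto)
    have hol: "B holomorphic_on ball 0 1"
    proof (rule holomorphic_transform)
      show "b holomorphic_on ball 0 1" using proper(2,3) by (auto elim!: holomorphic_on_subset)
    qed (use proper(4) in auto)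
    have inv: "b w = b z" if "z \<in> G" "norm z < 1" "w \<in> cls z" for z w
    proof -
      have "B w = B z"
        using commutant_imp_invariant[OF hol _ that] cls_operator_commutant[of H] comm by blast
      then show ?thesis using proper(4) that contraction(3)[OF that(3,2)] by simp
    qed
    define E where "E = {z \<in> sphere 0 1. \<exists>w\<in>sphere 0 1. \<phi> w = \<phi> z \<and> b w \<noteq> b z}"
    have "finite E" unfolding E_def
      by (rule finite_noninvariant_pairs[of b, OF inv]) (use b_isCont in_U in auto)
    have "card {w \<in> sphere 0 1. \<Psi> w = \<Psi> \<xi>} = 1" if \<xi>: "\<xi> \<in> sphere 0 1 - b ` E" for \<xi>
    proof -
      have "\<eta> = \<xi>" if \<eta>: "\<eta> \<in> sphere 0 1" "\<Psi> \<eta> = \<Psi> \<xi>" for \<eta>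
      proof (rule ccontr)
        assume "\<eta> \<noteq> \<xi>"
        obtain z where z: "norm z = 1" "b z = \<xi>" using b_lift[of \<xi>] \<xi> by auto
        obtain w where w: "norm w = 1" "b w = \<eta>" using b_lift[of \<eta>] \<eta> by auto
        have "\<phi> w = \<phi> z" using \<Psi>(3)[of z] \<Psi>(3)[of w] z w \<eta>(2) by simp
        then have "z \<in> E" unfolding E_def using z w \<open>\<eta> \<noteq> \<xi>\<close> by auto
        then show False using \<xi> z(2) by blast
      qed
      then have "{w \<in> sphere 0 1. \<Psi> w = \<Psi> \<xi>} = {\<xi>}" using \<xi> by auto
      then show ?thesis by simp
    qed
    moreover have "b ` E \<subseteq> sphere 0 1" using b_circle by (auto simp: E_def)
    moreover have "\<Psi> holomorphic_on ball 0 1"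
      by (rule holomorphic_transform[OF \<psi>]) (use \<Psi>(1) in auto)
    ultimately have "FSI_property \<Psi>"
      unfolding FSI_property_def using \<Psi>(2) \<open>finite E\<close> by (intro conjI exI[of _ "b ` E"]) auto
    then show ?thesis using \<Psi>(1) by (intro exI[of _ \<Psi>]) auto
  qed
qed

end
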